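(* Let $k\ge -\tfrac12$, let $M=\begin{pmatrix} a & b\\ c& d\end{pmatrix}$ be a real matrix with $\det M=1$ and $b\neq 0$, let $m\in\mathbb{R}$ and $\sigma\in S^m$. Then the operator $P_{\sigma,M}:\mathcal{S}'(\mathbb{R})\to\mathcal{S}'(\mathbb{R})$, defined by $(P_{\sigma,M}u)(\phi)=u\bigl(\overline{P^*_{\sigma,M}(\overline{\phi})}\bigr)$ for $u\in\mathcal{S}'(\mathbb{R})$ and $\phi\in\mathcal{S}(\mathbb{R})$, is continuous.
   Context: Notation (the symbol is written $\sigma$ to avoid a clash with the matrix entry $a$). $d\mu_k(x)=\frac{|x|^{2k+1}}{2^{k+1}\Gamma(k+1)}dx$ on $\mathbb{R}$; $\langle f,g\rangle=\int_{\mathbb{R}}f\,\overline{g}\,d\mu_k$. Powers $(ib)^{k+1}$ use the principal branch. $\mathcal{S}'(\mathbb{R})$ is the space of tempered distributions, with convergence $u_j\to u$ meaning $u_j(\phi)\to u(\phi)$ for all $\phi\in\mathcal{S}(\mathbb{R})$ (weak-* topology). Dunkl kernel: for real $\lambda,x$, $E_k(i\lambda,x)=j_k(\lambda x)+\frac{i\lambda x}{2(k+1)}j_{k+1}(\lambda x)$, where $j_\nu(z)=\Gamma(\nu+1)\sum_{n\ge0}\frac{(-1)^n(z/2)^{2n}}{n!\,\Gamma(n+\nu+1)}$. Linear canonical Dunkl kernel: $E_k^M(\lambda,x)=e^{\frac{i}{2}\left(\frac{d}{b}\lambda^2+\frac{a}{b}x^2\right)}E_k(-i\lambda/b,x)$.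 Since $M^{-1}=\begin{pmatrix} d&-b\\-c&a\end{pmatrix}$, one has $E_k^{M^{-1}}(x,\lambda)=e^{-\frac{i}{2}\left(\frac{a}{b}x^2+\frac{d}{b}\lambda^2\right)}E_k(ix/b,\lambda)$. Linear canonical Dunkl transform: $\mathcal{D}_k^M(f)(\lambda)=\frac{1}{(ib)^{k+1}}\int_{\mathbb{R}}f(x)E_k^M(\lambda,x)\,d\mu_k(x)$. Symbol class $S^m$ ($m\in\mathbb{R}$): all $\sigma\in C^\infty(\mathbb{R}\times\mathbb{R};\mathbb{C})$ such that for all integers $l,n,r\ge0$ there is a constant $C$ with $|(1+x^2)^r\partial_x^l\partial_\lambda^n\sigma(x,\lambda)|\le C(1+|\lambda|^2)^{(m-n)/2}$ for all $x,\lambda\in\mathbb{R}$. Pseudo-differential operator on $\mathcal{S}(\mathbb{R})$: $P_{\sigma,M}(f)(x)=\int_{\mathbb{R}}\sigma(x,\lambda)\,\mathcal{D}_k^M(f)(\lambda)\,E_k^{M^{-1}}(x,\lambda)\,d\mu_k(\lambda)$. Its adjoint $P^*_{\sigma,M}:\mathcal{S}(\mathbb{R})\to\mathcal{S}(\mathbb{R})$ is determined by $\langle P_{\sigma,M}f,g\rangle=\langle f,P^*_{\sigma,M}g\rangle$ for all $f,g\in\mathcal{S}(\mathbb{R})$; explicitly (as an iterated integral) $$P^*_{\sigma,M}(g)(y)=\frac{1}{(-ib)^{k+1}}\int_{\mathbb{R}}E_k^{M^{-1}}(y,\lambda)\left(\int_{\mathbb{R}}\overline{\sigma(x,\lambda)}\,E_k^M(\lambda,x)\,g(x)\,d\mu_k(x)\right)d\mu_k(\lambda).$$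 *)

theory Defs
  imports "HOL-Analysis.Analysis"
begin

section \<open>Schwartz functions and tempered distributions on the real line\<close>

definition vderiv :: "(real \<Rightarrow> complex) \<Rightarrow> real \<Rightarrow> complex" where
  "vderiv f = (\<lambda>x. vector_derivative f (at x))"

definition smooth :: "(real \<Rightarrow> complex) \<Rightarrow> bool" where
  "smooth f \<longleftrightarrow> (\<forall>n x. (vderiv ^^ n) f differentiable (at x))"

definition schwartz :: "(real \<Rightarrow> complex) set" where
  "schwartz = {f. smooth f \<and>
     (\<forall>l n. \<exists>C. \<forall>x. \<bar>x\<bar> ^ l * norm ((vderiv ^^ n) f x) \<le> C)}"

definition schwartz_seminorm :: "nat \<Rightarrow> nat \<Rightarrow> (real \<Rightarrow> complex) \<Rightarrow> real" where
  "schwartz_seminorm l n f = (SUP x. \<bar>x\<bar> ^ l * norm ((vderiv ^^ n) f x))"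

text \<open>The usual locally convex topology: the open balls of all seminorms, around all centres,
  form a subbase.\<close>

definition schwartz_topology :: "(real \<Rightarrow> complex) topology" where
  "schwartz_topology = topology_generated_by
     {{g \<in> schwartz. schwartz_seminorm l n (\<lambda>x. g x - f x) < e} | f l n e. f \<in> schwartz \<and> 0 < e}"

text \<open>A distribution is a functional on Schwartz functions only; being extensional fixes its
  (irrelevant) values at functions outside the Schwartz space.\<close>

definition tempered_distributions :: "((real \<Rightarrow> complex) \<Rightarrow> complex) set" where
  "tempered_distributions = {u \<in> extensional schwartz.
     (\<forall>f\<in>schwartz. \<forall>g\<in>schwartz. u (\<lambda>x. f x + g x) = u f + u g) \<and>
     (\<forall>z. \<forall>f\<in>schwartz. u (\<lambda>x. z * f x) = z * u f) \<and>
     continuous_map schwartz_topology euclidean u}"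

text \<open>The weak-* topology, that is, the topology of pointwise convergence on Schwartz functions.\<close>

definition weak_star_topology :: "((real \<Rightarrow> complex) \<Rightarrow> complex) topology" where
  "weak_star_topology =
     subtopology (product_topology (\<lambda>_. euclidean) schwartz) tempered_distributions"

lemma topspace_schwartz_topology: "topspace schwartz_topology = schwartz"
proof
  show "topspace schwartz_topology \<subseteq> schwartz"
    unfolding schwartz_topology_def topology_generated_by_topspace by (rule Union_least) auto
next
  show "schwartz \<subseteq> topspace schwartz_topology"
  proof
    fix f assume f: "f \<in> schwartz"
    let ?B = "{g \<in> schwartz. schwartz_seminorm 0 0 (\<lambda>x. g x - f x) < 1}"
    have mem: "f \<in> ?B"
      using f by (simp add: schwartz_seminorm_def)
    have "openin schwartz_topology ?B"
      unfolding schwartz_topology_def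
      by (rule topology_generated_by_Basis, rule CollectI, intro exI conjI)
        (rule refl f zero_less_one)+
    then show "f \<in> topspace schwartz_topology"
      by (rule subsetD[OF openin_subset mem])
  qed
qed

lemma topspace_weak_star_topology: "topspace weak_star_topology = tempered_distributions"
proof -
  have "tempered_distributions \<subseteq> extensional schwartz"
    unfolding tempered_distributions_def by (rule Collect_restrict)
  then show ?thesis
    by (simp add: weak_star_topology_def PiE_def Int_absorb1)
qed


section \<open>The symbol classes\<close>

definition pderiv_fst :: "(real \<Rightarrow> real \<Rightarrow> complex) \<Rightarrow> real \<Rightarrow> real \<Rightarrow> complex" where
  "pderiv_fst s = (\<lambda>x y. vector_derivative (\<lambda>t. s t y) (at x))"

definition pderiv_snd :: "(real \<Rightarrow> real \<Rightarrow> complex) \<Rightarrow> real \<Rightarrow> real \<Rightarrow> complex" where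
  "pderiv_snd s = (\<lambda>x y. vector_derivative (\<lambda>t. s x t) (at y))"

text \<open>The class \<open>C\<^sup>n\<close> on the plane: all partial derivatives of order at most \<open>n\<close>, taken in any
  order, exist and are jointly continuous.\<close>

primrec Cn_plane :: "nat \<Rightarrow> (real \<Rightarrow> real \<Rightarrow> complex) \<Rightarrow> bool" where
  "Cn_plane 0 s \<longleftrightarrow> continuous_on UNIV (\<lambda>(x, y). s x y)"
| "Cn_plane (Suc n) s \<longleftrightarrow>
     continuous_on UNIV (\<lambda>(x, y). s x y) \<and>
     (\<forall>x y. (\<lambda>t. s t y) differentiable (at x) \<and> (\<lambda>t. s x t) differentiable (at y)) \<and>
     Cn_plane n (pderiv_fst s) \<and> Cn_plane n (pderiv_snd s)"

definition symbol_class :: "real \<Rightarrow> (real \<Rightarrow> real \<Rightarrow> complex) set" where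
  "symbol_class m = {s. (\<forall>n. Cn_plane n s) \<and>
     (\<forall>l n r. \<exists>C. \<forall>x \<xi>.
        norm (of_real ((1 + x\<^sup>2) ^ r) * (pderiv_fst ^^ l) ((pderiv_snd ^^ n) s) x \<xi>)
          \<le> C * (1 + \<bar>\<xi>\<bar>\<^sup>2) powr ((m - real n) / 2))}"


section \<open>The linear canonical Dunkl transform\<close>

text \<open>For \<open>k = -1/2\<close> the density is that of a multiple of Lebesgue measure; the convention
  \<open>0 powr 0 = 0\<close> changes it at the origin only.\<close>

definition dunkl_measure :: "real \<Rightarrow> real measure" where
  "dunkl_measure k =
     density lborel (\<lambda>x. ennreal (\<bar>x\<bar> powr (2 * k + 1) / (2 powr (k + 1) * Gamma (k + 1))))"

definition dunkl_inner :: "real \<Rightarrow> (real \<Rightarrow> complex) \<Rightarrow> (real \<Rightarrow> complex) \<Rightarrow> complex" where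
  "dunkl_inner k f g = (LINT x|dunkl_measure k. f x * cnj (g x))"

definition bessel_j :: "real \<Rightarrow> real \<Rightarrow> real" where
  "bessel_j \<nu> z =
     Gamma (\<nu> + 1) * (\<Sum>n. (-1) ^ n * (z / 2) ^ (2 * n) / (fact n * Gamma (real n + \<nu> + 1)))"

text \<open>\<open>dunkl_kernel k \<xi> x\<close> is the Dunkl kernel \<open>E\<^sub>k(i\<xi>, x)\<close>: the imaginary unit in the
  first argument is implicit.\<close>

definition dunkl_kernel :: "real \<Rightarrow> real \<Rightarrow> real \<Rightarrow> complex" where
  "dunkl_kernel k \<xi> x =
     of_real (bessel_j k (\<xi> * x)) +
     \<i> * of_real (\<xi> * x) / of_real (2 * (k + 1)) * of_real (bessel_j (k + 1) (\<xi> * x))"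

text \<open>The entries of \<open>M\<close> are \<open>a = M $ 1 $ 1\<close>, \<open>b = M $ 1 $ 2\<close>, \<open>c = M $ 2 $ 1\<close> and
  \<open>d = M $ 2 $ 2\<close>.\<close>

definition lc_kernel :: "real \<Rightarrow> real ^ 2 ^ 2 \<Rightarrow> real \<Rightarrow> real \<Rightarrow> complex" where
  "lc_kernel k M \<xi> x =
     exp (\<i> / 2 * of_real (M $ 2 $ 2 / M $ 1 $ 2 * \<xi>\<^sup>2 + M $ 1 $ 1 / M $ 1 $ 2 * x\<^sup>2)) *
     dunkl_kernel k (- \<xi> / M $ 1 $ 2) x"

definition lc_dunkl :: "real \<Rightarrow> real ^ 2 ^ 2 \<Rightarrow> (real \<Rightarrow> complex) \<Rightarrow> real \<Rightarrow> complex" where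
  "lc_dunkl k M f \<xi> =
     1 / ((\<i> * of_real (M $ 1 $ 2)) powr of_real (k + 1)) *
     (LINT x|dunkl_measure k. f x * lc_kernel k M \<xi> x)"

lemma matrix_inv_2x2:
  fixes M :: "real ^ 2 ^ 2"
  assumes "det M = 1"
  shows "matrix_inv M = vector [vector [M $ 2 $ 2, - M $ 1 $ 2], vector [- M $ 2 $ 1, M $ 1 $ 1]]"
    (is "_ = ?N")
proof -
  have d: "M $ 1 $ 1 * M $ 2 $ 2 - M $ 1 $ 2 * M $ 2 $ 1 = 1"
    using assms by (simp add: det_2)
  have "M ** ?N = mat 1" "?N ** M = mat 1"
    using d by (simp_all add: vec_eq_iff matrix_matrix_mult_def mat_def sum_2 forall_2 algebra_simps)
  moreover from this have "matrix_inv M ** M = mat 1"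
    unfolding matrix_inv_def
    by (metis (mono_tags, lifting) someI_ex)
  ultimately show ?thesis
    using matrix_mul_assoc[of "matrix_inv M" M ?N] by simp
qed

lemma lc_kernel_matrix_inv:
  fixes M :: "real ^ 2 ^ 2"
  assumes "det M = 1"
  shows "lc_kernel k (matrix_inv M) x \<xi> =
     exp (- \<i> / 2 * of_real (M $ 1 $ 1 / M $ 1 $ 2 * x\<^sup>2 + M $ 2 $ 2 / M $ 1 $ 2 * \<xi>\<^sup>2)) *
     dunkl_kernel k (x / M $ 1 $ 2) \<xi>"
proof -
  have "M $ 1 $ 1 / - M $ 1 $ 2 * x\<^sup>2 + M $ 2 $ 2 / - M $ 1 $ 2 * \<xi>\<^sup>2 =
      - (M $ 1 $ 1 / M $ 1 $ 2 * x\<^sup>2 + M $ 2 $ 2 / M $ 1 $ 2 * \<xi>\<^sup>2)"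
    by simp
  moreover have "\<i> / 2 * of_real (- r) = - \<i> / 2 * complex_of_real r" for r
    by simp
  moreover have "- x / - M $ 1 $ 2 = x / M $ 1 $ 2"
    by simp
  ultimately show ?thesis
    unfolding lc_kernel_def matrix_inv_2x2[OF assms] vector_2 by (simp only:)
qed


section \<open>Pseudo-differential operators\<close>

definition pseudo_op ::
  "real \<Rightarrow> real ^ 2 ^ 2 \<Rightarrow> (real \<Rightarrow> real \<Rightarrow> complex) \<Rightarrow> (real \<Rightarrow> complex) \<Rightarrow> real \<Rightarrow> complex" where
  "pseudo_op k M s f x =
     (LINT \<xi>|dunkl_measure k. s x \<xi> * lc_dunkl k M f \<xi> * lc_kernel k (matrix_inv M) x \<xi>)"

definition pseudo_op_adj ::
  "real \<Rightarrow> real ^ 2 ^ 2 \<Rightarrow> (real \<Rightarrow> real \<Rightarrow> complex) \<Rightarrow> (real \<Rightarrow> complex) \<Rightarrow> real \<Rightarrow> complex" where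
  "pseudo_op_adj k M s g y =
     1 / ((- (\<i> * of_real (M $ 1 $ 2))) powr of_real (k + 1)) *
     (LINT \<xi>|dunkl_measure k. lc_kernel k (matrix_inv M) y \<xi> *
        (LINT x|dunkl_measure k. cnj (s x \<xi>) * lc_kernel k M \<xi> x * g x))"

definition schwartz_adjoint :: "real \<Rightarrow>
    ((real \<Rightarrow> complex) \<Rightarrow> real \<Rightarrow> complex) \<Rightarrow> ((real \<Rightarrow> complex) \<Rightarrow> real \<Rightarrow> complex) \<Rightarrow> bool" where
  "schwartz_adjoint k P Q \<longleftrightarrow>
     (\<forall>g\<in>schwartz. Q g \<in> schwartz) \<and>
     (\<forall>f\<in>schwartz. \<forall>g\<in>schwartz. dunkl_inner k (P f) g = dunkl_inner k f (Q g))"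

definition pseudo_op_dist :: "real \<Rightarrow> real ^ 2 ^ 2 \<Rightarrow> (real \<Rightarrow> real \<Rightarrow> complex) \<Rightarrow>
    ((real \<Rightarrow> complex) \<Rightarrow> complex) \<Rightarrow> (real \<Rightarrow> complex) \<Rightarrow> complex" where
  "pseudo_op_dist k M s u =
     (\<lambda>\<phi>\<in>schwartz. u (\<lambda>y. cnj (pseudo_op_adj k M s (\<lambda>x. cnj (\<phi> x)) y)))"

end

theory Submission
  imports Defs "HOL-Probability.Sinc_Integral"
begin

text \<open>Everything rests on one class of operators: for an amplitude \<open>s\<close> and \<open>c \<noteq> 0\<close>,
  \<open>g \<mapsto> (\<integral> s x \<xi> E\<^sub>k(i c \<xi>, x) g x d\<mu>\<^sub>k(x))\<close> maps the Schwartz space continuously to itself. The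
  transform, its inverse and the inner integral of the adjoint are of this form, the amplitude being a
  product of chirps with the conjugate symbol, so the adjoint is a composition of two such operators
  and its transpose is weak-* continuous; the adjoint identity is Fubini's theorem, used twice.

  To estimate the operator only two bounds are needed. Derivatives in \<open>\<xi>\<close> grow at most polynomially,
  by differentiation under the integral and because the Bessel functions \<open>j\<^sub>\<nu>\<close> are bounded (by an
  energy estimate from their differential equation). The function itself decays rapidly, since the
  Dunkl operator has the kernel as eigenfunction and is antisymmetric for \<open>\<mu>\<^sub>k\<close>. Landau's
  interpolation inequality then turns these into rapid decay of all derivatives.\<close>

section \<open>Families of functions with derivatives of polynomial growth\<close>

text \<open>The obstacle is that the amplitude depends on both variables, so derivatives in
  \<open>\<xi>\<close> cannot simply be traded for multiplications by \<open>x\<close>, as they can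
  for a pure transform. Decay is therefore proved with \<open>\<xi>\<close> frozen: the value at
  \<open>\<xi>\<close> is the Dunkl transform, at frequency \<open>c * \<xi>\<close>, of the
  Schwartz function \<open>\<lambda>x. s x \<xi> * g x\<close>, and only the size of the seminorms
  of this function in terms of \<open>\<xi>\<close> matters. Derivatives in \<open>\<xi>\<close>
  never need more than a crude growth bound. Such an argument needs estimates that are uniform in
  parameters of several kinds: the test function, the point \<open>x\<close>, the frequency
  \<open>\<xi>\<close>, or a pair of these. Hence everything is stated for families indexed by a
  set, measured by an increasing sequence of weights. With the Schwartz space as index set and its
  norms as weights, a bound for the family is a continuity estimate for an operator; with points as
  indices and powers as weights, it is a growth estimate for a kernel or a symbol.\<close>

lemma vderiv_pow_Suc: "(vderiv ^^ n) (vderiv f) = (vderiv ^^ Suc n) f"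
  by (simp add: funpow_swap1)

lemma has_vector_derivative_vderiv:
  "f differentiable (at x) \<Longrightarrow> (f has_vector_derivative vderiv f x) (at x)"
  by (simp add: vderiv_def vector_derivative_works)

lemma vderiv_eqI: "(\<And>x. (f has_vector_derivative f' x) (at x)) \<Longrightarrow> vderiv f = f'"
  by (auto simp: vderiv_def fun_eq_iff intro: vector_derivative_at)

lemma smooth_vderiv: "smooth f \<Longrightarrow> smooth (vderiv f)"
  unfolding smooth_def vderiv_pow_Suc by blast

lemma smooth_has_vector_derivative:
  "smooth f \<Longrightarrow> ((vderiv ^^ n) f has_vector_derivative (vderiv ^^ Suc n) f x) (at x)"
  by (simp add: has_vector_derivative_vderiv smooth_def)

lemma smooth_continuous_on: "smooth f \<Longrightarrow> continuous_on S ((vderiv ^^ n) f)"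
  unfolding smooth_def
  by (meson continuous_at_imp_continuous_on differentiable_imp_continuous_within)

lemma smooth_continuous_on_0: "smooth f \<Longrightarrow> continuous_on S f"
  using smooth_continuous_on[of f S 0] by simp

text \<open>The weights play the role of an increasing sequence of seminorms on the parameter.
  Estimates may raise the index \<open>N\<close>, as continuity estimates between Frechet spaces
  do.\<close>

definition weight :: "'p set \<Rightarrow> (nat \<Rightarrow> 'p \<Rightarrow> real) \<Rightarrow> bool" where
  "weight I W \<longleftrightarrow> (\<forall>p\<in>I. mono (\<lambda>N. W N p) \<and> 0 \<le> W 0 p)"

lemma weight_mono: "weight I W \<Longrightarrow> p \<in> I \<Longrightarrow> M \<le> N \<Longrightarrow> W M p \<le> W N p"
  by (auto simp: weight_def mono_def)

lemma weight_nonneg: "weight I W \<Longrightarrow> p \<in> I \<Longrightarrow> 0 \<le> W N p"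
  using weight_mono[of I W p 0 N] by (auto simp: weight_def)

text \<open>Any number above both the constant and the index can replace the two, by monotonicity of
  the weights.\<close>

lemma weight_bound:
  assumes "weight I W" "p \<in> I" "C \<le> real K" "M \<le> K"
  shows "C * W M p \<le> real K * W K p"
proof -
  have "C * W M p \<le> real K * W M p"
    by (intro mult_right_mono assms weight_nonneg[OF assms(1,2)])
  also have "\<dots> \<le> real K * W K p"
    by (intro mult_left_mono weight_mono[OF assms(1,2)] assms) auto
  finally show ?thesis .
qed

text \<open>One number \<open>N\<close> serves as constant, as index of the weight and as exponent.\<close>

definition poly_bounded :: "'p set \<Rightarrow> (nat \<Rightarrow> 'p \<Rightarrow> real) \<Rightarrow> ('p \<Rightarrow> real \<Rightarrow> complex) \<Rightarrow> bool" where
  "poly_bounded I W \<Phi> \<longleftrightarrow>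
     (\<exists>N. \<forall>p\<in>I. \<forall>x. norm (\<Phi> p x) \<le> real N * W N p * (1 + \<bar>x\<bar>) ^ N)"

lemma poly_boundedI:
  assumes W: "weight I W"
    and le: "\<And>p x. p \<in> I \<Longrightarrow> norm (\<Phi> p x) \<le> C * W M p * (1 + \<bar>x\<bar>) ^ L"
  shows "poly_bounded I W \<Phi>"
proof -
  define K where "K = nat \<lceil>C\<rceil> + M + L"
  have "norm (\<Phi> p x) \<le> real K * W K p * (1 + \<bar>x\<bar>) ^ K" if p: "p \<in> I" for p x
  proof -
    have "C \<le> real K" unfolding K_def by linarith
    then have "C * W M p * (1 + \<bar>x\<bar>) ^ L \<le> (real K * W K p) * (1 + \<bar>x\<bar>) ^ L"
      by (intro mult_right_mono weight_bound[OF W p]) (auto simp: K_def)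
    also have "\<dots> \<le> (real K * W K p) * (1 + \<bar>x\<bar>) ^ K"
      by (intro mult_left_mono power_increasing mult_nonneg_nonneg weight_nonneg[OF W p])
        (auto simp: K_def)
    finally show ?thesis using le[OF p, of x] by linarith
  qed
  then show ?thesis by (auto simp: poly_bounded_def)
qed

lemma poly_bounded_add:
  assumes W: "weight I W" and "poly_bounded I W \<Phi>" "poly_bounded I W \<Psi>"
  shows "poly_bounded I W (\<lambda>p x. \<Phi> p x + \<Psi> p x)"
proof -
  obtain A where A: "\<And>p x. p \<in> I \<Longrightarrow> norm (\<Phi> p x) \<le> real A * W A p * (1 + \<bar>x\<bar>) ^ A"
    using assms unfolding poly_bounded_def by blast
  obtain B where B: "\<And>p x. p \<in> I \<Longrightarrow> norm (\<Psi> p x) \<le> real B * W B p * (1 + \<bar>x\<bar>) ^ B"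
    using assms unfolding poly_bounded_def by blast
  show ?thesis
  proof (rule poly_boundedI[OF W])
    fix p x assume p: "p \<in> I"
    have aux: "real D * W D p * (1 + \<bar>x\<bar>) ^ D \<le> real D * W (A + B) p * (1 + \<bar>x\<bar>) ^ (A + B)"
      if "D \<le> A + B" for D
      using that by (intro mult_mono power_increasing mult_nonneg_nonneg weight_nonneg[OF W p]
          weight_mono[OF W p]) auto
    have "norm (\<Phi> p x + \<Psi> p x) \<le> norm (\<Phi> p x) + norm (\<Psi> p x)" by (rule norm_triangle_ineq)
    also have "\<dots> \<le> real A * W A p * (1 + \<bar>x\<bar>) ^ A + real B * W B p * (1 + \<bar>x\<bar>) ^ B"
      by (intro add_mono A B p)
    also have "\<dots> \<le> real A * W (A + B) p * (1 + \<bar>x\<bar>) ^ (A + B)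
        + real B * W (A + B) p * (1 + \<bar>x\<bar>) ^ (A + B)"
      by (intro add_mono aux) auto
    finally show "norm (\<Phi> p x + \<Psi> p x) \<le> real (A + B) * W (A + B) p * (1 + \<bar>x\<bar>) ^ (A + B)"
      by (simp add: algebra_simps)
  qed
qed

lemma poly_bounded_mult:
  assumes U: "weight I U" and V: "weight I V" and W: "weight I W"
    and UV: "\<And>p N M. p \<in> I \<Longrightarrow> U N p * V M p \<le> W (N + M) p"
    and "poly_bounded I U \<Phi>" "poly_bounded I V \<Psi>"
  shows "poly_bounded I W (\<lambda>p x. \<Phi> p x * \<Psi> p x)"
proof -
  obtain A where A: "\<And>p x. p \<in> I \<Longrightarrow> norm (\<Phi> p x) \<le> real A * U A p * (1 + \<bar>x\<bar>) ^ A"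
    using assms unfolding poly_bounded_def by blast
  obtain B where B: "\<And>p x. p \<in> I \<Longrightarrow> norm (\<Psi> p x) \<le> real B * V B p * (1 + \<bar>x\<bar>) ^ B"
    using assms unfolding poly_bounded_def by blast
  show ?thesis
  proof (rule poly_boundedI[OF W])
    fix p x assume p: "p \<in> I"
    have "norm (\<Phi> p x * \<Psi> p x) = norm (\<Phi> p x) * norm (\<Psi> p x)" by (rule norm_mult)
    also have "\<dots> \<le> (real A * U A p * (1 + \<bar>x\<bar>) ^ A) * (real B * V B p * (1 + \<bar>x\<bar>) ^ B)"
      by (intro mult_mono A B p mult_nonneg_nonneg weight_nonneg[OF U p]) auto
    also have "\<dots> = (real A * real B) * (U A p * V B p) * (1 + \<bar>x\<bar>) ^ (A + B)"
      by (simp add: power_add)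
    also have "\<dots> \<le> (real A * real B) * W (A + B) p * (1 + \<bar>x\<bar>) ^ (A + B)"
      by (intro mult_right_mono mult_left_mono UV p) auto
    finally show "norm (\<Phi> p x * \<Psi> p x) \<le> (real A * real B) * W (A + B) p * (1 + \<bar>x\<bar>) ^ (A + B)" .
  qed
qed

text \<open>The recursion runs over the first derivative, so that sums and products need the rules
  for one derivative only and no Leibniz formula for iterated derivatives.\<close>

primrec tame :: "'p set \<Rightarrow> (nat \<Rightarrow> 'p \<Rightarrow> real) \<Rightarrow> nat \<Rightarrow> ('p \<Rightarrow> real \<Rightarrow> complex) \<Rightarrow> bool" where
  "tame I W 0 \<Phi> \<longleftrightarrow> poly_bounded I W \<Phi>"
| "tame I W (Suc n) \<Phi> \<longleftrightarrow> poly_bounded I W \<Phi> \<and> (\<forall>p\<in>I. \<forall>x. \<Phi> p differentiable (at x)) \<and>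
     tame I W n (\<lambda>p. vderiv (\<Phi> p))"

lemma tame_poly_bounded: "tame I W n \<Phi> \<Longrightarrow> poly_bounded I W \<Phi>"
  by (cases n) auto

lemma poly_bounded_cong:
  "(\<And>p x. p \<in> I \<Longrightarrow> \<Phi> p x = \<Psi> p x) \<Longrightarrow> poly_bounded I W \<Phi> \<longleftrightarrow> poly_bounded I W \<Psi>"
  by (simp add: poly_bounded_def)

lemma tame_cong: "(\<And>p. p \<in> I \<Longrightarrow> \<Phi> p = \<Psi> p) \<Longrightarrow> tame I W n \<Phi> \<longleftrightarrow> tame I W n \<Psi>"
proof (induction n arbitrary: \<Phi> \<Psi>)
  case 0
  then show ?case by (simp cong: poly_bounded_cong)
next
  case (Suc n)
  have "tame I W n (\<lambda>p. vderiv (\<Phi> p)) \<longleftrightarrow> tame I W n (\<lambda>p. vderiv (\<Psi> p))"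
    by (rule Suc.IH) (simp add: Suc.prems)
  with Suc.prems show ?case by (simp cong: poly_bounded_cong)
qed

lemma tame_SucI:
  assumes "poly_bounded I W \<Phi>" "\<And>p x. p \<in> I \<Longrightarrow> (\<Phi> p has_vector_derivative \<Psi> p x) (at x)"
    and "tame I W n \<Psi>"
  shows "tame I W (Suc n) \<Phi>"
proof -
  have "tame I W n (\<lambda>p. vderiv (\<Phi> p)) \<longleftrightarrow> tame I W n \<Psi>"
    by (rule tame_cong, rule vderiv_eqI, rule assms(2))
  moreover have "\<forall>p\<in>I. \<forall>x. \<Phi> p differentiable (at x)"
    using assms(2) differentiableI_vector by blast
  ultimately show ?thesis using assms(1,3) by simp
qed

lemma tame_SucD: "tame I W (Suc n) \<Phi> \<Longrightarrow> tame I W n \<Phi>"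
  by (induction n arbitrary: \<Phi>) auto

lemma tame_derivative:
  "tame I W (Suc n) \<Phi> \<Longrightarrow> p \<in> I \<Longrightarrow> (\<Phi> p has_vector_derivative vderiv (\<Phi> p) x) (at x)"
  by (simp add: has_vector_derivative_vderiv)

lemma tame_add:
  assumes W: "weight I W"
  shows "tame I W n \<Phi> \<Longrightarrow> tame I W n \<Psi> \<Longrightarrow> tame I W n (\<lambda>p x. \<Phi> p x + \<Psi> p x)"
proof (induction n arbitrary: \<Phi> \<Psi>)
  case 0
  then show ?case using poly_bounded_add[OF W] by simp
next
  case (Suc n)
  show ?case
  proof (rule tame_SucI)
    show "poly_bounded I W (\<lambda>p x. \<Phi> p x + \<Psi> p x)"
      using Suc.prems by (intro poly_bounded_add[OF W]) (auto dest: tame_poly_bounded)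
    show "((\<lambda>x. \<Phi> p x + \<Psi> p x) has_vector_derivative vderiv (\<Phi> p) x + vderiv (\<Psi> p) x) (at x)"
      if "p \<in> I" for p x
      using that Suc.prems by (intro has_vector_derivative_add tame_derivative)
    show "tame I W n (\<lambda>p x. vderiv (\<Phi> p) x + vderiv (\<Psi> p) x)"
      using Suc.IH[of "\<lambda>p. vderiv (\<Phi> p)" "\<lambda>p. vderiv (\<Psi> p)"] Suc.prems by simp
  qed
qed

text \<open>The weights of the factors may differ, for instance a power of the frequency and a
  Schwartz norm; it is enough that their indices add up. In the induction each summand of the
  product rule has one factor differentiated and the other lowered by one order with
  \<open>tame_SucD\<close>.\<close>

lemma tame_mult:
  assumes U: "weight I U" and V: "weight I V" and W: "weight I W"
    and UV: "\<And>p N M. p \<in> I \<Longrightarrow> U N p * V M p \<le> W (N + M) p"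
  shows "tame I U n \<Phi> \<Longrightarrow> tame I V n \<Psi> \<Longrightarrow> tame I W n (\<lambda>p x. \<Phi> p x * \<Psi> p x)"
proof (induction n arbitrary: \<Phi> \<Psi>)
  case 0
  then show ?case using poly_bounded_mult[OF U V W UV] by simp
next
  case (Suc n)
  show ?case
  proof (rule tame_SucI)
    show "poly_bounded I W (\<lambda>p x. \<Phi> p x * \<Psi> p x)"
      using Suc.prems by (intro poly_bounded_mult[OF U V W UV]) (auto dest: tame_poly_bounded)
    show "((\<lambda>x. \<Phi> p x * \<Psi> p x) has_vector_derivative
        \<Phi> p x * vderiv (\<Psi> p) x + vderiv (\<Phi> p) x * \<Psi> p x) (at x)"
      if "p \<in> I" for p x
      using that Suc.prems by (intro has_vector_derivative_mult tame_derivative)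
    show "tame I W n (\<lambda>p x. \<Phi> p x * vderiv (\<Psi> p) x + vderiv (\<Phi> p) x * \<Psi> p x)"
    proof (rule tame_add[OF W])
      show "tame I W n (\<lambda>p x. \<Phi> p x * vderiv (\<Psi> p) x)"
        using Suc.prems(2) by (intro Suc.IH tame_SucD[OF Suc.prems(1)]) simp
      show "tame I W n (\<lambda>p x. vderiv (\<Phi> p) x * \<Psi> p x)"
        using Suc.prems(1) by (intro Suc.IH tame_SucD[OF Suc.prems(2)]) simp
    qed
  qed
qed

lemma tame_iff:
  "(\<forall>n. tame I W n \<Phi>) \<longleftrightarrow>
     (\<forall>p\<in>I. smooth (\<Phi> p)) \<and> (\<forall>n. poly_bounded I W (\<lambda>p. (vderiv ^^ n) (\<Phi> p)))"
proof -
  \<comment> \<open>At order \<open>n\<close> the derivative of order \<open>n\<close> is bounded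
    but may fail to be differentiable, hence \<open>j < n\<close> beside \<open>j \<le> n\<close>.
    The difference disappears once all \<open>n\<close> are taken.\<close>
  have *: "tame I W n \<Phi> \<longleftrightarrow> (\<forall>p\<in>I. \<forall>j<n. \<forall>x. (vderiv ^^ j) (\<Phi> p) differentiable (at x)) \<and>
      (\<forall>j\<le>n. poly_bounded I W (\<lambda>p. (vderiv ^^ j) (\<Phi> p)))" for n
  proof (induction n arbitrary: \<Phi>)
    case (Suc n)
    have all_less: "(\<forall>j<Suc n. P j) \<longleftrightarrow> P 0 \<and> (\<forall>j<n. P (Suc j))" for P
      using less_Suc_eq_0_disj by auto
    have all_le: "(\<forall>j\<le>Suc n. P j) \<longleftrightarrow> P 0 \<and> (\<forall>j\<le>n. P (Suc j))" for P
      by (simp add: All_less_Suc2 flip: less_Suc_eq_le)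
    show ?case
      unfolding tame.simps Suc.IH vderiv_pow_Suc all_less all_le by auto
  qed simp
  show ?thesis
    unfolding smooth_def * by (meson lessI order_refl)
qed

lemma tame_const:
  assumes W: "weight I W" and "\<And>p. p \<in> I \<Longrightarrow> norm (c p) \<le> C * W M p"
  shows "tame I W n (\<lambda>p x. c p)"
proof -
  have [simp]: "poly_bounded I W (\<lambda>p x. c p)"
    using assms by (intro poly_boundedI[where C = C and M = M and L = 0]) auto
  have [simp]: "poly_bounded I W (\<lambda>p x. 0)"
    by (rule poly_boundedI[OF W, where C = 0]) auto
  have z: "tame I W n (\<lambda>p x. 0)" for n
    by (induction n) (auto intro!: tame_SucI[where \<Psi> = "\<lambda>p x. 0"] simp del: tame.simps(2))
  show ?thesis
    by (cases n) (auto intro!: tame_SucI[where \<Psi> = "\<lambda>p x. 0"] z simp del: tame.simps(2))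
qed

lemma tame_cmult:
  assumes W: "weight I W" and "tame I W n \<Phi>"
  shows "tame I W n (\<lambda>p x. c * \<Phi> p x)"
proof (rule tame_mult[where U = "\<lambda>_ _. 1" and V = W])
  have U: "weight I (\<lambda>_ _. 1)" by (auto simp: weight_def intro: monoI)
  then show "weight I (\<lambda>_ _. 1)" .
  show "tame I (\<lambda>_ _. 1) n (\<lambda>p x. c)"
    by (rule tame_const[OF U, where C = "norm c"]) simp
  show "1 * W M p \<le> W (N + M) p" if "p \<in> I" for p N M
    using weight_mono[OF W that] by simp
qed (use assms in auto)

lemma tame_cnj: "tame I W n \<Phi> \<Longrightarrow> tame I W n (\<lambda>p x. cnj (\<Phi> p x))"
proof (induction n arbitrary: \<Phi>)
  case 0
  then show ?case by (simp add: poly_bounded_def)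
next
  case (Suc n)
  show ?case
  proof (rule tame_SucI)
    show "poly_bounded I W (\<lambda>p x. cnj (\<Phi> p x))"
      using Suc.prems by (simp add: poly_bounded_def)
    show "((\<lambda>x. cnj (\<Phi> p x)) has_vector_derivative cnj (vderiv (\<Phi> p) x)) (at x)" if "p \<in> I" for p x
      using tame_derivative[OF Suc.prems that] by (rule has_vector_derivative_cnj)
    show "tame I W n (\<lambda>p x. cnj (vderiv (\<Phi> p) x))"
      using Suc.prems by (intro Suc.IH) simp
  qed
qed

text \<open>Pulls a family back along a change of parameter \<open>\<pi>\<close>. The loss of a
  constant and of an index in the weight makes room for a rescaling of the parameter.\<close>

lemma tame_reweight:
  assumes V: "weight J V" and "tame I W n \<Phi>" "\<And>q. q \<in> J \<Longrightarrow> \<pi> q \<in> I"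
    and le: "\<And>N. \<exists>C M. \<forall>q\<in>J. W N (\<pi> q) \<le> C * V M q"
  shows "tame J V n (\<lambda>q. \<Phi> (\<pi> q))"
proof -
  have *: "poly_bounded J V (\<lambda>q. \<Phi> (\<pi> q))" if pb: "poly_bounded I W \<Phi>" for \<Phi>
  proof -
    obtain N where N: "\<And>p x. p \<in> I \<Longrightarrow> norm (\<Phi> p x) \<le> real N * W N p * (1 + \<bar>x\<bar>) ^ N"
      using pb unfolding poly_bounded_def by blast
    obtain C M where CM: "\<And>q. q \<in> J \<Longrightarrow> W N (\<pi> q) \<le> C * V M q"
      using le by blast
    show ?thesis
    proof (rule poly_boundedI[OF V])
      fix q x assume q: "q \<in> J"
      have "norm (\<Phi> (\<pi> q) x) \<le> real N * W N (\<pi> q) * (1 + \<bar>x\<bar>) ^ N"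
        by (rule N[OF assms(3)[OF q]])
      also have "\<dots> \<le> real N * (C * V M q) * (1 + \<bar>x\<bar>) ^ N"
        by (intro mult_right_mono mult_left_mono CM q) auto
      finally show "norm (\<Phi> (\<pi> q) x) \<le> (real N * C) * V M q * (1 + \<bar>x\<bar>) ^ N"
        by (simp add: mult.assoc)
    qed
  qed
  show ?thesis
    using assms(2)
  proof (induction n arbitrary: \<Phi>)
    case (Suc n)
    then show ?case using Suc.IH[of "\<lambda>p. vderiv (\<Phi> p)"] by (auto simp: * assms(3))
  qed (simp add: *)
qed

lemma tame_reindex:
  assumes V: "weight J V" and "tame I W n \<Phi>" "\<And>q. q \<in> J \<Longrightarrow> \<pi> q \<in> I"
    and le: "\<And>N q. q \<in> J \<Longrightarrow> W N (\<pi> q) \<le> V N q"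
  shows "tame J V n (\<lambda>q. \<Phi> (\<pi> q))"
proof (rule tame_reweight[OF assms(1-3)])
  show "\<exists>C M. \<forall>q\<in>J. W N (\<pi> q) \<le> C * V M q" for N
    using le[of _ N] by (intro exI[of _ 1] exI[of _ N]) simp
qed

subsection \<open>Rapid decrease\<close>

text \<open>With \<open>1 + \<bar>x\<bar>\<close> instead of \<open>\<bar>x\<bar>\<close> a single
  power controls all lower ones, including plain boundedness.\<close>

definition rapid :: "'p set \<Rightarrow> (nat \<Rightarrow> 'p \<Rightarrow> real) \<Rightarrow> ('p \<Rightarrow> real \<Rightarrow> complex) \<Rightarrow> bool" where
  "rapid I W \<Phi> \<longleftrightarrow>
     (\<forall>l. \<exists>N. \<forall>p\<in>I. \<forall>x. (1 + \<bar>x\<bar>) ^ l * norm (\<Phi> p x) \<le> real N * W N p)"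

lemma rapidI:
  assumes "weight I W"
    and "\<And>l. \<exists>C M. \<forall>p\<in>I. \<forall>x. (1 + \<bar>x\<bar>) ^ l * norm (\<Phi> p x) \<le> C * W M p"
  shows "rapid I W \<Phi>"
  unfolding rapid_def
proof
  fix l
  obtain C M where CM: "\<And>p x. p \<in> I \<Longrightarrow> (1 + \<bar>x\<bar>) ^ l * norm (\<Phi> p x) \<le> C * W M p"
    using assms(2) by blast
  show "\<exists>N. \<forall>p\<in>I. \<forall>x. (1 + \<bar>x\<bar>) ^ l * norm (\<Phi> p x) \<le> real N * W N p"
  proof (intro exI ballI allI)
    fix p x assume p: "p \<in> I"
    have "C \<le> real (nat \<lceil>C\<rceil> + M)" by linarith
    then show "(1 + \<bar>x\<bar>) ^ l * norm (\<Phi> p x) \<le> real (nat \<lceil>C\<rceil> + M) * W (nat \<lceil>C\<rceil> + M) p"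
      using CM[OF p] weight_bound[OF assms(1) p] by (meson le_add2 order_trans)
  qed
qed

lemma rapid_add:
  assumes W: "weight I W" and "rapid I W \<Phi>" "rapid I W \<Psi>"
  shows "rapid I W (\<lambda>p x. \<Phi> p x + \<Psi> p x)"
proof (rule rapidI[OF W])
  fix l
  obtain A where A: "\<And>p x. p \<in> I \<Longrightarrow> (1 + \<bar>x\<bar>) ^ l * norm (\<Phi> p x) \<le> real A * W A p"
    using assms unfolding rapid_def by blast
  obtain B where B: "\<And>p x. p \<in> I \<Longrightarrow> (1 + \<bar>x\<bar>) ^ l * norm (\<Psi> p x) \<le> real B * W B p"
    using assms unfolding rapid_def by blast
  show "\<exists>C M. \<forall>p\<in>I. \<forall>x. (1 + \<bar>x\<bar>) ^ l * norm (\<Phi> p x + \<Psi> p x) \<le> C * W M p"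
  proof (intro exI ballI allI)
    fix p x assume p: "p \<in> I"
    have "(1 + \<bar>x\<bar>) ^ l * norm (\<Phi> p x + \<Psi> p x)
        \<le> (1 + \<bar>x\<bar>) ^ l * (norm (\<Phi> p x) + norm (\<Psi> p x))"
      by (intro mult_left_mono norm_triangle_ineq) auto
    also have "\<dots> \<le> real A * W A p + real B * W B p"
      using A[OF p, of x] B[OF p, of x] by (simp add: distrib_left)
    also have "\<dots> \<le> real (A + B) * W (A + B) p + real (A + B) * W (A + B) p"
      by (intro add_mono weight_bound[OF W p]) auto
    finally show "(1 + \<bar>x\<bar>) ^ l * norm (\<Phi> p x + \<Psi> p x) \<le> (2 * real (A + B)) * W (A + B) p"
      by (simp only: algebra_simps)
  qed
qed

lemma rapid_mult_bounded:
  assumes W: "weight I W" and "rapid I W \<Phi>" and c: "\<And>p x. p \<in> I \<Longrightarrow> norm (c p x) \<le> K"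
  shows "rapid I W (\<lambda>p x. c p x * \<Phi> p x)"
proof (rule rapidI[OF W])
  fix l
  obtain A where A: "\<And>p x. p \<in> I \<Longrightarrow> (1 + \<bar>x\<bar>) ^ l * norm (\<Phi> p x) \<le> real A * W A p"
    using assms unfolding rapid_def by blast
  show "\<exists>C M. \<forall>p\<in>I. \<forall>x. (1 + \<bar>x\<bar>) ^ l * norm (c p x * \<Phi> p x) \<le> C * W M p"
  proof (intro exI ballI allI)
    fix p and x :: real assume p: "p \<in> I"
    have K: "0 \<le> K" using order_trans[OF norm_ge_zero c[OF p]] .
    have "(1 + \<bar>x\<bar>) ^ l * norm (c p x * \<Phi> p x) = norm (c p x) * ((1 + \<bar>x\<bar>) ^ l * norm (\<Phi> p x))"
      by (simp add: norm_mult)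
    also have "\<dots> \<le> K * (real A * W A p)"
      by (intro mult_mono c A p K) auto
    finally show "(1 + \<bar>x\<bar>) ^ l * norm (c p x * \<Phi> p x) \<le> (K * real A) * W A p"
      by simp
  qed
qed

lemma rapid_mult_poly_bounded:
  assumes U: "weight I U" and V: "weight I V" and W: "weight I W"
    and UV: "\<And>p N M. p \<in> I \<Longrightarrow> U N p * V M p \<le> W (N + M) p"
    and \<Phi>: "poly_bounded I U \<Phi>" and \<Psi>: "rapid I V \<Psi>"
  shows "rapid I W (\<lambda>p x. \<Phi> p x * \<Psi> p x)"
proof (rule rapidI[OF W])
  fix l
  obtain A where A: "\<And>p x. p \<in> I \<Longrightarrow> norm (\<Phi> p x) \<le> real A * U A p * (1 + \<bar>x\<bar>) ^ A"
    using \<Phi> unfolding poly_bounded_def by blast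
  \<comment> \<open>The \<open>A\<close> extra powers of decay pay for the growth of the factor
    \<open>\<Phi>\<close>.\<close>
  obtain B where B: "\<And>p x. p \<in> I \<Longrightarrow> (1 + \<bar>x\<bar>) ^ (l + A) * norm (\<Psi> p x) \<le> real B * V B p"
    using \<Psi> unfolding rapid_def by blast
  show "\<exists>C M. \<forall>p\<in>I. \<forall>x. (1 + \<bar>x\<bar>) ^ l * norm (\<Phi> p x * \<Psi> p x) \<le> C * W M p"
  proof (intro exI ballI allI)
    fix p and x :: real assume p: "p \<in> I"
    have "(1 + \<bar>x\<bar>) ^ l * norm (\<Phi> p x * \<Psi> p x) = norm (\<Phi> p x) * ((1 + \<bar>x\<bar>) ^ l * norm (\<Psi> p x))"
      by (simp add: norm_mult)
    also have "\<dots> \<le> (real A * U A p * (1 + \<bar>x\<bar>) ^ A) * ((1 + \<bar>x\<bar>) ^ l * norm (\<Psi> p x))"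
      by (intro mult_right_mono A p) auto
    also have "\<dots> = real A * U A p * ((1 + \<bar>x\<bar>) ^ (l + A) * norm (\<Psi> p x))"
      by (simp add: power_add)
    also have "\<dots> \<le> real A * U A p * (real B * V B p)"
      by (intro mult_left_mono B p mult_nonneg_nonneg weight_nonneg[OF U p]) auto
    also have "\<dots> = (real A * real B) * (U A p * V B p)" by simp
    also have "\<dots> \<le> (real A * real B) * W (A + B) p"
      by (intro mult_left_mono UV p) auto
    finally show "(1 + \<bar>x\<bar>) ^ l * norm (\<Phi> p x * \<Psi> p x) \<le> (real A * real B) * W (A + B) p" .
  qed
qed

lemma rapid_reindex:
  assumes V: "weight J V" and \<Phi>: "rapid I W \<Phi>" and \<pi>: "\<And>q. q \<in> J \<Longrightarrow> \<pi> q \<in> I"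
    and le: "\<And>N q. q \<in> J \<Longrightarrow> W N (\<pi> q) \<le> V N q"
  shows "rapid J V (\<lambda>q. \<Phi> (\<pi> q))"
  unfolding rapid_def
proof
  fix l
  obtain N where N: "\<And>p x. p \<in> I \<Longrightarrow> (1 + \<bar>x\<bar>) ^ l * norm (\<Phi> p x) \<le> real N * W N p"
    using \<Phi> unfolding rapid_def by blast
  have "(1 + \<bar>x\<bar>) ^ l * norm (\<Phi> (\<pi> q) x) \<le> real N * V N q" if q: "q \<in> J" for q x
    using N[OF \<pi>[OF q], of x] mult_left_mono[OF le[OF q, of N], of "real N"] by simp
  then show "\<exists>N. \<forall>q\<in>J. \<forall>x. (1 + \<bar>x\<bar>) ^ l * norm (\<Phi> (\<pi> q) x) \<le> real N * V N q"
    by blast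
qed

section \<open>Landau's interpolation inequality and decay of derivatives\<close>

lemma onorm_scaleR_le:
  fixes v :: complex
  assumes "norm v \<le> K"
  shows "onorm (\<lambda>t::real. t *\<^sub>R v) \<le> K"
proof (rule onorm_bound)
  show "0 \<le> K" using assms norm_ge_zero order_trans by blast
  show "norm (t *\<^sub>R v) \<le> K * norm t" for t :: real
    using mult_left_mono[OF assms, of "\<bar>t\<bar>"] by (simp add: mult.commute)
qed

text \<open>This is Taylor's formula of order two, solved for \<open>f' x\<close>. The values are
  complex, so there is no intermediate point for a remainder term; the mean value inequality is
  applied twice instead, to \<open>f'\<close> and then to \<open>f\<close> minus its linear part
  with slope \<open>f' x\<close>.\<close>

lemma second_order_bound:
  fixes f f' f'' :: "real \<Rightarrow> complex"
  assumes "\<And>y. (f has_vector_derivative f' y) (at y)" "\<And>y. (f' has_vector_derivative f'' y) (at y)"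
    and "0 < h" "\<And>y. x \<le> y \<Longrightarrow> y \<le> x + h \<Longrightarrow> norm (f'' y) \<le> K"
  shows "norm (f' x) \<le> (norm (f (x + h)) + norm (f x)) / h + h * K"
proof -
  have f'_bound: "norm (f' y - f' x) \<le> h * K" if y: "x \<le> y" "y \<le> x + h" for y
  proof -
    have "norm (f' y - f' x) \<le> K * norm (y - x)"
    proof (rule differentiable_bound[where S = "{x..x + h}"])
      show "(f' has_derivative (\<lambda>t. t *\<^sub>R f'' z)) (at z within {x..x + h})" for z
        using assms(2)[of z] by (auto simp: has_vector_derivative_def intro: has_derivative_at_withinI)
      show "onorm (\<lambda>t. t *\<^sub>R f'' z) \<le> K" if "z \<in> {x..x + h}" for z
        using assms(4)[of z] that by (intro onorm_scaleR_le) auto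
    qed (use y assms(3) in auto)
    also have "\<dots> \<le> K * h"
      using y assms(3) assms(4)[of x] by (intro mult_left_mono) (auto intro: order_trans[OF norm_ge_zero])
    finally show ?thesis by (simp add: mult.commute)
  qed
  define g where "g = (\<lambda>y. f y - y *\<^sub>R f' x)"
  have "norm (g (x + h) - g x) \<le> (h * K) * norm ((x + h) - x)"
  proof (rule differentiable_bound[where S = "{x..x + h}"])
    show "(g has_derivative (\<lambda>t. t *\<^sub>R (f' z - f' x))) (at z within {x..x + h})" for z
      unfolding g_def scaleR_diff_right
      using assms(1)[of z] by (intro derivative_intros)
        (auto simp: has_vector_derivative_def intro: has_derivative_at_withinI)
    show "onorm (\<lambda>t. t *\<^sub>R (f' z - f' x)) \<le> h * K" if "z \<in> {x..x + h}" for z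
      using f'_bound[of z] that by (intro onorm_scaleR_le) auto
  qed (use assms(3) in auto)
  then have 1: "norm (f (x + h) - f x - h *\<^sub>R f' x) \<le> h * K * h"
    using assms(3) by (simp add: g_def algebra_simps)
  have "h * norm (f' x) = norm ((f (x + h) - f x) - (f (x + h) - f x - h *\<^sub>R f' x))"
    using assms(3) by simp
  also have "\<dots> \<le> norm (f (x + h)) + norm (f x) + h * K * h"
    using norm_triangle_ineq4[of "f (x + h) - f x" "f (x + h) - f x - h *\<^sub>R f' x"]
      norm_triangle_ineq4[of "f (x + h)" "f x"] 1 by linarith
  finally have "norm (f' x) \<le> (norm (f (x + h)) + norm (f x) + h * K * h) / h"
    using assms(3) by (simp add: pos_le_divide_eq mult.commute)
  then show ?thesis using assms(3) by (simp add: add_divide_distrib)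
qed

text \<open>Landau's inequality on an interval of length \<open>(1 + \<bar>x\<bar>)\<^sup>-\<^sup>L\<close> trades decay of \<open>\<Phi>\<close> against the
  growth of its second derivative.\<close>

lemma rapid_vderiv:
  assumes W: "weight I W" and tame: "tame I W 2 \<Phi>" and rapid: "rapid I W \<Phi>"
  shows "rapid I W (\<lambda>p. vderiv (\<Phi> p))"
proof (rule rapidI[OF W])
  fix l
  have tame2: "tame I W (Suc 1) \<Phi>" "tame I W 1 (\<lambda>p. vderiv (\<Phi> p))"
    "poly_bounded I W (\<lambda>p. vderiv (vderiv (\<Phi> p)))"
    using tame by (simp_all add: numeral_2_eq_2)
  obtain B where B: "\<And>p x. p \<in> I \<Longrightarrow>
      norm (vderiv (vderiv (\<Phi> p)) x) \<le> real B * W B p * (1 + \<bar>x\<bar>) ^ B"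
    using tame2(3) unfolding poly_bounded_def by blast
  \<comment> \<open>With \<open>h = u ^ (- L)\<close> the term \<open>u ^ l * h * K\<close> stays
    bounded, since \<open>K\<close> grows like \<open>u ^ B\<close>. Dividing by \<open>h\<close>
    costs \<open>L\<close> powers, so \<open>\<Phi>\<close> is used with decay of order
    \<open>l + L\<close>.\<close>
  define L where "L = l + B"
  obtain A where A: "\<And>p x. p \<in> I \<Longrightarrow> (1 + \<bar>x\<bar>) ^ (l + L) * norm (\<Phi> p x) \<le> real A * W A p"
    using rapid unfolding rapid_def by blast
  define C where "C = (2::real) ^ (l + L) * real A + real A + real B * 2 ^ B"
  show "\<exists>C M. \<forall>p\<in>I. \<forall>x. (1 + \<bar>x\<bar>) ^ l * norm (vderiv (\<Phi> p) x) \<le> C * W M p"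
  proof (intro exI ballI allI)
    fix p and x :: real assume p: "p \<in> I"
    define u where "u = 1 + \<bar>x\<bar>"
    define h where "h = 1 / u ^ L"
    define K where "K = real B * W B p * (2 * u) ^ B"
    have u: "u \<ge> 1" by (simp add: u_def)
    then have h: "0 < h" "h \<le> 1" by (auto simp: h_def)
    have fB: "norm (vderiv (vderiv (\<Phi> p)) y) \<le> K" if "x \<le> y" "y \<le> x + h" for y
    proof -
      \<comment> \<open>Since \<open>h \<le> 1\<close>, moving inside the interval changes
        \<open>1 + \<bar>x\<bar>\<close> by a factor of at most 2; the same remark compares
        \<open>u\<close> with \<open>1 + \<bar>x + h\<bar>\<close> below.\<close>
      have "1 + \<bar>y\<bar> \<le> 2 * u" using that h by (auto simp: u_def)
      then have "real B * W B p * (1 + \<bar>y\<bar>) ^ B \<le> K"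
        unfolding K_def by (intro mult_left_mono power_mono mult_nonneg_nonneg weight_nonneg[OF W p]) auto
      then show ?thesis using B[OF p, of y] by linarith
    qed
    have "norm (vderiv (\<Phi> p) x) \<le> (norm (\<Phi> p (x + h)) + norm (\<Phi> p x)) / h + h * K"
      by (rule second_order_bound[OF tame_derivative[OF tame2(1) p] _ h(1) fB])
        (use tame_derivative[OF _ p, of W 0 "\<lambda>p. vderiv (\<Phi> p)"] tame2(2) in auto)
    then have "u ^ l * norm (vderiv (\<Phi> p) x)
        \<le> u ^ l * ((norm (\<Phi> p (x + h)) + norm (\<Phi> p x)) / h + h * K)"
      using u by (intro mult_left_mono) auto
    also have "\<dots> = u ^ (l + L) * norm (\<Phi> p (x + h)) + u ^ (l + L) * norm (\<Phi> p x) + u ^ l * h * K"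
      by (simp add: h_def power_add algebra_simps)
    also have "\<dots> \<le> 2 ^ (l + L) * (real A * W A p) + real A * W A p + real B * 2 ^ B * W B p"
    proof (intro add_mono)
      have "u \<le> 2 * (1 + \<bar>x + h\<bar>)"
        unfolding u_def using h abs_triangle_ineq4[of "x + h" h] abs_ge_zero[of "x + h"] by (simp del: abs_ge_zero)
      then have "u ^ (l + L) \<le> (2 * (1 + \<bar>x + h\<bar>)) ^ (l + L)"
        using u by (intro power_mono) auto
      then have "u ^ (l + L) * norm (\<Phi> p (x + h)) \<le> (2 * (1 + \<bar>x + h\<bar>)) ^ (l + L) * norm (\<Phi> p (x + h))"
        by (intro mult_right_mono) auto
      also have "\<dots> = 2 ^ (l + L) * ((1 + \<bar>x + h\<bar>) ^ (l + L) * norm (\<Phi> p (x + h)))"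
        by (simp only: power_mult_distrib mult.assoc)
      also have "\<dots> \<le> 2 ^ (l + L) * (real A * W A p)"
        by (intro mult_left_mono A p) auto
      finally show "u ^ (l + L) * norm (\<Phi> p (x + h)) \<le> 2 ^ (l + L) * (real A * W A p)" .
      show "u ^ (l + L) * norm (\<Phi> p x) \<le> real A * W A p"
        using A[OF p, of x] by (simp add: u_def)
      show "u ^ l * h * K \<le> real B * 2 ^ B * W B p"
        using u by (simp add: h_def K_def L_def power_add power_mult_distrib)
    qed
    also have "\<dots> \<le> 2 ^ (l + L) * (real A * W (A + B) p) + real A * W (A + B) p + real B * 2 ^ B * W (A + B) p"
      by (intro add_mono mult_left_mono weight_mono[OF W p]) auto
    also have "\<dots> = C * W (A + B) p" by (simp add: C_def algebra_simps)
    finally show "(1 + \<bar>x\<bar>) ^ l * norm (vderiv (\<Phi> p) x) \<le> C * W (A + B) p" by (simp add: u_def)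
  qed
qed

lemma tame_vderiv_pow: "\<forall>n. tame I W n \<Phi> \<Longrightarrow> tame I W n (\<lambda>p. (vderiv ^^ j) (\<Phi> p))"
proof (induction j arbitrary: \<Phi>)
  case (Suc j)
  have "tame I W n (\<lambda>p. vderiv (\<Phi> p))" for n
    using Suc.prems[rule_format, of "Suc n"] by simp
  then show ?case
    using Suc.IH[of "\<lambda>p. vderiv (\<Phi> p)"] by (simp add: funpow_swap1)
qed simp

lemma rapid_vderiv_pow:
  assumes "weight I W" "\<forall>n. tame I W n \<Phi>" "rapid I W \<Phi>"
  shows "rapid I W (\<lambda>p. (vderiv ^^ j) (\<Phi> p))"
proof (induction j)
  case (Suc j)
  show ?case
    using rapid_vderiv[OF assms(1) tame_vderiv_pow[OF assms(2)] Suc.IH] by simp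
qed (use assms in simp)

section \<open>Continuous operators on the Schwartz space\<close>

text \<open>Summing over a square of indices gives a norm that increases with \<open>N\<close>, so
  that the countably many seminorms form a weight.\<close>

definition schwartz_norm :: "nat \<Rightarrow> (real \<Rightarrow> complex) \<Rightarrow> real" where
  "schwartz_norm N f = (\<Sum>l\<le>N. \<Sum>n\<le>N. schwartz_seminorm l n f)"

lemma schwartz_smooth: "f \<in> schwartz \<Longrightarrow> smooth f"
  by (simp add: schwartz_def)

lemma schwartz_seminorm_ge:
  assumes "f \<in> schwartz"
  shows "\<bar>x\<bar> ^ l * norm ((vderiv ^^ n) f x) \<le> schwartz_seminorm l n f"
proof -
  have "\<exists>C. \<forall>x. \<bar>x\<bar> ^ l * norm ((vderiv ^^ n) f x) \<le> C"
    using assms by (simp add: schwartz_def)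
  then show ?thesis
    unfolding schwartz_seminorm_def by (intro cSUP_upper) (auto simp: bdd_above_def)
qed

lemma schwartz_seminorm_nonneg: "f \<in> schwartz \<Longrightarrow> 0 \<le> schwartz_seminorm l n f"
  using schwartz_seminorm_ge[of f 0 l n] by (meson norm_ge_zero order_trans mult_nonneg_nonneg zero_le_power abs_ge_zero)

lemma schwartz_seminorm_le_norm:
  assumes f: "f \<in> schwartz" and "l \<le> N" "n \<le> N"
  shows "schwartz_seminorm l n f \<le> schwartz_norm N f"
proof -
  have "schwartz_seminorm l n f \<le> (\<Sum>n\<le>N. schwartz_seminorm l n f)"
    using assms by (intro member_le_sum schwartz_seminorm_nonneg) auto
  also have "\<dots> \<le> schwartz_norm N f"
    unfolding schwartz_norm_def
    using assms by (intro member_le_sum[of l _ "\<lambda>l. \<Sum>n\<le>N. schwartz_seminorm l n f"] sum_nonneg schwartz_seminorm_nonneg) auto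
  finally show ?thesis .
qed

lemma weight_schwartz_norm: "weight schwartz schwartz_norm"
  unfolding weight_def
proof (intro ballI conjI monoI)
  fix f :: "real \<Rightarrow> complex" and M N :: nat assume f: "f \<in> schwartz" and MN: "M \<le> N"
  have "schwartz_norm M f \<le> (\<Sum>l\<le>M. \<Sum>n\<le>N. schwartz_seminorm l n f)"
    unfolding schwartz_norm_def using MN f
    by (intro sum_mono sum_mono2 schwartz_seminorm_nonneg) auto
  also have "\<dots> \<le> schwartz_norm N f"
    unfolding schwartz_norm_def using MN f
    by (intro sum_mono2 sum_nonneg schwartz_seminorm_nonneg) auto
  finally show "schwartz_norm M f \<le> schwartz_norm N f" .
qed (simp add: schwartz_norm_def schwartz_seminorm_nonneg)

text \<open>Since \<open>1 + \<bar>x\<bar> \<le> 2 * max 1 \<bar>x\<bar>\<close>, the seminorms with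
  powers \<open>0\<close> and \<open>l\<close> suffice; this is the origin of
  \<open>2 ^ l\<close>.\<close>

lemma schwartz_norm_bound:
  assumes f: "f \<in> schwartz" and "l \<le> N" "n \<le> N"
  shows "(1 + \<bar>x\<bar>) ^ l * norm ((vderiv ^^ n) f x) \<le> 2 ^ l * schwartz_norm N f"
proof -
  have "norm ((vderiv ^^ n) f x) \<le> schwartz_norm N f" 
    using schwartz_seminorm_ge[OF f, of x 0 n] schwartz_seminorm_le_norm[OF f, of 0 N n] assms by simp
  moreover have "\<bar>x\<bar> ^ l * norm ((vderiv ^^ n) f x) \<le> schwartz_norm N f"
    using schwartz_seminorm_ge[OF f, of x l n] schwartz_seminorm_le_norm[OF f, of l N n] assms by simp
  ultimately have m: "max 1 (\<bar>x\<bar> ^ l) * norm ((vderiv ^^ n) f x) \<le> schwartz_norm N f"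
    by (simp add: max_def)
  have "(1 + \<bar>x\<bar>) ^ l \<le> (2 * max 1 \<bar>x\<bar>) ^ l"
    by (intro power_mono) auto
  also have "\<dots> \<le> 2 ^ l * max 1 (\<bar>x\<bar> ^ l)"
    by (auto simp: power_mult_distrib max_def)
  finally have "(1 + \<bar>x\<bar>) ^ l * norm ((vderiv ^^ n) f x) \<le> 2 ^ l * max 1 (\<bar>x\<bar> ^ l) * norm ((vderiv ^^ n) f x)"
    by (rule mult_right_mono) auto
  also have "\<dots> \<le> 2 ^ l * schwartz_norm N f"
    using m by (simp add: mult.assoc)
  finally show ?thesis .
qed

lemma schwartz_tame: "tame schwartz schwartz_norm n (\<lambda>f. f)"
proof -
  have "poly_bounded schwartz schwartz_norm (vderiv ^^ n)" for n
    using schwartz_norm_bound[of _ 0 n n]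
    by (intro poly_boundedI[where C = 1 and M = n and L = 0] weight_schwartz_norm) auto
  then have "\<forall>n. tame schwartz schwartz_norm n (\<lambda>f. f)"
    by (subst tame_iff) (auto intro: schwartz_smooth)
  then show ?thesis by blast
qed

lemma schwartz_rapid: "rapid schwartz schwartz_norm (\<lambda>f. f)"
proof (rule rapidI[OF weight_schwartz_norm])
  show "\<exists>C M. \<forall>p\<in>schwartz. \<forall>x. (1 + \<bar>x\<bar>) ^ l * norm (p x) \<le> C * schwartz_norm M p" for l
    using schwartz_norm_bound[of _ l l 0] by auto
qed

text \<open>Decay is asked of the functions themselves only. Interpolation carries it over to all
  derivatives, whose a priori bounds merely have polynomial growth.\<close>

lemma schwartz_criterion:
  assumes W: "weight I W" and tame: "\<forall>n. tame I W n A" and rapid: "rapid I W A"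
  shows "\<And>p. p \<in> I \<Longrightarrow> A p \<in> schwartz"
    and "\<exists>K. \<forall>p\<in>I. schwartz_norm N (A p) \<le> real K * W K p"
proof -
  have dec: "\<exists>K. \<forall>p\<in>I. \<forall>x. \<bar>x\<bar> ^ l * norm ((vderiv ^^ n) (A p) x) \<le> real K * W K p" for l n
  proof -
    obtain K where K: "\<And>p x. p \<in> I \<Longrightarrow> (1 + \<bar>x\<bar>) ^ l * norm ((vderiv ^^ n) (A p) x) \<le> real K * W K p"
      using rapid_vderiv_pow[OF assms] unfolding rapid_def by blast
    have "\<bar>x\<bar> ^ l * norm ((vderiv ^^ n) (A p) x) \<le> (1 + \<bar>x\<bar>) ^ l * norm ((vderiv ^^ n) (A p) x)" for x p
      by (intro mult_right_mono power_mono) auto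
    then show ?thesis using K by (meson order_trans)
  qed
  show "A p \<in> schwartz" if "p \<in> I" for p
    using tame that dec unfolding tame_iff schwartz_def by blast
  obtain K where K: "\<And>l n p x. p \<in> I \<Longrightarrow>
      \<bar>x\<bar> ^ l * norm ((vderiv ^^ n) (A p) x) \<le> real (K l n) * W (K l n) p"
    using dec by metis
  have seminorm: "schwartz_seminorm l n (A p) \<le> real (K l n) * W (K l n) p" if "p \<in> I" for l n p
    unfolding schwartz_seminorm_def using K[OF that] by (intro cSUP_least) auto
  \<comment> \<open>As a sum of natural numbers \<open>Q\<close> dominates every index
    \<open>K l n\<close>, and it is at the same time the sum of the constants.\<close>
  define Q where "Q = (\<Sum>l\<le>N. \<Sum>n\<le>N. K l n)"
  show "\<exists>K. \<forall>p\<in>I. schwartz_norm N (A p) \<le> real K * W K p"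
  proof (intro exI ballI)
    fix p assume p: "p \<in> I"
    have KQ: "K l n \<le> Q" if "l \<le> N" "n \<le> N" for l n
    proof -
      have "K l n \<le> (\<Sum>n\<le>N. K l n)" using that by (intro member_le_sum) auto
      also have "\<dots> \<le> Q" unfolding Q_def using that
        by (intro member_le_sum[of l _ "\<lambda>l. \<Sum>n\<le>N. K l n"]) auto
      finally show ?thesis .
    qed
    have "schwartz_norm N (A p) \<le> (\<Sum>l\<le>N. \<Sum>n\<le>N. real (K l n) * W Q p)"
      unfolding schwartz_norm_def
      by (intro sum_mono order_trans[OF seminorm[OF p]] mult_left_mono weight_mono[OF W p] KQ) auto
    also have "\<dots> = real Q * W Q p"
      by (simp add: Q_def sum_distrib_right)
    finally show "schwartz_norm N (A p) \<le> real Q * W Q p" .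
  qed
qed

definition schwartz_operator :: "((real \<Rightarrow> complex) \<Rightarrow> real \<Rightarrow> complex) \<Rightarrow> bool" where
  "schwartz_operator A \<longleftrightarrow> (\<forall>f\<in>schwartz. A f \<in> schwartz) \<and>
     (\<forall>N. \<exists>K. \<forall>f\<in>schwartz. schwartz_norm N (A f) \<le> real K * schwartz_norm K f)"

lemma schwartz_operatorI:
  assumes "\<forall>n. tame schwartz schwartz_norm n A" "rapid schwartz schwartz_norm A"
  shows "schwartz_operator A"
  unfolding schwartz_operator_def
  using schwartz_criterion[OF weight_schwartz_norm assms] by blast

lemma schwartz_operator_id: "schwartz_operator (\<lambda>f. f)"
  using schwartz_operatorI schwartz_tame schwartz_rapid by blast

lemma schwartz_operator_in: "schwartz_operator A \<Longrightarrow> f \<in> schwartz \<Longrightarrow> A f \<in> schwartz"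
  by (simp add: schwartz_operator_def)

lemma schwartz_operator_compose:
  assumes A: "schwartz_operator A" and B: "schwartz_operator B"
  shows "schwartz_operator (\<lambda>f. A (B f))"
  unfolding schwartz_operator_def
proof (intro conjI ballI allI)
  show "A (B f) \<in> schwartz" if "f \<in> schwartz" for f
    using that A B by (simp add: schwartz_operator_in)
  fix N
  obtain K where K: "\<And>f. f \<in> schwartz \<Longrightarrow> schwartz_norm N (A f) \<le> real K * schwartz_norm K f"
    using A unfolding schwartz_operator_def by blast
  obtain L where L: "\<And>f. f \<in> schwartz \<Longrightarrow> schwartz_norm K (B f) \<le> real L * schwartz_norm L f"
    using B unfolding schwartz_operator_def by blast
  show "\<exists>K. \<forall>f\<in>schwartz. schwartz_norm N (A (B f)) \<le> real K * schwartz_norm K f"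
  proof (intro exI ballI)
    fix f :: "real \<Rightarrow> complex" assume f: "f \<in> schwartz"
    have "schwartz_norm N (A (B f)) \<le> real K * schwartz_norm K (B f)"
      using K f B by (simp add: schwartz_operator_in)
    also have "\<dots> \<le> real K * (real L * schwartz_norm L f)"
      by (intro mult_left_mono L f) auto
    \<comment> \<open>The number \<open>K * L + L\<close> lies above the constant
      \<open>K * L\<close> and above the index \<open>L\<close>, also when
      \<open>K = 0\<close>.\<close>
    also have "\<dots> \<le> real (K * L + L) * schwartz_norm (K * L + L) f"
      unfolding mult.assoc[symmetric] by (intro weight_bound[OF weight_schwartz_norm f]) auto
    finally show "schwartz_norm N (A (B f)) \<le> real (K * L + L) * schwartz_norm (K * L + L) f" .
  qed
qed

section \<open>The Dunkl kernel\<close>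

text \<open>These are the coefficients of \<open>j\<^sub>\<nu>\<close> as a power series in
  \<open>z\<^sup>2\<close>. The Pochhammer symbol stands for the quotient of Gamma values, which
  makes a shift of \<open>\<nu>\<close> a matter of algebra.\<close>

definition bessel_coeff :: "real \<Rightarrow> nat \<Rightarrow> real" where
  "bessel_coeff \<nu> n = (-1) ^ n / (4 ^ n * fact n * pochhammer (\<nu> + 1) n)"

text \<open>Every factor is at least \<open>1 / 2\<close>. The bound is crude, but the factor
  \<open>4 ^ n\<close> in the Bessel coefficients more than compensates it, so that the exponential
  series is a majorant.\<close>

lemma pochhammer_ge_half:
  assumes "a \<ge> (1 / 2 :: real)"
  shows "pochhammer a n \<ge> (1 / 2) ^ n"
proof (induction n)
  case (Suc n)
  have "(1 / 2) ^ n * (1 / 2) \<le> pochhammer a n * (a + real n)"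
    using Suc assms by (intro mult_mono) (auto intro: order_trans[OF _ Suc])
  then show ?case by (simp add: pochhammer_Suc)
qed simp

lemma summable_bessel:
  assumes "\<nu> \<ge> - 1 / 2"
  shows "summable (\<lambda>n. bessel_coeff \<nu> n * u ^ n)"
proof (rule summable_comparison_test)
  show "summable (\<lambda>n. inverse (fact n) * \<bar>u\<bar> ^ n)"
    by (rule summable_exp)
  have "norm (bessel_coeff \<nu> n * u ^ n) \<le> inverse (fact n) * \<bar>u\<bar> ^ n" for n
  proof -
    have p: "pochhammer (\<nu> + 1) n \<ge> (1 / 2) ^ n"
      using assms by (intro pochhammer_ge_half) simp
    then have p0: "pochhammer (\<nu> + 1) n > 0"
      by (smt (verit) zero_less_power divide_pos_pos)
    have "1 \<le> (4 :: real) ^ n * (1 / 2) ^ n"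
      by (simp flip: power_mult_distrib)
    also have "\<dots> \<le> 4 ^ n * pochhammer (\<nu> + 1) n"
      using p by (intro mult_left_mono) auto
    finally have "1 / (4 ^ n * pochhammer (\<nu> + 1) n) \<le> 1"
      by simp
    then have "1 / (4 ^ n * pochhammer (\<nu> + 1) n) * (inverse (fact n) * \<bar>u\<bar> ^ n)
        \<le> 1 * (inverse (fact n) * \<bar>u\<bar> ^ n)"
      by (intro mult_right_mono) auto
    moreover have "norm (bessel_coeff \<nu> n * u ^ n) =
        1 / (4 ^ n * pochhammer (\<nu> + 1) n) * (inverse (fact n) * \<bar>u\<bar> ^ n)"
      using p0 by (simp add: bessel_coeff_def abs_mult power_abs divide_simps)
    ultimately show ?thesis by simp
  qed
  then show "\<exists>N. \<forall>n\<ge>N. norm (bessel_coeff \<nu> n * u ^ n) \<le> inverse (fact n) * \<bar>u\<bar> ^ n"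
    by blast
qed

lemma bessel_j_series:
  assumes "\<nu> \<ge> - 1 / 2"
  shows "bessel_j \<nu> z = (\<Sum>n. bessel_coeff \<nu> n * (z\<^sup>2) ^ n)"
proof -
  have n0: "\<nu> + 1 \<notin> \<int>\<^sub>\<le>\<^sub>0"
    using assms by (auto elim!: nonpos_Ints_cases)
  have G: "Gamma (\<nu> + 1) > 0"
    using assms by (intro Gamma_real_pos) simp
  have "bessel_coeff \<nu> n * (z\<^sup>2) ^ n =
      Gamma (\<nu> + 1) * ((-1) ^ n * (z / 2) ^ (2 * n) / (fact n * Gamma (real n + \<nu> + 1)))" for n
  proof -
    have "pochhammer (\<nu> + 1) n = Gamma (real n + \<nu> + 1) / Gamma (\<nu> + 1)"
      using pochhammer_Gamma[OF n0, of n] by (simp add: add_ac)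
    moreover have "(z / 2) ^ (2 * n) = (z\<^sup>2) ^ n / 4 ^ n"
      by (simp add: power_mult power_divide)
    ultimately show ?thesis
      using G by (simp add: bessel_coeff_def mult.assoc)
  qed
  then have eq: "(\<lambda>n. bessel_coeff \<nu> n * (z\<^sup>2) ^ n) = (\<lambda>n. Gamma (\<nu> + 1) *
      ((-1) ^ n * (z / 2) ^ (2 * n) / (fact n * Gamma (real n + \<nu> + 1))))"
    by blast
  have sm: "summable (\<lambda>n. (-1) ^ n * (z / 2) ^ (2 * n) / (fact n * Gamma (real n + \<nu> + 1)))"
    using summable_mult_D[OF summable_bessel[OF assms, of "z\<^sup>2", unfolded eq]] G by simp
  show ?thesis
    unfolding bessel_j_def eq by (rule suminf_mult[OF sm, symmetric])
qed

text \<open>Differentiating the series in \<open>u = z\<^sup>2\<close> shifts the coefficients, and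
  \<open>(\<nu> + 1)\<^sub>n\<^sub>+\<^sub>1 = (\<nu> + 1) * (\<nu> + 2)\<^sub>n\<close> turns the
  shift in \<open>n\<close> into a shift of \<open>\<nu>\<close>. The chain rule supplies the factor
  \<open>2 * z\<close>.\<close>

lemma DERIV_bessel_j:
  assumes "\<nu> \<ge> - 1 / 2"
  shows "(bessel_j \<nu> has_field_derivative - z / (2 * (\<nu> + 1)) * bessel_j (\<nu> + 1) z) (at z)"
proof -
  have \<nu>: "\<nu> + 1 > 0" using assms by simp
  have d: "diffs (bessel_coeff \<nu>) n = - 1 / (4 * (\<nu> + 1)) * bessel_coeff (\<nu> + 1) n" for n
  proof -
    have "pochhammer (\<nu> + 1 + 1) n > 0" using \<nu> by (intro pochhammer_pos) simp
    then show ?thesis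
      using \<nu> by (simp add: diffs_def bessel_coeff_def pochhammer_rec divide_simps)
  qed
  have "((\<lambda>u. \<Sum>n. bessel_coeff \<nu> n * u ^ n) has_field_derivative
      (\<Sum>n. diffs (bessel_coeff \<nu>) n * u ^ n)) (at u)" for u
    by (rule termdiffs_strong_converges_everywhere) (rule summable_bessel[OF assms])
  moreover have "(\<Sum>n. diffs (bessel_coeff \<nu>) n * u ^ n) =
      - 1 / (4 * (\<nu> + 1)) * (\<Sum>n. bessel_coeff (\<nu> + 1) n * u ^ n)" for u
    unfolding d mult.assoc using assms by (intro suminf_mult summable_bessel) simp
  ultimately have J: "((\<lambda>u. \<Sum>n. bessel_coeff \<nu> n * u ^ n) has_field_derivative
      - 1 / (4 * (\<nu> + 1)) * (\<Sum>n. bessel_coeff (\<nu> + 1) n * u ^ n)) (at u)" for u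
    by simp
  have "((\<lambda>z. \<Sum>n. bessel_coeff \<nu> n * (z\<^sup>2) ^ n) has_field_derivative
      - 1 / (4 * (\<nu> + 1)) * (\<Sum>n. bessel_coeff (\<nu> + 1) n * (z\<^sup>2) ^ n) * (2 * z)) (at z)"
    by (rule DERIV_chain2[OF J]) (auto intro!: derivative_eq_intros)
  moreover have "bessel_j \<nu> = (\<lambda>z. \<Sum>n. bessel_coeff \<nu> n * (z\<^sup>2) ^ n)"
    using bessel_j_series[OF assms] by blast
  moreover have "- 1 / (4 * p) * S * (2 * z) = - z / (2 * p) * S" for p S :: real
    by simp
  ultimately show ?thesis
    using bessel_j_series[of "\<nu> + 1" z] assms by (simp only:)
qed

text \<open>Combined with the derivative formula, this three-term relation is the Bessel
  differential equation. It follows by comparing coefficients.\<close>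

lemma bessel_j_recurrence:
  assumes "\<nu> \<ge> - 1 / 2"
  shows "bessel_j \<nu> z =
    bessel_j (\<nu> + 1) z - z\<^sup>2 / (4 * (\<nu> + 1) * (\<nu> + 2)) * bessel_j (\<nu> + 2) z"
proof -
  have coeff: "bessel_coeff \<nu> (Suc n) =
      bessel_coeff (\<nu> + 1) (Suc n) - 1 / (4 * (\<nu> + 1) * (\<nu> + 2)) * bessel_coeff (\<nu> + 2) n" for n
  proof -
    define a where "a = \<nu> + 1"
    define Q where "Q = pochhammer (a + 2) n"
    have a: "a > 0" using assms by (simp add: a_def)
    have Q: "Q > 0" unfolding Q_def using a by (intro pochhammer_pos) simp
    have 1: "pochhammer (a + 1) (Suc n) = (a + 1) * Q"
      by (simp add: pochhammer_rec Q_def add.assoc)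
    \<comment> \<open>All three Pochhammer symbols are expressed through \<open>Q\<close>, the one
      of \<open>a + 2\<close>. Here the last factor of \<open>pochhammer (a + 1) (Suc n)\<close> is
      absent and has to be divided out.\<close>
    have 2: "pochhammer a (Suc n) = a * ((a + 1) * Q / (a + 1 + real n))"
    proof -
      have "pochhammer (a + 1) n * (a + 1 + real n) = (a + 1) * Q"
        using 1 by (simp add: pochhammer_Suc)
      then have "pochhammer (a + 1) n = (a + 1) * Q / (a + 1 + real n)"
        using a by (subst eq_divide_eq) auto
      then show ?thesis by (simp only: pochhammer_rec)
    qed
    have 3: "\<nu> + 1 = a" "\<nu> + 1 + 1 = a + 1" "\<nu> + 2 = a + 1" "a + 1 + 1 = a + 2"
      by (auto simp: a_def)
    have nz: "a \<noteq> 0" "a + 1 \<noteq> 0" "a + 1 + real n \<noteq> 0" "Q \<noteq> 0" "1 + real n \<noteq> 0"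
      using a Q by auto
    show ?thesis
      unfolding bessel_coeff_def 3 1 2 Q_def[symmetric] using nz
      by (simp add: divide_simps) (simp add: algebra_simps)
  qed
  define u where "u = z\<^sup>2"
  have s: "summable (\<lambda>n. bessel_coeff \<nu> n * u ^ n)" "summable (\<lambda>n. bessel_coeff (\<nu> + 1) n * u ^ n)"
    "summable (\<lambda>n. bessel_coeff (\<nu> + 2) n * u ^ n)"
    using assms by (auto intro: summable_bessel)
  have s1: "summable (\<lambda>n. bessel_coeff (\<nu> + 1) (Suc n) * u ^ Suc n)"
    using s(2) by (subst summable_Suc_iff)
  \<comment> \<open>The constant terms of the two series for \<open>\<nu>\<close> and
    \<open>\<nu> + 1\<close> are both 1, so only the tails have to be compared.\<close>
  have "(\<Sum>n. bessel_coeff \<nu> n * u ^ n) = 1 + (\<Sum>n. bessel_coeff \<nu> (Suc n) * u ^ Suc n)"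
    using suminf_split_head[OF s(1)] by (simp add: bessel_coeff_def)
  also have "(\<lambda>n. bessel_coeff \<nu> (Suc n) * u ^ Suc n) =
      (\<lambda>n. bessel_coeff (\<nu> + 1) (Suc n) * u ^ Suc n
        - u / (4 * (\<nu> + 1) * (\<nu> + 2)) * (bessel_coeff (\<nu> + 2) n * u ^ n))"
  proof -
    have "(P - 1 / D * E) * u ^ Suc n = P * u ^ Suc n - u / D * (E * u ^ n)" for P D E and n :: nat
      by (simp add: left_diff_distrib)
    then show ?thesis unfolding coeff by (simp only:)
  qed
  also have "suminf \<dots> = (\<Sum>n. bessel_coeff (\<nu> + 1) (Suc n) * u ^ Suc n)
      - u / (4 * (\<nu> + 1) * (\<nu> + 2)) * (\<Sum>n. bessel_coeff (\<nu> + 2) n * u ^ n)"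
    unfolding suminf_mult[OF s(3), symmetric]
    by (rule suminf_diff[symmetric, OF s1 summable_mult[OF s(3)]])
  also have "1 + \<dots> = (\<Sum>n. bessel_coeff (\<nu> + 1) n * u ^ n)
      - u / (4 * (\<nu> + 1) * (\<nu> + 2)) * (\<Sum>n. bessel_coeff (\<nu> + 2) n * u ^ n)"
    using suminf_split_head[OF s(2)] by (simp add: bessel_coeff_def)
  finally show ?thesis
    using assms by (simp add: bessel_j_series u_def)
qed

lemma bessel_j_0: "\<nu> \<ge> - 1 / 2 \<Longrightarrow> bessel_j \<nu> 0 = 1"
  by (simp add: bessel_j_series powser_zero) (simp add: bessel_coeff_def)

lemma bessel_j_minus: "\<nu> \<ge> - 1 / 2 \<Longrightarrow> bessel_j \<nu> (- z) = bessel_j \<nu> z"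
  by (simp add: bessel_j_series)

lemma bessel_denominators: "x * (1 / (2 * p)) * (- x / (2 * q) * J) = - x\<^sup>2 / (4 * p * q) * (J :: real)"
  by (simp add: power2_eq_square)

section \<open>The energy estimate for Bessel functions\<close>

lemma DERIV_ident_mult:
  fixes f :: "real \<Rightarrow> real"
  assumes "(f has_field_derivative D) (at x)"
  shows "((\<lambda>t. t * c * f t) has_field_derivative c * f x + x * c * D) (at x)"
  using assms by (auto intro!: derivative_eq_intros)

lemma DERIV_sum_squares:
  fixes f g :: "real \<Rightarrow> real"
  assumes "(f has_field_derivative D) (at x)" "(g has_field_derivative E) (at x)"
  shows "((\<lambda>t. (f t)\<^sup>2 + (g t)\<^sup>2) has_field_derivative 2 * f x * D + 2 * g x * E) (at x)"
  using assms by (auto intro!: derivative_eq_intros)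

text \<open>With \<open>y = bessel_j \<nu>\<close> the second summand is the square of
  \<open>y'\<close>, and \<open>y'' + (2 * \<nu> + 1) / t * y' + y = 0\<close>. The energy
  \<open>y\<^sup>2 + y'\<^sup>2\<close> equals 1 at the origin and does not increase, because the
  damping coefficient \<open>2 * \<nu> + 1\<close> is nonnegative.\<close>

lemma bessel_energy_nonneg:
  assumes \<nu>: "\<nu> \<ge> - 1 / 2" and "t \<ge> 0"
  shows "(bessel_j \<nu> t)\<^sup>2 + (t / (2 * (\<nu> + 1)) * bessel_j (\<nu> + 1) t)\<^sup>2 \<le> 1"
proof -
  define F where "F = (\<lambda>t. (bessel_j \<nu> t)\<^sup>2 + (t / (2 * (\<nu> + 1)) * bessel_j (\<nu> + 1) t)\<^sup>2)"
  have \<nu>1: "\<nu> + 1 > 0" "\<nu> + 2 > 0" using \<nu> by auto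
  have "F t \<le> F 0"
  proof (rule DERIV_nonpos_imp_nonincreasing[OF \<open>t \<ge> 0\<close>])
    fix x assume x: "0 \<le> x" "x \<le> t"
    define A B where "A = bessel_j \<nu> x" and "B = bessel_j (\<nu> + 1) x"
    have A': "(bessel_j \<nu> has_field_derivative - x / (2 * (\<nu> + 1)) * B) (at x)"
      unfolding B_def by (rule DERIV_bessel_j[OF \<nu>])
    have B': "(bessel_j (\<nu> + 1) has_field_derivative - x / (2 * (\<nu> + 2)) * bessel_j (\<nu> + 2) x) (at x)"
      using DERIV_bessel_j[of "\<nu> + 1" x] \<nu> by (simp add: add.assoc)
    have rec: "- x\<^sup>2 / (4 * (\<nu> + 1) * (\<nu> + 2)) * bessel_j (\<nu> + 2) x = A - B"
      using bessel_j_recurrence[OF \<nu>, of x] by (simp add: A_def B_def)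
    have "((\<lambda>t. t * (1 / (2 * (\<nu> + 1))) * bessel_j (\<nu> + 1) t) has_field_derivative
        (1 / (2 * (\<nu> + 1))) * B + (x * (1 / (2 * (\<nu> + 1)))) * (- x / (2 * (\<nu> + 2)) * bessel_j (\<nu> + 2) x)) (at x)"
      unfolding B_def by (rule DERIV_ident_mult[OF B'])
    also have "(1 / (2 * (\<nu> + 1))) * B + (x * (1 / (2 * (\<nu> + 1)))) * (- x / (2 * (\<nu> + 2)) * bessel_j (\<nu> + 2) x)
        = (1 / (2 * (\<nu> + 1))) * B + (- x\<^sup>2 / (4 * (\<nu> + 1) * (\<nu> + 2)) * bessel_j (\<nu> + 2) x)"
      by (simp only: bessel_denominators)
    also have "\<dots> = A - (2 * \<nu> + 1) / (2 * (\<nu> + 1)) * B"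
      unfolding rec using \<nu>1 by (simp add: field_simps)
    \<comment> \<open>This is the differential equation for \<open>- y''\<close>; in terms of
      \<open>B\<close> there is no division by \<open>x\<close>, so it holds at the origin as
      well.\<close>
    finally have C': "((\<lambda>t. t / (2 * (\<nu> + 1)) * bessel_j (\<nu> + 1) t) has_field_derivative
        A - (2 * \<nu> + 1) / (2 * (\<nu> + 1)) * B) (at x)" by simp
    have "(F has_field_derivative (2 * A * (- x / (2 * (\<nu> + 1)) * B) +
        2 * (x / (2 * (\<nu> + 1)) * B) * (A - (2 * \<nu> + 1) / (2 * (\<nu> + 1)) * B))) (at x)"
      unfolding F_def A_def B_def by (rule DERIV_sum_squares[OF A' C', unfolded A_def B_def])
    also have "2 * A * (- x / (2 * (\<nu> + 1)) * B) +
        2 * (x / (2 * (\<nu> + 1)) * B) * (A - (2 * \<nu> + 1) / (2 * (\<nu> + 1)) * B)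
        = - (x * (2 * \<nu> + 1) / (2 * (\<nu> + 1)\<^sup>2) * B\<^sup>2)"
    proof -
      have "2 * A * (- x / (2 * q) * B) + 2 * (x / (2 * q) * B) * (A - r / (2 * q) * B)
          = - (x * r / (2 * q\<^sup>2) * B\<^sup>2)" for q r :: real
        by (simp add: algebra_simps power2_eq_square)
      then show ?thesis .
    qed
    finally have "(F has_field_derivative - (x * (2 * \<nu> + 1) / (2 * (\<nu> + 1)\<^sup>2) * B\<^sup>2)) (at x)" .
    moreover have "0 \<le> x * (2 * \<nu> + 1) / (2 * (\<nu> + 1)\<^sup>2) * B\<^sup>2"
      using \<nu> x by (intro mult_nonneg_nonneg divide_nonneg_nonneg) auto
    ultimately show "\<exists>y. DERIV F x :> y \<and> y \<le> 0"
      by (metis neg_le_0_iff_le)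
  qed
  also have "F 0 = 1" using \<nu> by (simp add: F_def bessel_j_0)
  finally show ?thesis by (simp add: F_def)
qed

lemma bessel_energy:
  assumes \<nu>: "\<nu> \<ge> - 1 / 2"
  shows "(bessel_j \<nu> t)\<^sup>2 + (t / (2 * (\<nu> + 1)) * bessel_j (\<nu> + 1) t)\<^sup>2 \<le> 1"
proof (cases "t \<ge> 0")
  case False
  then show ?thesis
    using bessel_energy_nonneg[OF \<nu>, of "- t"] \<nu> by (simp add: bessel_j_minus)
qed (use bessel_energy_nonneg \<nu> in blast)

lemma abs_bessel_j_le_1:
  assumes "\<nu> \<ge> - 1 / 2"
  shows "\<bar>bessel_j \<nu> t\<bar> \<le> 1"
proof -
  have "(bessel_j \<nu> t)\<^sup>2 \<le> 1"
    using bessel_energy[OF assms, of t]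
      zero_le_power2[of "t / (2 * (\<nu> + 1)) * bessel_j (\<nu> + 1) t"] by linarith
  then show ?thesis by (simp add: abs_square_le_1)
qed

text \<open>The real and imaginary parts of the kernel are the two components of the energy, so its
  squared modulus is the energy itself.\<close>

lemma norm_dunkl_kernel_le_1:
  assumes "k \<ge> - 1 / 2"
  shows "norm (dunkl_kernel k \<xi> x) \<le> 1"
proof -
  have "dunkl_kernel k \<xi> x = Complex (bessel_j k (\<xi> * x))
      (\<xi> * x / (2 * (k + 1)) * bessel_j (k + 1) (\<xi> * x))"
    by (simp add: dunkl_kernel_def complex_eq_iff)
  then show ?thesis
    using bessel_energy[OF assms, of "\<xi> * x"] by (simp add: cmod_def)
qed

lemma cnj_dunkl_kernel:
  assumes "k \<ge> - 1 / 2"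
  shows "cnj (dunkl_kernel k \<xi> x) = dunkl_kernel k (- \<xi>) x"
  using assms by (simp add: dunkl_kernel_def bessel_j_minus)

lemma continuous_on_bessel_j:
  assumes "\<nu> \<ge> - 1 / 2"
  shows "continuous_on S (bessel_j \<nu>)"
  using DERIV_bessel_j[OF assms] DERIV_isCont continuous_at_imp_continuous_on by blast

lemma continuous_on_dunkl_kernel [continuous_intros]:
  assumes "k \<ge> - 1 / 2" "continuous_on S f" "continuous_on S g"
  shows "continuous_on S (\<lambda>x. dunkl_kernel k (f x) (g x))"
proof -
  have "continuous_on S (\<lambda>x. bessel_j \<nu> (f x * g x))" if "\<nu> \<ge> - 1 / 2" for \<nu>
    using assms that by (intro continuous_on_compose2[OF continuous_on_bessel_j[OF that, of UNIV]]
        continuous_intros) auto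
  moreover have nz: "complex_of_real (2 * (k + 1)) \<noteq> 0"
    using assms(1) by (simp only: of_real_eq_0_iff) simp
  ultimately show ?thesis
    unfolding dunkl_kernel_def using assms by (intro continuous_intros ballI nz) auto
qed

section \<open>Growth of the derivatives of the kernel in its second variable\<close>

definition poly_weight :: "nat \<Rightarrow> real \<Rightarrow> real" where
  "poly_weight N x = (1 + \<bar>x\<bar>) ^ N"

lemma weight_poly_weight: "weight I poly_weight"
  by (auto simp: weight_def poly_weight_def intro!: monoI power_increasing)

lemma tame_mult_poly_weight:
  assumes "tame I poly_weight n \<Phi>" "tame I poly_weight n \<Psi>"
  shows "tame I poly_weight n (\<lambda>p x. \<Phi> p x * \<Psi> p x)"
  using assms
  by (rule tame_mult[OF weight_poly_weight weight_poly_weight weight_poly_weight, rotated])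
    (simp add: poly_weight_def power_add)

lemma tame_poly_weight_product:
  "tame I poly_weight n (\<lambda>x \<xi>. of_real (x * \<xi>))"
proof -
  have *: "tame I poly_weight n (\<lambda>x \<xi>. of_real x)" for n
    by (rule tame_const[OF weight_poly_weight, of _ _ 1 1]) (simp add: poly_weight_def)
  have "poly_bounded I poly_weight (\<lambda>x \<xi>. of_real (x * \<xi>))"
    by (rule poly_boundedI[OF weight_poly_weight, of _ _ 1 1 1])
      (simp only: norm_of_real abs_mult poly_weight_def power_one_right mult_1, intro mult_mono, auto)
  moreover have "((\<lambda>\<xi>. of_real (x * \<xi>)) has_vector_derivative complex_of_real x) (at \<xi>)" for x \<xi>
    by (auto intro!: derivative_eq_intros simp: scaleR_conv_of_real)
  ultimately show ?thesis
    using * by (cases n) (auto intro!: tame_SucI simp del: tame.simps(2))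
qed

text \<open>The induction has to vary \<open>\<nu>\<close>, since a derivative raises it by one.
  Each derivative also brings out a polynomial factor in \<open>x\<close> and \<open>\<xi>\<close>,
  while the Bessel function that remains is bounded by 1.\<close>

lemma tame_bessel_j:
  assumes "\<nu> \<ge> - 1 / 2"
  shows "tame UNIV poly_weight n (\<lambda>x \<xi>. of_real (bessel_j \<nu> (x * \<xi>)))"
  using assms
proof (induction n arbitrary: \<nu>)
  case (0 \<nu>)
  then show ?case
    unfolding tame.simps
    by (intro poly_boundedI[OF weight_poly_weight, where C = 1 and M = 0 and L = 0])
      (simp add: abs_bessel_j_le_1 poly_weight_def)
next
  case (Suc n \<nu>)
  show ?case
  proof (rule tame_SucI)
    show "poly_bounded UNIV poly_weight (\<lambda>x \<xi>. complex_of_real (bessel_j \<nu> (x * \<xi>)))"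
      using Suc.IH[OF Suc.prems] by (rule tame_poly_bounded)
    show "((\<lambda>\<xi>. complex_of_real (bessel_j \<nu> (x * \<xi>))) has_vector_derivative
        of_real (x * \<xi>) * (of_real (- x / (2 * (\<nu> + 1))) * of_real (bessel_j (\<nu> + 1) (x * \<xi>)))) (at \<xi>)" for x \<xi>
    proof -
      have "((\<lambda>\<xi>. bessel_j \<nu> (x * \<xi>)) has_field_derivative
          (- (x * \<xi>) / (2 * (\<nu> + 1)) * bessel_j (\<nu> + 1) (x * \<xi>)) * x) (at \<xi>)"
        by (rule DERIV_chain2[OF DERIV_bessel_j[OF Suc.prems]]) (auto intro!: derivative_eq_intros)
      then have "((\<lambda>\<xi>. complex_of_real (bessel_j \<nu> (x * \<xi>))) has_vector_derivative
          of_real ((- (x * \<xi>) / (2 * (\<nu> + 1)) * bessel_j (\<nu> + 1) (x * \<xi>)) * x)) (at \<xi>)"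
        by (intro has_vector_derivative_of_real) (simp add: has_real_derivative_iff_has_vector_derivative)
      then show ?thesis by (simp add: mult_ac)
    qed
    have "tame UNIV poly_weight n (\<lambda>x \<xi>. complex_of_real (- x / (2 * (\<nu> + 1))))"
    proof (rule tame_const[OF weight_poly_weight, of _ _ "1 / (2 * (\<nu> + 1))" 1])
      fix x :: real
      have "norm (complex_of_real (- x / (2 * (\<nu> + 1)))) = \<bar>x\<bar> / (2 * (\<nu> + 1))"
        using Suc.prems by (subst norm_of_real) simp
      also have "\<dots> \<le> 1 / (2 * (\<nu> + 1)) * poly_weight 1 x"
        using Suc.prems by (simp add: poly_weight_def divide_right_mono)
      finally show "norm (complex_of_real (- x / (2 * (\<nu> + 1)))) \<le> 1 / (2 * (\<nu> + 1)) * poly_weight 1 x" .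
    qed
    then show "tame UNIV poly_weight n (\<lambda>x \<xi>. of_real (x * \<xi>) *
        (of_real (- x / (2 * (\<nu> + 1))) * of_real (bessel_j (\<nu> + 1) (x * \<xi>))))"
      using Suc.prems by (intro tame_mult_poly_weight tame_poly_weight_product Suc.IH) auto
  qed
qed

lemma tame_dunkl_kernel:
  assumes "k \<ge> - 1 / 2"
  shows "tame UNIV poly_weight n (\<lambda>x \<xi>. dunkl_kernel k x \<xi>)"
proof -
  have "tame UNIV poly_weight n (\<lambda>x \<xi>. \<i> / of_real (2 * (k + 1)))"
    by (rule tame_const[OF weight_poly_weight, of _ _ "norm (\<i> / of_real (2 * (k + 1)))" 0])
      (simp add: poly_weight_def)
  then have "tame UNIV poly_weight n (\<lambda>x \<xi>. of_real (bessel_j k (x * \<xi>)) +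
      \<i> / of_real (2 * (k + 1)) * (of_real (x * \<xi>) * of_real (bessel_j (k + 1) (x * \<xi>))))"
    using assms by (intro tame_add[OF weight_poly_weight] tame_mult_poly_weight
        tame_poly_weight_product tame_bessel_j) auto
  then show ?thesis by (simp add: dunkl_kernel_def mult_ac)
qed

text \<open>The eigenvalue equation of the Dunkl operator, multiplied by \<open>x\<close>.\<close>

lemma dunkl_kernel_derivative:
  assumes k: "k \<ge> - 1 / 2"
  obtains \<phi>' where "\<And>x. ((\<lambda>x. dunkl_kernel k \<eta> x) has_vector_derivative \<phi>' x) (at x)"
    "\<And>x. of_real x * \<phi>' x + of_real (k + 1 / 2) * (dunkl_kernel k \<eta> x - dunkl_kernel k \<eta> (- x))
      = of_real x * (\<i> * of_real \<eta> * dunkl_kernel k \<eta> x)"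
proof -
  define A B where "A = (\<lambda>x. bessel_j k (\<eta> * x))" and "B = (\<lambda>x. bessel_j (k + 1) (\<eta> * x))"
  have k1: "k + 1 > 0" "k + 2 > 0" using k by auto
  have A': "(A has_field_derivative - (\<eta> * x) / (2 * (k + 1)) * B x * \<eta>) (at x)" for x
    unfolding A_def B_def
    by (rule DERIV_chain2[OF DERIV_bessel_j[OF k]]) (auto intro!: derivative_eq_intros)
  have C': "((\<lambda>x. (\<eta> * x) / (2 * (k + 1)) * B x) has_field_derivative
      \<eta> * (A x - (2 * k + 1) / (2 * (k + 1)) * B x)) (at x)" for x
  proof -
  have "(bessel_j (k + 1) has_field_derivative - (\<eta> * x) / (2 * (k + 2)) * bessel_j (k + 2) (\<eta> * x)) (at (\<eta> * x))"
    using k DERIV_bessel_j[of "k + 1" "\<eta> * x"] by (simp add: add.assoc)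
  then have "(B has_field_derivative - (\<eta> * x) / (2 * (k + 2)) * bessel_j (k + 2) (\<eta> * x) * \<eta>) (at x)"
    unfolding B_def by (rule DERIV_chain2) (auto intro!: derivative_eq_intros)
  from DERIV_ident_mult[OF this, of "\<eta> / (2 * (k + 1))"]
  have "((\<lambda>x. (\<eta> * x) / (2 * (k + 1)) * B x) has_field_derivative
      \<eta> / (2 * (k + 1)) * B x + (\<eta> * x) / (2 * (k + 1)) *
        (- (\<eta> * x) / (2 * (k + 2)) * bessel_j (k + 2) (\<eta> * x) * \<eta>)) (at x)"
    by (simp add: mult_ac)
  also have "\<eta> / (2 * (k + 1)) * B x + (\<eta> * x) / (2 * (k + 1)) *
        (- (\<eta> * x) / (2 * (k + 2)) * bessel_j (k + 2) (\<eta> * x) * \<eta>)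
      = \<eta> / (2 * (k + 1)) * B x + \<eta> * (- (\<eta> * x)\<^sup>2 / (4 * (k + 1) * (k + 2)) * bessel_j (k + 2) (\<eta> * x))"
  proof -
    have "(\<eta> * x) / (2 * (k + 1)) * (- (\<eta> * x) / (2 * (k + 2)) * bessel_j (k + 2) (\<eta> * x) * \<eta>)
        = \<eta> * ((\<eta> * x) * (1 / (2 * (k + 1))) * (- (\<eta> * x) / (2 * (k + 2)) * bessel_j (k + 2) (\<eta> * x)))"
      by simp
    then show ?thesis by (simp only: bessel_denominators)
  qed
  also have "- (\<eta> * x)\<^sup>2 / (4 * (k + 1) * (k + 2)) * bessel_j (k + 2) (\<eta> * x) = A x - B x"
    using bessel_j_recurrence[OF k, of "\<eta> * x"] by (simp add: A_def B_def)
  also have "\<eta> / (2 * (k + 1)) * B x + \<eta> * (A x - B x) = \<eta> * (A x - (2 * k + 1) / (2 * (k + 1)) * B x)"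
    using k1 by (simp add: field_simps)
  finally show "((\<lambda>x. (\<eta> * x) / (2 * (k + 1)) * B x) has_field_derivative
      \<eta> * (A x - (2 * k + 1) / (2 * (k + 1)) * B x)) (at x)" .
  qed
  have eq: "dunkl_kernel k \<eta> = (\<lambda>x. of_real (A x) + \<i> * of_real ((\<eta> * x) / (2 * (k + 1)) * B x))"
    by (rule ext) (simp add: dunkl_kernel_def A_def B_def)
  define \<phi>' where "\<phi>' = (\<lambda>x. complex_of_real (- (\<eta> * x) / (2 * (k + 1)) * B x * \<eta>)
      + \<i> * of_real (\<eta> * (A x - (2 * k + 1) / (2 * (k + 1)) * B x)))"
  have 1: "(dunkl_kernel k \<eta> has_vector_derivative \<phi>' x) (at x)" for x
    unfolding eq \<phi>'_def using A' C'
    by (intro has_vector_derivative_add has_vector_derivative_mult_right has_vector_derivative_of_real)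
      (auto simp: has_real_derivative_iff_has_vector_derivative)
  have par: "A (- x) = A x" "B (- x) = B x" for x
    using k bessel_j_minus[of k "\<eta> * x"] bessel_j_minus[of "k + 1" "\<eta> * x"] by (simp_all add: A_def B_def)
  have 2: "of_real x * \<phi>' x + of_real (k + 1 / 2) * (dunkl_kernel k \<eta> x - dunkl_kernel k \<eta> (- x))
      = of_real x * (\<i> * of_real \<eta> * dunkl_kernel k \<eta> x)" for x
  proof -
    \<comment> \<open>The identity holds for any value of this reciprocal; giving it a name removes
      all denominators.\<close>
    define c where "c = 1 / (2 * (k + 1))"
    have c: "a / (2 * (k + 1)) = a * c" for a by (simp add: c_def)
    show ?thesis
      unfolding eq \<phi>'_def par c by (simp add: complex_eq_iff) (simp add: algebra_simps)
  qed
  show thesis by (rule that[of \<phi>', OF 1 2])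
qed

section \<open>Differentiation under the integral\<close>

lemma integrable_dominated:
  fixes f :: "'a \<Rightarrow> complex"
  assumes "integrable M G" "f \<in> borel_measurable M" "\<And>s. s \<in> space M \<Longrightarrow> norm (f s) \<le> G s"
  shows "integrable M f"
proof (rule Bochner_Integration.integrable_bound[OF assms(1,2)], rule AE_I2)
  show "norm (f s) \<le> norm (G s)" if "s \<in> space M" for s
    using assms(3)[OF that] by simp
qed

lemma tendsto_difference_quotient:
  fixes f :: "real \<Rightarrow> complex"
  assumes "(f has_vector_derivative D) (at x)"
  shows "((\<lambda>h. (f (x + h) - f x) /\<^sub>R h) \<longlongrightarrow> D) (at 0)"
proof (rule LIM_zero_cancel, rule tendsto_norm_zero_cancel)
  have "((\<lambda>h. norm (f (x + h) - f x - h *\<^sub>R D) / norm h) \<longlongrightarrow> 0) (at 0)"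
    using assms by (simp add: has_vector_derivative_def has_derivative_at)
  moreover have "eventually (\<lambda>h. norm (f (x + h) - f x - h *\<^sub>R D) / norm h
      = norm ((f (x + h) - f x) /\<^sub>R h - D)) (at 0)"
  proof (rule eventually_mono[OF eventually_neq_at_within[of 0]])
    fix h :: real assume h: "h \<noteq> 0"
    have "norm (f (x + h) - f x - h *\<^sub>R D) / norm h = norm ((f (x + h) - f x - h *\<^sub>R D) /\<^sub>R h)"
      by (simp add: divide_inverse mult.commute)
    also have "(f (x + h) - f x - h *\<^sub>R D) /\<^sub>R h = (f (x + h) - f x) /\<^sub>R h - D"
      using h by (simp add: scaleR_diff_right)
    finally show "norm (f (x + h) - f x - h *\<^sub>R D) / norm h = norm ((f (x + h) - f x) /\<^sub>R h - D)" .
  qed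
  ultimately show "((\<lambda>h. norm ((f (x + h) - f x) /\<^sub>R h - D)) \<longlongrightarrow> 0) (at 0)"
    by (rule Lim_transform_eventually)
qed

text \<open>The derivative is a pointwise limit of difference quotients with step
  \<open>1 / (n + 1)\<close>, so measurability at each point passes on to the derivatives and need
  not be assumed for them.\<close>

lemma borel_measurable_vector_derivative:
  fixes \<Phi> \<Phi>' :: "'a \<Rightarrow> real \<Rightarrow> complex"
  assumes deriv: "\<And>s. s \<in> space M \<Longrightarrow> (\<Phi> s has_vector_derivative \<Phi>' s x) (at x)"
    and meas: "\<And>y. (\<lambda>s. \<Phi> s y) \<in> borel_measurable M"
  shows "(\<lambda>s. \<Phi>' s x) \<in> borel_measurable M"
proof (rule borel_measurable_LIMSEQ_metric)
  define h where "h = (\<lambda>n. inverse (real (Suc n)))"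
  have h: "h \<longlonglongrightarrow> 0" "\<And>n. h n > 0"
    unfolding h_def using LIMSEQ_inverse_real_of_nat by auto
  show "(\<lambda>s. (\<Phi> s (x + h n) - \<Phi> s x) /\<^sub>R h n) \<in> borel_measurable M" for n
    using meas by measurable
  show "(\<lambda>n. (\<Phi> s (x + h n) - \<Phi> s x) /\<^sub>R h n) \<longlonglongrightarrow> \<Phi>' s x" if s: "s \<in> space M" for s
  proof -
    have "filterlim h (at 0) sequentially"
      unfolding filterlim_at using h by (auto simp: less_imp_neq[symmetric])
    then show ?thesis
      by (rule filterlim_compose[OF tendsto_difference_quotient[OF deriv[OF s]]])
  qed
qed

text \<open>A majorant near \<open>x\<close> suffices: by the mean value inequality on the unit ball
  around \<open>x\<close> the normalised remainder of the first-order expansion is at most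
  \<open>2 * G s\<close>, and it tends to 0 pointwise. Dominated convergence does the rest.\<close>

lemma has_vector_derivative_integral:
  fixes \<Phi> \<Phi>' :: "'a \<Rightarrow> real \<Rightarrow> complex"
  assumes deriv: "\<And>s y. s \<in> space M \<Longrightarrow> (\<Phi> s has_vector_derivative \<Phi>' s y) (at y)"
    and int: "\<And>y. integrable M (\<lambda>s. \<Phi> s y)"
    and dom: "\<And>s y. s \<in> space M \<Longrightarrow> \<bar>y - x\<bar> \<le> 1 \<Longrightarrow> norm (\<Phi>' s y) \<le> G s" "integrable M G"
  shows "((\<lambda>y. LINT s|M. \<Phi> s y) has_vector_derivative (LINT s|M. \<Phi>' s x)) (at x)"
proof -
  have meas: "(\<lambda>s. \<Phi>' s y) \<in> borel_measurable M" for y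
    by (rule borel_measurable_vector_derivative[OF deriv borel_measurable_integrable[OF int]])
  have int': "integrable M (\<lambda>s. \<Phi>' s x)"
    by (rule integrable_dominated[OF dom(2) meas dom(1)]) auto
  define R where "R = (\<lambda>y s. (\<Phi> s y - \<Phi> s x - (y - x) *\<^sub>R \<Phi>' s x) /\<^sub>R \<bar>y - x\<bar>)"
  have R_bound: "norm (R y s) \<le> 2 * G s" if s: "s \<in> space M" and y: "\<bar>y - x\<bar> \<le> 1" for y s
  proof -
    have "norm (\<Phi> s y - \<Phi> s x) \<le> G s * norm (y - x)"
    proof (rule differentiable_bound[where S = "cball x 1"])
      show "(\<Phi> s has_derivative (\<lambda>t. t *\<^sub>R \<Phi>' s z)) (at z within cball x 1)" for z
        using deriv[OF s, of z] by (auto simp: has_vector_derivative_def intro: has_derivative_at_withinI)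
      show "onorm (\<lambda>t. t *\<^sub>R \<Phi>' s z) \<le> G s" if "z \<in> cball x 1" for z
        using that dom(1)[OF s, of z] by (intro onorm_scaleR_le) (auto simp: dist_real_def abs_minus_commute)
    qed (use y in \<open>auto simp: dist_real_def abs_minus_commute\<close>)
    moreover have "norm ((y - x) *\<^sub>R \<Phi>' s x) \<le> G s * norm (y - x)"
      using mult_left_mono[OF dom(1)[OF s, of x], of "\<bar>y - x\<bar>"] by (simp add: mult.commute)
    ultimately have "norm (\<Phi> s y - \<Phi> s x - (y - x) *\<^sub>R \<Phi>' s x) \<le> 2 * G s * \<bar>y - x\<bar>"
      using norm_triangle_ineq4[of "\<Phi> s y - \<Phi> s x" "(y - x) *\<^sub>R \<Phi>' s x"] by simp
    moreover have "0 \<le> G s" using order_trans[OF norm_ge_zero dom(1)[OF s, of x]] by simp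
    ultimately show ?thesis
      by (cases "y = x") (auto simp: R_def divide_simps mult.commute)
  qed
  have R_lim: "((\<lambda>y. R y s) \<longlongrightarrow> 0) (at x)" if s: "s \<in> space M" for s
    using deriv[OF s, of x] unfolding has_vector_derivative_def has_derivative_iff_norm R_def
    by (subst tendsto_norm_zero_iff[symmetric]) (simp add: divide_inverse mult.commute)
  have "((\<lambda>y. LINT s|M. R y s) \<longlongrightarrow> 0) (at x)"
    unfolding tendsto_at_iff_sequentially
  proof (intro allI impI)
    fix X :: "nat \<Rightarrow> real" assume X: "\<forall>i. X i \<in> UNIV - {x}" "X \<longlonglongrightarrow> x"
    have "eventually (\<lambda>i. \<bar>X i - x\<bar> < 1) sequentially"
      using X(2) by (simp add: tendsto_iff dist_real_def)
    then obtain N where N: "\<And>i. i \<ge> N \<Longrightarrow> \<bar>X i - x\<bar> < 1"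
      by (auto simp: eventually_sequentially)
    \<comment> \<open>The majorant is available only within distance 1 of \<open>x\<close>, so the
      sequence is shifted until all its members lie there.\<close>
    have "(\<lambda>i. LINT s|M. R (X (i + N)) s) \<longlonglongrightarrow> (LINT s|M. 0)"
    proof (rule integral_dominated_convergence)
      show "(\<lambda>s. R (X (i + N)) s) \<in> borel_measurable M" for i
        unfolding R_def using int meas by (intro borel_measurable_scaleR borel_measurable_diff) auto
      show "integrable M (\<lambda>s. 2 * G s)" using dom(2) by simp
      show "AE s in M. norm (R (X (i + N)) s) \<le> 2 * G s" for i
        using R_bound N[of "i + N"] by (intro AE_I2) auto
      show "AE s in M. (\<lambda>i. R (X (i + N)) s) \<longlonglongrightarrow> 0"
      proof (rule AE_I2)
        fix s assume "s \<in> space M"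
        then have "((\<lambda>y. R y s) \<circ> X) \<longlonglongrightarrow> 0"
          using R_lim X unfolding tendsto_at_iff_sequentially by blast
        then show "(\<lambda>i. R (X (i + N)) s) \<longlonglongrightarrow> 0"
          using LIMSEQ_ignore_initial_segment[of "(\<lambda>y. R y s) \<circ> X" 0 N] by (simp add: o_def)
      qed
    qed auto
    then show "((\<lambda>y. LINT s|M. R y s) \<circ> X) \<longlonglongrightarrow> 0"
      using LIMSEQ_offset[of "(\<lambda>y. LINT s|M. R y s) \<circ> X" N 0] by (simp add: o_def)
  qed
  moreover have "(LINT s|M. R y s) = ((LINT s|M. \<Phi> s y) - (LINT s|M. \<Phi> s x) - (y - x) *\<^sub>R (LINT s|M. \<Phi>' s x)) /\<^sub>R \<bar>y - x\<bar>" for y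
    unfolding R_def using int int' by simp
  ultimately have "((\<lambda>y. norm (((LINT s|M. \<Phi> s y) - (LINT s|M. \<Phi> s x) - (y - x) *\<^sub>R (LINT s|M. \<Phi>' s x)) /\<^sub>R \<bar>y - x\<bar>)) \<longlongrightarrow> 0) (at x)"
    by (subst tendsto_norm_zero_iff) simp
  then show ?thesis
    unfolding has_vector_derivative_def has_derivative_iff_norm
    by (simp add: bounded_linear_scaleR_left divide_inverse mult.commute)
qed

text \<open>The majorant may depend on the order \<open>n\<close> and on the radius
  \<open>R\<close>. This local form fits integrands whose derivatives grow in the parameter.\<close>

lemma smooth_integral:
  fixes \<Phi> :: "'a \<Rightarrow> real \<Rightarrow> complex"
  assumes smooth: "\<And>s. s \<in> space M \<Longrightarrow> smooth (\<Phi> s)"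
    and meas: "\<And>x. (\<lambda>s. \<Phi> s x) \<in> borel_measurable M"
    and dom: "\<And>n R. \<exists>G. integrable M G \<and>
      (\<forall>s\<in>space M. \<forall>y. \<bar>y\<bar> \<le> R \<longrightarrow> norm ((vderiv ^^ n) (\<Phi> s) y) \<le> G s)"
  shows "smooth (\<lambda>x. LINT s|M. \<Phi> s x)"
    and "(vderiv ^^ n) (\<lambda>x. LINT s|M. \<Phi> s x) = (\<lambda>x. LINT s|M. (vderiv ^^ n) (\<Phi> s) x)"
    and "integrable M (\<lambda>s. (vderiv ^^ n) (\<Phi> s) x)"
proof -
  have meas_n: "(\<lambda>s. (vderiv ^^ n) (\<Phi> s) x) \<in> borel_measurable M" for n x
  proof (induction n arbitrary: x)
    case (Suc n)
    show ?case
      by (rule borel_measurable_vector_derivative[OF _ Suc.IH])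
        (rule smooth_has_vector_derivative[OF smooth])
  qed (simp add: meas)
  have int: "integrable M (\<lambda>s. (vderiv ^^ n) (\<Phi> s) x)" for n x
  proof -
    obtain G where "integrable M G" "\<And>s. s \<in> space M \<Longrightarrow> norm ((vderiv ^^ n) (\<Phi> s) x) \<le> G s"
      using dom[of "\<bar>x\<bar>" n] by auto
    then show ?thesis
      by (rule integrable_dominated[OF _ meas_n])
  qed
  have deriv: "((\<lambda>y. LINT s|M. (vderiv ^^ n) (\<Phi> s) y) has_vector_derivative
      (LINT s|M. (vderiv ^^ Suc n) (\<Phi> s) x)) (at x)" for n x
  proof -
    obtain G where G: "integrable M G"
      "\<And>s y. s \<in> space M \<Longrightarrow> \<bar>y\<bar> \<le> \<bar>x\<bar> + 1 \<Longrightarrow> norm ((vderiv ^^ Suc n) (\<Phi> s) y) \<le> G s"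
      using dom[of "\<bar>x\<bar> + 1" "Suc n"] by blast
    show ?thesis
      by (rule has_vector_derivative_integral[OF smooth_has_vector_derivative[OF smooth] int _ G(1)])
        (auto simp: G(2) simp del: funpow.simps)
  qed
  have eq: "(vderiv ^^ n) (\<lambda>x. LINT s|M. \<Phi> s x) = (\<lambda>x. LINT s|M. (vderiv ^^ n) (\<Phi> s) x)" for n
  proof (induction n)
    case (Suc n)
    have "vderiv ((vderiv ^^ n) (\<lambda>x. LINT s|M. \<Phi> s x)) = (\<lambda>x. LINT s|M. (vderiv ^^ Suc n) (\<Phi> s) x)"
      unfolding Suc.IH by (rule vderiv_eqI[OF deriv])
    then show ?case by simp
  qed simp
  show "(vderiv ^^ n) (\<lambda>x. LINT s|M. \<Phi> s x) = (\<lambda>x. LINT s|M. (vderiv ^^ n) (\<Phi> s) x)"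
    by (rule eq)
  show "smooth (\<lambda>x. LINT s|M. \<Phi> s x)"
    unfolding smooth_def eq using deriv differentiableI_vector by blast
  show "integrable M (\<lambda>s. (vderiv ^^ n) (\<Phi> s) x)" by (rule int)
qed

section \<open>Integration against the Dunkl measure\<close>

definition dunkl_density :: "real \<Rightarrow> real \<Rightarrow> real" where
  "dunkl_density k x = \<bar>x\<bar> powr (2 * k + 1) / (2 powr (k + 1) * Gamma (k + 1))"

lemma dunkl_density_nonneg:
  assumes "k \<ge> - 1 / 2"
  shows "0 \<le> dunkl_density k x"
proof -
  have "Gamma (k + 1) > 0" using assms by (intro Gamma_real_pos) simp
  then show ?thesis by (simp add: dunkl_density_def)
qed

lemma borel_measurable_dunkl_density [measurable]: "dunkl_density k \<in> borel_measurable borel"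
  unfolding dunkl_density_def by measurable

lemma dunkl_measure_eq: "dunkl_measure k = density lborel (\<lambda>x. ennreal (dunkl_density k x))"
  by (simp add: dunkl_measure_def dunkl_density_def)

lemma sets_dunkl_measure [measurable_cong, simp]: "sets (dunkl_measure k) = sets borel"
  by (simp add: dunkl_measure_def)

lemma space_dunkl_measure [simp]: "space (dunkl_measure k) = UNIV"
  by (simp add: dunkl_measure_def)

lemma sigma_finite_dunkl_measure: "sigma_finite_measure (dunkl_measure k)"
  unfolding dunkl_measure_eq by (subst sigma_finite_measure.sigma_finite_iff_density_finite[OF sigma_finite_lborel]) auto

lemma integrable_dunkl_measure:
  fixes f :: "real \<Rightarrow> complex"
  assumes "k \<ge> - 1 / 2" "f \<in> borel_measurable borel"
  shows "integrable (dunkl_measure k) f \<longleftrightarrow> integrable lborel (\<lambda>x. dunkl_density k x *\<^sub>R f x)"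
  unfolding dunkl_measure_eq using assms
  by (intro integrable_density) (auto simp: dunkl_density_nonneg)

lemma integral_dunkl_measure:
  fixes f :: "real \<Rightarrow> complex"
  assumes "k \<ge> - 1 / 2" "f \<in> borel_measurable borel"
  shows "(LINT x|dunkl_measure k. f x) = (LINT x|lborel. dunkl_density k x *\<^sub>R f x)"
  unfolding dunkl_measure_eq using assms
  by (intro integral_density) (auto simp: dunkl_density_nonneg)

text \<open>The rounded exponent pays for the growth of the density, and the 2 leaves an integrable
  inverse square.\<close>

definition dunkl_decay :: "real \<Rightarrow> nat" where
  "dunkl_decay k = nat \<lceil>2 * k + 1\<rceil> + 2"

lemma integrable_dunkl_decay:
  assumes "k \<ge> - 1 / 2"
  shows "integrable (dunkl_measure k) (\<lambda>x. 1 / (1 + \<bar>x\<bar>) ^ dunkl_decay k)"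
proof -
  define P where "P = nat \<lceil>2 * k + 1\<rceil>"
  define c where "c = 1 / (2 powr (k + 1) * Gamma (k + 1))"
  have "Gamma (k + 1) > 0" using assms by (intro Gamma_real_pos) simp
  then have c: "c > 0" by (simp add: c_def)
  have "integrable lborel (\<lambda>x. c * inverse (1 + x\<^sup>2))"
    using integrable_inverse_1_plus_square by (simp add: set_integrable_def)
  then have "integrable lborel (\<lambda>x. dunkl_density k x *\<^sub>R (1 / (1 + \<bar>x\<bar>) ^ dunkl_decay k))"
  proof (rule Bochner_Integration.integrable_bound[OF _ _ AE_I2])
    fix x :: real
    have "\<bar>x\<bar> powr (2 * k + 1) \<le> (1 + \<bar>x\<bar>) powr (2 * k + 1)"
      using assms by (intro powr_mono2) auto
    also have "\<dots> \<le> (1 + \<bar>x\<bar>) powr (real P)"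
      unfolding P_def by (intro powr_mono real_nat_ceiling_ge) auto
    also have "\<dots> = (1 + \<bar>x\<bar>) ^ P"
      by (rule powr_realpow) simp
    finally have "dunkl_density k x \<le> c * (1 + \<bar>x\<bar>) ^ P"
      using c mult_left_mono[of "\<bar>x\<bar> powr (2 * k + 1)" "(1 + \<bar>x\<bar>) ^ P" c]
      by (simp add: dunkl_density_def c_def)
    then have "dunkl_density k x * (1 / (1 + \<bar>x\<bar>) ^ dunkl_decay k)
        \<le> c * (1 + \<bar>x\<bar>) ^ P * (1 / (1 + \<bar>x\<bar>) ^ dunkl_decay k)"
      by (intro mult_right_mono) auto
    also have "\<dots> = c * (1 / (1 + \<bar>x\<bar>)\<^sup>2)"
    proof -
      have "dunkl_decay k = P + 2" by (simp only: dunkl_decay_def P_def)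
      then show ?thesis by (simp add: power_add add_nonneg_eq_0_iff power2_eq_square)
    qed
    also have "\<dots> \<le> c * inverse (1 + x\<^sup>2)"
    proof (intro mult_left_mono)
      have "1 + x\<^sup>2 \<le> (1 + \<bar>x\<bar>)\<^sup>2" by (simp add: power2_sum)
      moreover have "1 + x\<^sup>2 > 0" by (simp add: add_pos_nonneg)
      ultimately show "1 / (1 + \<bar>x\<bar>)\<^sup>2 \<le> inverse (1 + x\<^sup>2)"
        by (simp add: divide_inverse le_imp_inverse_le)
    qed (use c in auto)
    finally show "norm (dunkl_density k x *\<^sub>R (1 / (1 + \<bar>x\<bar>) ^ dunkl_decay k)) \<le> norm (c * inverse (1 + x\<^sup>2))"
      using c dunkl_density_nonneg[OF assms, of x] by simp
  qed measurable
  then show ?thesis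
    unfolding dunkl_measure_eq using assms
    by (subst integrable_density) (auto simp: dunkl_density_nonneg)
qed

definition dunkl_const :: "real \<Rightarrow> real" where
  "dunkl_const k = (LINT x|dunkl_measure k. 1 / (1 + \<bar>x\<bar>) ^ dunkl_decay k)"

lemma dunkl_const_nonneg: "0 \<le> dunkl_const k"
  unfolding dunkl_const_def by (intro integral_nonneg_AE AE_I2) simp

lemma
  fixes f :: "real \<Rightarrow> complex"
  assumes k: "k \<ge> - 1 / 2" and f: "f \<in> borel_measurable borel"
    and bound: "\<And>x. (1 + \<bar>x\<bar>) ^ dunkl_decay k * norm (f x) \<le> C"
  shows integrable_dunkl_bound: "integrable (dunkl_measure k) f"
    and integral_dunkl_bound: "norm (LINT x|dunkl_measure k. f x) \<le> C * dunkl_const k"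
proof -
  have 1: "norm (f x) \<le> C * (1 / (1 + \<bar>x\<bar>) ^ dunkl_decay k)" for x
    using bound[of x] by (simp add: field_simps)
  have 2: "integrable (dunkl_measure k) (\<lambda>x. C * (1 / (1 + \<bar>x\<bar>) ^ dunkl_decay k))"
    by (intro integrable_mult_right integrable_dunkl_decay k)
  show i: "integrable (dunkl_measure k) f"
    using f by (intro integrable_dominated[OF 2 _ 1]) simp
  show "norm (LINT x|dunkl_measure k. f x) \<le> C * dunkl_const k"
    unfolding dunkl_const_def integral_mult_right_zero[symmetric]
    by (rule Bochner_Integration.integral_norm_bound_integral[OF i 2 1])
qed

section \<open>The Dunkl operator\<close>

lemma
  assumes "smooth g"
  shows vderiv_pow_scale: "(vderiv ^^ n) (\<lambda>x. c *\<^sub>R g (s * x)) = (\<lambda>x. (c * s ^ n) *\<^sub>R (vderiv ^^ n) g (s * x))"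
    and smooth_scale: "smooth (\<lambda>x. c *\<^sub>R g (s * x))"
proof -
  have deriv: "((\<lambda>x. (c * s ^ n) *\<^sub>R (vderiv ^^ n) g (s * x)) has_vector_derivative
      (c * s ^ Suc n) *\<^sub>R (vderiv ^^ Suc n) g (s * x)) (at x)" for n x
  proof -
    have "((\<lambda>x. s * x) has_vector_derivative s) (at x)"
      by (auto intro!: derivative_eq_intros)
    from vector_diff_chain_at[OF this smooth_has_vector_derivative[OF assms]]
    have "((\<lambda>x. (vderiv ^^ n) g (s * x)) has_vector_derivative s *\<^sub>R (vderiv ^^ Suc n) g (s * x)) (at x)"
      by (simp only: o_def)
    from bounded_linear.has_vector_derivative[OF bounded_linear_scaleR_right this, of "c * s ^ n"]
    show ?thesis by (simp add: mult_ac)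
  qed
  have eq: "(vderiv ^^ n) (\<lambda>x. c *\<^sub>R g (s * x)) = (\<lambda>x. (c * s ^ n) *\<^sub>R (vderiv ^^ n) g (s * x))" for n
  proof (induction n)
    case (Suc n)
    have "vderiv ((vderiv ^^ n) (\<lambda>x. c *\<^sub>R g (s * x))) = (\<lambda>x. (c * s ^ Suc n) *\<^sub>R (vderiv ^^ Suc n) g (s * x))"
      unfolding Suc.IH by (rule vderiv_eqI[OF deriv])
    then show ?case by simp
  qed simp
  show "(vderiv ^^ n) (\<lambda>x. c *\<^sub>R g (s * x)) = (\<lambda>x. (c * s ^ n) *\<^sub>R (vderiv ^^ n) g (s * x))"
    by (rule eq)
  show "smooth (\<lambda>x. c *\<^sub>R g (s * x))"
    unfolding smooth_def eq using deriv differentiableI_vector by blast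
qed

text \<open>\<open>dunkl_mean f x\<close> is \<open>(f x - f (- x)) / x\<close>, continued smoothly to \<open>x = 0\<close>.\<close>

definition dunkl_mean :: "(real \<Rightarrow> complex) \<Rightarrow> real \<Rightarrow> complex" where
  "dunkl_mean f x = (LINT s|lborel. indicator {-1..1} s *\<^sub>R vderiv f (s * x))"

text \<open>This is the Dunkl operator, with the difference quotient
  \<open>(f x - f (- x)) / x\<close> in the form that is meaningful at the origin.\<close>

definition dunkl_op :: "real \<Rightarrow> (real \<Rightarrow> complex) \<Rightarrow> real \<Rightarrow> complex" where
  "dunkl_op k f x = vderiv f x + of_real (k + 1 / 2) * dunkl_mean f x"

text \<open>Differentiating \<open>n\<close> times under the integral brings out
  \<open>s ^ n\<close>, of modulus at most 1 on \<open>{-1..1}\<close>; the factor 2 is the length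
  of this interval.\<close>

lemma
  assumes f: "f \<in> schwartz"
  shows smooth_dunkl_mean: "smooth (dunkl_mean f)"
    and norm_dunkl_mean: "norm ((vderiv ^^ n) (dunkl_mean f) x) \<le> 2 * schwartz_norm (Suc n) f"
proof -
  have g: "smooth (vderiv f)" using f by (intro smooth_vderiv schwartz_smooth)
  define \<Phi> where "\<Phi> = (\<lambda>s x. indicator {-1..1} s *\<^sub>R vderiv f (s * x) :: complex)"
  define G where "G = (\<lambda>n s. schwartz_norm (Suc n) f * indicator {-1..1::real} s)"
  have G: "integrable lborel (G n)" "(LINT s|lborel. G n s) = 2 * schwartz_norm (Suc n) f" for n
    unfolding G_def by auto
  have smooth: "smooth (\<Phi> s)" for s
    unfolding \<Phi>_def by (rule smooth_scale[OF g])
  have bound: "norm ((vderiv ^^ n) (\<Phi> s) y) \<le> G n s" for n s y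
  proof (cases "s \<in> {-1..1}")
    case True
    have "norm ((vderiv ^^ n) (\<Phi> s) y) = \<bar>s\<bar> ^ n * norm ((vderiv ^^ Suc n) f (s * y))"
      using True unfolding \<Phi>_def vderiv_pow_scale[OF g] vderiv_pow_Suc by (simp add: power_abs)
    also have "\<dots> \<le> 1 * norm ((vderiv ^^ Suc n) f (s * y))"
      using True by (intro mult_right_mono power_le_one) auto
    also have "\<dots> \<le> schwartz_norm (Suc n) f"
      using schwartz_norm_bound[OF f, of 0 "Suc n" "Suc n" "s * y"] by simp
    finally show ?thesis using True by (simp add: G_def)
  next
    case False
    then show ?thesis
      unfolding \<Phi>_def vderiv_pow_scale[OF g] by (simp add: G_def)
  qed
  have meas: "(\<lambda>s. \<Phi> s x) \<in> borel_measurable lborel" for x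
  proof -
    have "continuous_on UNIV (\<lambda>s. vderiv f (s * x))"
      by (intro continuous_on_compose2[OF smooth_continuous_on_0[OF g, of UNIV]] continuous_intros) auto
    then have [measurable]: "(\<lambda>s. vderiv f (s * x)) \<in> borel_measurable borel"
      by (rule borel_measurable_continuous_onI)
    show ?thesis unfolding \<Phi>_def by measurable
  qed
  have dom: "\<exists>H. integrable lborel H \<and> (\<forall>s\<in>space lborel. \<forall>y. \<bar>y\<bar> \<le> R \<longrightarrow>
      norm ((vderiv ^^ n) (\<Phi> s) y) \<le> H s)" for n R
    using G(1) bound by blast
  have mean: "dunkl_mean f = (\<lambda>x. LINT s|lborel. \<Phi> s x)"
    by (auto simp: dunkl_mean_def \<Phi>_def)
  note smooth_integral = smooth_integral[OF smooth meas dom]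
  show "smooth (dunkl_mean f)" unfolding mean by (rule smooth_integral(1))
  have "norm (LINT s|lborel. (vderiv ^^ n) (\<Phi> s) x) \<le> (LINT s|lborel. G n s)"
    by (rule Bochner_Integration.integral_norm_bound_integral[OF smooth_integral(3) G(1) bound])
  then show "norm ((vderiv ^^ n) (dunkl_mean f) x) \<le> 2 * schwartz_norm (Suc n) f"
    unfolding mean smooth_integral(2) G(2) .
qed

lemma dunkl_mean_eq:
  assumes f: "smooth f"
  shows "of_real x * dunkl_mean f x = f x - f (- x)"
proof -
  have "of_real x * dunkl_mean f x = (LINT s|lborel. indicator {-1..1} s *\<^sub>R (of_real x * vderiv f (s * x)))"
    unfolding dunkl_mean_def integral_mult_right_zero[symmetric]
    by (intro arg_cong[where f = "integral\<^sup>L lborel"]) (simp add: fun_eq_iff)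
  also have "\<dots> = f (1 * x) - f ((-1) * x)"
  proof (rule integral_FTC_Icc)
    show "((\<lambda>s. f (s * x)) has_vector_derivative of_real x * vderiv f (s * x)) (at s within {-1..1})" for s
    proof -
      have "((\<lambda>s. s * x) has_vector_derivative x) (at s)"
        by (auto intro!: derivative_eq_intros)
      from vector_diff_chain_at[OF this smooth_has_vector_derivative[OF f, of 0]]
      have "((\<lambda>s. f (s * x)) has_vector_derivative of_real x * vderiv f (s * x)) (at s)"
        by (simp add: o_def scaleR_conv_of_real)
      then show ?thesis by (rule has_vector_derivative_at_within)
    qed
    show "continuous_on {-1..1} (\<lambda>s. of_real x * vderiv f (s * x))"
      by (intro continuous_intros continuous_on_compose2[OF smooth_continuous_on_0[OF smooth_vderiv[OF f], of UNIV]]) auto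
  qed auto
  finally show ?thesis by simp
qed

text \<open>Near the origin the integral form is bounded and the weight is at most
  \<open>2 ^ l\<close>. Away from it the quotient form transfers the decay of
  \<open>f\<close>.\<close>

lemma rapid_dunkl_mean: "rapid schwartz schwartz_norm dunkl_mean"
proof (rule rapidI[OF weight_schwartz_norm], intro exI ballI allI)
  fix l and f :: "real \<Rightarrow> complex" and x :: real assume f: "f \<in> schwartz"
  show "(1 + \<bar>x\<bar>) ^ l * norm (dunkl_mean f x) \<le> 2 ^ Suc l * schwartz_norm (Suc l) f"
  proof (cases "\<bar>x\<bar> \<le> 1")
    case True
    have "norm (dunkl_mean f x) \<le> 2 * schwartz_norm (Suc 0) f"
      using norm_dunkl_mean[OF f, of 0 x] by simp
    also have "\<dots> \<le> 2 * schwartz_norm (Suc l) f"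
      by (intro mult_left_mono weight_mono[OF weight_schwartz_norm f]) auto
    finally have "(1 + \<bar>x\<bar>) ^ l * norm (dunkl_mean f x) \<le> 2 ^ l * (2 * schwartz_norm (Suc l) f)"
      using True by (intro mult_mono power_mono) auto
    then show ?thesis by simp
  next
    case False
    have "norm (dunkl_mean f x) \<le> \<bar>x\<bar> * norm (dunkl_mean f x)"
      using mult_right_mono[of 1 "\<bar>x\<bar>" "norm (dunkl_mean f x)"] False by simp
    also have "\<dots> = norm (f x - f (- x))"
      using dunkl_mean_eq[OF schwartz_smooth[OF f], of x] by (metis norm_mult norm_of_real)
    also have "\<dots> \<le> norm (f x) + norm (f (- x))" by (rule norm_triangle_ineq4)
    finally have "(1 + \<bar>x\<bar>) ^ l * norm (dunkl_mean f x) \<le> (1 + \<bar>x\<bar>) ^ l * (norm (f x) + norm (f (- x)))"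
      by (intro mult_left_mono) auto
    also have "\<dots> \<le> 2 ^ l * schwartz_norm (Suc l) f + 2 ^ l * schwartz_norm (Suc l) f"
      using schwartz_norm_bound[OF f, of l "Suc l" 0 x] schwartz_norm_bound[OF f, of l "Suc l" 0 "- x"]
      unfolding distrib_left by (intro add_mono) simp_all
    finally show ?thesis by (simp add: mult_ac)
  qed
qed

lemma schwartz_operator_dunkl_op: "schwartz_operator (dunkl_op k)"
proof (rule schwartz_operatorI)
  have mean: "\<forall>n. tame schwartz schwartz_norm n dunkl_mean"
    unfolding tame_iff
  proof (intro conjI ballI allI)
    show "poly_bounded schwartz schwartz_norm (\<lambda>f. (vderiv ^^ n) (dunkl_mean f))" for n
      by (rule poly_boundedI[OF weight_schwartz_norm, where L = 0 and C = 2 and M = "Suc n"])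
        (simp add: norm_dunkl_mean del: funpow.simps)
  qed (rule smooth_dunkl_mean)
  have deriv: "tame schwartz schwartz_norm n vderiv" for n
    using schwartz_tame[of "Suc n"] by simp
  have op: "dunkl_op k = (\<lambda>f x. vderiv f x + of_real (k + 1 / 2) * dunkl_mean f x)"
    by (simp add: fun_eq_iff dunkl_op_def)
  show "\<forall>n. tame schwartz schwartz_norm n (dunkl_op k)"
    unfolding op using deriv mean
    by (intro allI tame_add[OF weight_schwartz_norm] tame_cmult[OF weight_schwartz_norm]) auto
  have "rapid schwartz schwartz_norm vderiv"
    using rapid_vderiv[OF weight_schwartz_norm schwartz_tame schwartz_rapid] .
  then show "rapid schwartz schwartz_norm (dunkl_op k)"
    unfolding op
    by (intro rapid_add[OF weight_schwartz_norm] rapid_mult_bounded[OF weight_schwartz_norm rapid_dunkl_mean])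
      auto
qed

lemma
  assumes k: "k \<ge> - 1 / 2" and f: "f \<in> schwartz"
    and \<phi>: "\<phi> \<in> borel_measurable borel" "\<And>x. norm (\<phi> x) \<le> 1"
  shows integrable_dunkl_schwartz: "integrable (dunkl_measure k) (\<lambda>x. f x * \<phi> x)"
    and integral_dunkl_schwartz: "norm (LINT x|dunkl_measure k. f x * \<phi> x)
      \<le> (2 ^ dunkl_decay k * dunkl_const k) * schwartz_norm (dunkl_decay k) f"
proof -
  have "f \<in> borel_measurable borel"
    using f by (intro borel_measurable_continuous_onI smooth_continuous_on_0 schwartz_smooth)
  then have meas: "(\<lambda>x. f x * \<phi> x) \<in> borel_measurable borel"
    using \<phi>(1) by measurable
  have "(1 + \<bar>x\<bar>) ^ dunkl_decay k * norm (f x * \<phi> x)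
      \<le> 2 ^ dunkl_decay k * schwartz_norm (dunkl_decay k) f" for x
  proof -
    have "(1 + \<bar>x\<bar>) ^ dunkl_decay k * norm (f x * \<phi> x) \<le> (1 + \<bar>x\<bar>) ^ dunkl_decay k * (norm (f x) * 1)"
      unfolding norm_mult by (intro mult_left_mono \<phi>(2)) auto
    also have "\<dots> \<le> 2 ^ dunkl_decay k * schwartz_norm (dunkl_decay k) f"
      using schwartz_norm_bound[OF f, of "dunkl_decay k" "dunkl_decay k" 0 x] by simp
    finally show ?thesis .
  qed
  note bound = integrable_dunkl_bound[OF k meas this] integral_dunkl_bound[OF k meas this]
  show "integrable (dunkl_measure k) (\<lambda>x. f x * \<phi> x)" by (rule bound(1))
  show "norm (LINT x|dunkl_measure k. f x * \<phi> x)
      \<le> (2 ^ dunkl_decay k * dunkl_const k) * schwartz_norm (dunkl_decay k) f"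
    using bound(2) by (simp add: mult_ac)
qed

section \<open>Antisymmetry of the Dunkl operator and decay of the transform\<close>

lemma borel_measurable_dunkl_kernel:
  assumes "k \<ge> - 1 / 2"
  shows "dunkl_kernel k \<eta> \<in> borel_measurable borel"
  using assms by (intro borel_measurable_continuous_onI continuous_intros)

text \<open>Folding onto the positive half-line pairs each point with its reflection, and there the
  density is a differentiable power even if it is singular or kinked at 0.\<close>

lemma integral_symmetrize:
  fixes g :: "real \<Rightarrow> complex"
  assumes g: "integrable lborel g"
  shows "set_integrable lborel {0<..} (\<lambda>x. g x + g (- x))"
    and "(LINT x|lborel. g x) = (LINT x:{0<..}|lborel. g x + g (- x))"
proof -
  have [measurable]: "g \<in> borel_measurable borel" using borel_measurable_integrable[OF g] by simp
  have pos: "integrable lborel (\<lambda>x. indicator {0<..} x *\<^sub>R g x)"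
    using g by (intro integrable_mult_indicator) auto
  have neg: "integrable lborel (\<lambda>x. indicator {..<0} x *\<^sub>R g x)"
    using g by (intro integrable_mult_indicator) auto
  have ind: "indicator {..<0} (0 + (- 1) * x) *\<^sub>R g (0 + (- 1) * x) = indicator {0<..} x *\<^sub>R g (- x)" for x :: real
    by (simp add: indicator_def)
  have neg': "integrable lborel (\<lambda>x. indicator {0<..} x *\<^sub>R g (- x))"
    using lborel_integrable_real_affine[OF neg, of "- 1" 0] unfolding ind by simp
  show "set_integrable lborel {0<..} (\<lambda>x. g x + g (- x))"
    unfolding set_integrable_def scaleR_add_right
    by (rule Bochner_Integration.integrable_add[OF pos neg'])
  have "(LINT x|lborel. g x) = (LINT x|lborel. indicator {0<..} x *\<^sub>R g x + indicator {..<0} x *\<^sub>R g x)"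
  proof (rule integral_cong_AE)
    show "AE x in lborel. g x = indicator {0<..} x *\<^sub>R g x + indicator {..<0} x *\<^sub>R g x"
      using AE_lborel_singleton[of 0] by eventually_elim (auto simp: indicator_def)
  qed measurable
  also have "\<dots> = (LINT x|lborel. indicator {0<..} x *\<^sub>R g x) + (LINT x|lborel. indicator {..<0} x *\<^sub>R g x)"
    by (rule Bochner_Integration.integral_add[OF pos neg])
  also have "(LINT x|lborel. indicator {..<0} x *\<^sub>R g x) = (LINT x|lborel. indicator {0<..} x *\<^sub>R g (- x))"
    using lborel_integral_real_affine[of "- 1" "\<lambda>x. indicator {..<0} x *\<^sub>R g x" 0] unfolding ind by simp
  also have "(LINT x|lborel. indicator {0<..} x *\<^sub>R g x) + \<dots> = (LINT x:{0<..}|lborel. g x + g (- x))"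
    unfolding set_lebesgue_integral_def scaleR_add_right
    by (rule Bochner_Integration.integral_add[OF pos neg', symmetric])
  finally show "(LINT x|lborel. g x) = (LINT x:{0<..}|lborel. g x + g (- x))" .
qed

text \<open>Adding the integrand at \<open>x\<close> and at \<open>- x\<close> gives the derivative on the half-line of
  \<open>x\<^sup>2\<^sup>k\<^sup>+\<^sup>1 (f x \<phi> x - f (- x) \<phi> (- x))\<close>, where \<open>\<phi>\<close> is the Dunkl kernel.\<close>

lemma dunkl_op_integral:
  assumes k: "k \<ge> - 1 / 2" and f: "f \<in> schwartz"
  shows "(LINT x|dunkl_measure k. dunkl_op k f x * dunkl_kernel k \<eta> x)
    = - (\<i> * of_real \<eta>) * (LINT x|dunkl_measure k. f x * dunkl_kernel k \<eta> x)"
proof -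
  define \<phi> where "\<phi> = dunkl_kernel k \<eta>"
  define \<alpha> where "\<alpha> = 2 * k + 1"
  define c where "c = 1 / (2 powr (k + 1) * Gamma (k + 1))"
  have \<alpha>: "\<alpha> \<ge> 0" using k by (simp add: \<alpha>_def)
  have smooth_f: "smooth f" using f by (rule schwartz_smooth)
  obtain \<phi>' where \<phi>': "\<And>x. (\<phi> has_vector_derivative \<phi>' x) (at x)"
    "\<And>x. of_real x * \<phi>' x + of_real (k + 1 / 2) * (\<phi> x - \<phi> (- x)) = of_real x * (\<i> * of_real \<eta> * \<phi> x)"
    using dunkl_kernel_derivative[OF k, of \<eta>] unfolding \<phi>_def by blast
  have f': "(f has_vector_derivative vderiv f x) (at x)" for x
    using smooth_has_vector_derivative[OF smooth_f, of 0] by simp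
  have neg: "((\<lambda>x. g (- x)) has_vector_derivative - g' (- x)) (at x)"
    if "\<And>x. (g has_vector_derivative g' x) (at x)" for g g' :: "real \<Rightarrow> complex" and x
  proof -
    have "(uminus has_vector_derivative - 1) (at x :: real filter)"
      by (auto intro!: derivative_eq_intros)
    from vector_diff_chain_at[OF this that] show ?thesis by (simp add: o_def)
  qed
  \<comment> \<open>The claim says that the integral of \<open>S\<close> vanishes.\<close>
  define S where "S = (\<lambda>x. dunkl_op k f x * \<phi> x + f x * (\<i> * of_real \<eta> * \<phi> x))"
  define v where "v = (\<lambda>x. f x * \<phi> x - f (- x) * \<phi> (- x))"
  define v' where "v' = (\<lambda>x. (f x * \<phi>' x + vderiv f x * \<phi> x) -
      (f (- x) * - \<phi>' (- x) + - vderiv f (- x) * \<phi> (- x)))"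
  have v': "(v has_vector_derivative v' x) (at x)" for x
    unfolding v_def v'_def
    by (intro has_vector_derivative_diff has_vector_derivative_mult f' \<phi>' neg)
  \<comment> \<open>The factor \<open>x\<close> clears the difference quotients. The mixed terms
    \<open>f (- x) * \<phi> x\<close> and \<open>f x * \<phi> (- x)\<close> are symmetric and
    cancel; the remaining ones add up to \<open>\<alpha> * v x\<close>, which is what
    differentiating the power in \<open>F\<close> yields.\<close>
  have S_eq: "of_real x * (S x + S (- x)) = of_real x * v' x + of_real \<alpha> * v x" for x
  proof -
    have xS: "of_real x * S x = of_real x * vderiv f x * \<phi> x + of_real (k + 1 / 2) * (f x - f (- x)) * \<phi> x
        + f x * (of_real x * \<phi>' x + of_real (k + 1 / 2) * (\<phi> x - \<phi> (- x)))" for x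
      unfolding \<phi>'(2) dunkl_mean_eq[OF smooth_f, symmetric] S_def dunkl_op_def
      by (simp only: algebra_simps)
    have "of_real x * (S x + S (- x)) = of_real x * S x - of_real (- x) * S (- x)"
      by (simp add: algebra_simps)
    also have "\<dots> = of_real x * v' x + of_real \<alpha> * v x"
    proof -
      define \<kappa> where "\<kappa> = complex_of_real (k + 1 / 2)"
      have \<kappa>: "complex_of_real \<alpha> = 2 * \<kappa>" by (simp add: \<alpha>_def \<kappa>_def)
      show ?thesis
        unfolding xS v_def v'_def \<kappa> \<kappa>_def[symmetric] by (simp add: algebra_simps)
    qed
    finally show ?thesis .
  qed
  have \<phi>_meas: "\<phi> \<in> borel_measurable borel" and \<phi>_bound: "norm (\<phi> x) \<le> 1" for x
    unfolding \<phi>_def using k by (auto intro: borel_measurable_dunkl_kernel norm_dunkl_kernel_le_1)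
  have Tf: "dunkl_op k f \<in> schwartz"
    by (rule schwartz_operator_in[OF schwartz_operator_dunkl_op f])
  have int: "integrable (dunkl_measure k) (\<lambda>x. dunkl_op k f x * \<phi> x)"
    "integrable (dunkl_measure k) (\<lambda>x. f x * \<phi> x)"
    using integrable_dunkl_schwartz[OF k Tf \<phi>_meas \<phi>_bound] integrable_dunkl_schwartz[OF k f \<phi>_meas \<phi>_bound] by auto
  have int2: "integrable (dunkl_measure k) (\<lambda>x. f x * (\<i> * of_real \<eta> * \<phi> x))"
    using integrable_mult_right[OF int(2), of "\<i> * of_real \<eta>"] by (simp add: mult_ac)
  have intS: "integrable (dunkl_measure k) S"
    unfolding S_def by (rule Bochner_Integration.integrable_add[OF int(1) int2])
  have contS: "continuous_on UNIV S"
    unfolding S_def \<phi>_def using k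
    by (intro continuous_intros smooth_continuous_on_0 schwartz_smooth Tf f)
  then have S_meas: "S \<in> borel_measurable borel"
    by (rule borel_measurable_continuous_onI)
  define g where "g = (\<lambda>x. dunkl_density k x *\<^sub>R S x)"
  have int_g: "integrable lborel g"
    using intS unfolding g_def integrable_dunkl_measure[OF k S_meas] .
  have g_even: "g x + g (- x) = (c * x powr \<alpha>) *\<^sub>R (S x + S (- x))" if "x > 0" for x
    using that by (simp add: g_def dunkl_density_def c_def \<alpha>_def scaleR_add_right)
  define F where "F = (\<lambda>x. (c * x powr \<alpha>) *\<^sub>R v x)"
  have F': "(F has_vector_derivative g x + g (- x)) (at x)" if x: "x > 0" for x
  proof -
    have "((\<lambda>x. c * x powr \<alpha>) has_real_derivative c * (\<alpha> * x powr (\<alpha> - 1))) (at x)"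
      using x by (intro DERIV_cmult has_real_derivative_powr)
    from has_vector_derivative_scaleR[OF this v']
    have "(F has_vector_derivative (c * x powr \<alpha>) *\<^sub>R v' x + (c * (\<alpha> * x powr (\<alpha> - 1))) *\<^sub>R v x) (at x)"
      unfolding F_def .
    also have "(c * x powr \<alpha>) *\<^sub>R v' x + (c * (\<alpha> * x powr (\<alpha> - 1))) *\<^sub>R v x
        = (c * x powr (\<alpha> - 1)) *\<^sub>R (of_real x * v' x + of_real \<alpha> * v x)"
      using x by (simp add: powr_diff scaleR_conv_of_real algebra_simps)
    also have "\<dots> = g x + g (- x)"
      unfolding S_eq[symmetric] g_even[OF x] using x by (simp add: powr_diff scaleR_conv_of_real)
    finally show ?thesis .
  qed
  have "(LBINT x=0..\<infinity>. g x + g (- x)) = 0 - 0"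
  proof (rule interval_integral_FTC_integrable[where F = F])
    show "(F has_vector_derivative g x + g (- x)) (at x)" if "0 < ereal x" for x
      using that by (intro F') simp
    show "isCont (\<lambda>x. g x + g (- x)) x" if "0 < ereal x" for x
    proof -
      have "isCont (\<lambda>x. (c * x powr \<alpha>) *\<^sub>R (S x + S (- x))) x"
      proof -
        have "isCont S x" "isCont (\<lambda>x. S (- x)) x"
          using contS by (auto simp: continuous_on_eq_continuous_at intro: isCont_o2[where g = S])
        moreover have "isCont (\<lambda>x. x powr \<alpha>) x"
          using that by (intro DERIV_isCont[OF has_real_derivative_powr]) simp
        ultimately show ?thesis using that by (intro continuous_intros) auto
      qed
      moreover have "eventually (\<lambda>y. (c * y powr \<alpha>) *\<^sub>R (S y + S (- y)) = g y + g (- y)) (nhds x)"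
        using that g_even by (intro eventually_nhds[THEN iffD2] exI[of _ "{0<..}"]) auto
      ultimately show ?thesis
        by (simp add: isCont_cong)
    qed
    show "set_integrable lborel (einterval 0 \<infinity>) (\<lambda>x. g x + g (- x))"
      using integral_symmetrize(1)[OF int_g] by (simp add: zero_ereal_def einterval_eq)
    \<comment> \<open>The boundary term at the origin vanishes because \<open>v 0 = 0\<close>; the
      power alone would not do it for \<open>k = - 1 / 2\<close>, where
      \<open>\<alpha> = 0\<close>.\<close>
    show "((F \<circ> real_of_ereal) \<longlongrightarrow> 0) (at_right 0)"
      unfolding zero_ereal_def ereal_tendsto_simps
    proof (rule Lim_null_comparison)
      have "v 0 = 0" by (simp add: v_def)
      moreover have "isCont v 0" using v' has_vector_derivative_continuous by blast
      ultimately have "(v \<longlongrightarrow> 0) (at_right 0)"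
        by (auto simp: isCont_def intro: tendsto_within_subset)
      then show "((\<lambda>x. \<bar>c\<bar> * norm (v x)) \<longlongrightarrow> 0) (at_right 0)"
        by (auto intro!: tendsto_eq_intros)
      have "norm (F x) \<le> \<bar>c\<bar> * norm (v x)" if "0 < x" "x < 1" for x
      proof -
        have "x powr \<alpha> \<le> 1" using that \<alpha> by (intro powr_le1) auto
        then have "\<bar>c\<bar> * x powr \<alpha> * norm (v x) \<le> \<bar>c\<bar> * 1 * norm (v x)"
          by (intro mult_right_mono mult_left_mono) auto
        then show ?thesis by (simp add: F_def abs_mult)
      qed
      then show "\<forall>\<^sub>F x in at_right 0. norm (F x) \<le> \<bar>c\<bar> * norm (v x)"
        by (auto simp: eventually_at_right_field intro: exI[of _ 1])
    qed
    show "((F \<circ> real_of_ereal) \<longlongrightarrow> 0) (at_left \<infinity>)"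
      unfolding ereal_tendsto_simps
    proof (rule Lim_null_comparison)
      define P where "P = nat \<lceil>\<alpha>\<rceil>"
      \<comment> \<open>Of the \<open>Suc P\<close> powers of decay, \<open>P\<close> absorb
        \<open>x powr \<alpha>\<close> and one is left over to give \<open>1 / x\<close>.\<close>
      define K where "K = 2 * 2 ^ Suc P * schwartz_norm (Suc P) f"
      show "((\<lambda>x. \<bar>c\<bar> * K / x) \<longlongrightarrow> 0) at_top"
        by (auto intro!: tendsto_divide_0[OF tendsto_const] filterlim_at_top_imp_at_infinity filterlim_ident)
      have "norm (F x) \<le> \<bar>c\<bar> * K / x" if x: "x > 1" for x
      proof -
        have v: "norm (v x) \<le> norm (f x) + norm (f (- x))"
          using norm_triangle_ineq4[of "f x * \<phi> x" "f (- x) * \<phi> (- x)"]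
            mult_left_mono[OF \<phi>_bound[of x], of "norm (f x)"] mult_left_mono[OF \<phi>_bound[of "- x"], of "norm (f (- x))"]
          by (simp add: v_def norm_mult)
        have "x powr \<alpha> \<le> x powr real P"
          using x unfolding P_def by (intro powr_mono real_nat_ceiling_ge) auto
        then have "x * x powr \<alpha> \<le> x ^ Suc P"
          using x by (simp add: powr_realpow)
        also have "\<dots> \<le> (1 + \<bar>x\<bar>) ^ Suc P" using x by (intro power_mono) auto
        finally have "x * x powr \<alpha> * norm (v x) \<le> (1 + \<bar>x\<bar>) ^ Suc P * (norm (f x) + norm (f (- x)))"
          using v by (intro mult_mono) auto
        also have "\<dots> \<le> K"
          using schwartz_norm_bound[OF f, of "Suc P" "Suc P" 0 x] schwartz_norm_bound[OF f, of "Suc P" "Suc P" 0 "- x"]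
          unfolding distrib_left K_def by simp
        finally have "\<bar>c\<bar> * (x * x powr \<alpha> * norm (v x)) \<le> \<bar>c\<bar> * K"
          by (intro mult_left_mono) auto
        then have "x * norm (F x) \<le> \<bar>c\<bar> * K"
          by (simp add: F_def abs_mult mult_ac)
        then show ?thesis using x by (simp add: pos_le_divide_eq mult.commute)
      qed
      then show "\<forall>\<^sub>F x in at_top. norm (F x) \<le> \<bar>c\<bar> * K / x"
        using eventually_gt_at_top[of 1] by (rule eventually_mono[rotated])
    qed
  qed auto
  then have "(LINT x|lborel. g x) = 0"
    unfolding integral_symmetrize(2)[OF int_g] by (simp add: interval_lebesgue_integral_0_infty)
  then have "(LINT x|dunkl_measure k. S x) = 0"
    unfolding integral_dunkl_measure[OF k S_meas] g_def .
  moreover have "(LINT x|dunkl_measure k. S x) = (LINT x|dunkl_measure k. dunkl_op k f x * \<phi> x)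
      + (LINT x|dunkl_measure k. f x * (\<i> * of_real \<eta> * \<phi> x))"
    unfolding S_def by (rule Bochner_Integration.integral_add[OF int(1) int2])
  moreover have "(LINT x|dunkl_measure k. f x * (\<i> * of_real \<eta> * \<phi> x))
      = \<i> * of_real \<eta> * (LINT x|dunkl_measure k. f x * \<phi> x)"
    unfolding integral_mult_right_zero[symmetric] by (simp add: mult_ac)
  ultimately show ?thesis
    unfolding \<phi>_def[symmetric] by (simp add: eq_neg_iff_add_eq_0)
qed

text \<open>Each application of the Dunkl operator multiplies the transform by
  \<open>- \<i> * \<eta>\<close>, so \<open>l\<close> of them produce the power of
  \<open>\<eta>\<close>. The iterated operator is continuous on the Schwartz space, which keeps the
  bound in terms of one norm of \<open>f\<close>.\<close>

lemma dunkl_transform_decay: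
  assumes k: "k \<ge> - 1 / 2"
  shows "\<exists>K. \<forall>f\<in>schwartz. \<forall>\<eta>.
    (1 + \<bar>\<eta>\<bar>) ^ l * norm (LINT x|dunkl_measure k. f x * dunkl_kernel k \<eta> x) \<le> real K * schwartz_norm K f"
proof -
  define I where "I = (\<lambda>f \<eta>. LINT x|dunkl_measure k. f x * dunkl_kernel k \<eta> x)"
  define L where "L = dunkl_decay k"
  define C where "C = 2 ^ L * dunkl_const k"
  have C: "0 \<le> C" by (simp add: C_def dunkl_const_nonneg)
  have T: "schwartz_operator (dunkl_op k ^^ l)" for l
  proof (induction l)
    case 0
    then show ?case using schwartz_operator_id by (simp add: id_def)
  next
    case (Suc l)
    then show ?case using schwartz_operator_compose[OF schwartz_operator_dunkl_op Suc.IH] by (simp add: o_def)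
  qed
  have I_bound: "norm (I f \<eta>) \<le> C * schwartz_norm L f" if "f \<in> schwartz" for f \<eta>
    unfolding I_def C_def L_def
    by (rule integral_dunkl_schwartz[OF k that borel_measurable_dunkl_kernel[OF k] norm_dunkl_kernel_le_1[OF k]])
  have I_pow: "I ((dunkl_op k ^^ l) f) \<eta> = (- (\<i> * of_real \<eta>)) ^ l * I f \<eta>" if f: "f \<in> schwartz" for f \<eta>
  proof (induction l)
    case (Suc l)
    show ?case
      using dunkl_op_integral[OF k schwartz_operator_in[OF T f], of l \<eta>] Suc.IH by (simp add: I_def)
  qed simp
  obtain K where K: "\<And>f. f \<in> schwartz \<Longrightarrow> schwartz_norm L ((dunkl_op k ^^ l) f) \<le> real K * schwartz_norm K f"
    using T unfolding schwartz_operator_def by blast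
  define Q where "Q = nat \<lceil>2 ^ l * (C + C * real K)\<rceil> + L + K"
  show ?thesis
  proof (intro exI ballI allI)
    fix f :: "real \<Rightarrow> complex" and \<eta> :: real assume f: "f \<in> schwartz"
    have "\<bar>\<eta>\<bar> ^ l * norm (I f \<eta>) = norm (I ((dunkl_op k ^^ l) f) \<eta>)"
      unfolding I_pow[OF f] by (simp add: norm_mult norm_power)
    also have "\<dots> \<le> C * schwartz_norm L ((dunkl_op k ^^ l) f)"
      by (rule I_bound[OF schwartz_operator_in[OF T f]])
    also have "\<dots> \<le> C * (real K * schwartz_norm K f)"
      by (intro mult_left_mono K f C)
    finally have 1: "\<bar>\<eta>\<bar> ^ l * norm (I f \<eta>) \<le> C * (real K * schwartz_norm K f)" .
    have "(1 + \<bar>\<eta>\<bar>) ^ l \<le> (2 * max 1 \<bar>\<eta>\<bar>) ^ l" by (intro power_mono) auto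
    also have "\<dots> \<le> 2 ^ l * (1 + \<bar>\<eta>\<bar> ^ l)" by (auto simp: power_mult_distrib max_def)
    finally have "(1 + \<bar>\<eta>\<bar>) ^ l * norm (I f \<eta>) \<le> 2 ^ l * (1 + \<bar>\<eta>\<bar> ^ l) * norm (I f \<eta>)"
      by (rule mult_right_mono) simp
    also have "\<dots> = 2 ^ l * (norm (I f \<eta>) + \<bar>\<eta>\<bar> ^ l * norm (I f \<eta>))"
      by (simp add: algebra_simps)
    also have "\<dots> \<le> 2 ^ l * (C * schwartz_norm L f + C * (real K * schwartz_norm K f))"
      by (intro mult_left_mono add_mono I_bound f 1) auto
    also have "\<dots> \<le> 2 ^ l * (C * schwartz_norm (L + K) f + C * (real K * schwartz_norm (L + K) f))"
      using C by (intro mult_left_mono add_mono weight_mono[OF weight_schwartz_norm f]) auto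
    also have "\<dots> = (2 ^ l * (C + C * real K)) * schwartz_norm (L + K) f"
      by (simp add: algebra_simps)
    also have "\<dots> \<le> real Q * schwartz_norm Q f"
    proof (rule weight_bound[OF weight_schwartz_norm f])
      show "2 ^ l * (C + C * real K) \<le> real Q" unfolding Q_def by linarith
    qed (simp add: Q_def)
    finally show "(1 + \<bar>\<eta>\<bar>) ^ l * norm (LINT x|dunkl_measure k. f x * dunkl_kernel k \<eta> x) \<le> real Q * schwartz_norm Q f"
      by (simp add: I_def)
  qed
qed

section \<open>Oscillatory integral operators on the Schwartz space\<close>

text \<open>The index \<open>N\<close> is deliberately ignored: the order of growth is frozen at
  \<open>M\<close>, whatever the number of derivatives.\<close>

definition power_weight :: "nat \<Rightarrow> nat \<Rightarrow> real \<Rightarrow> real" where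
  "power_weight M N \<xi> = (1 + \<bar>\<xi>\<bar>) ^ M"

lemma weight_power_weight: "weight I (power_weight M)"
  by (auto simp: weight_def power_weight_def intro: monoI)

text \<open>In the second variable the growth has to be of a fixed order, uniformly in all derivatives with
  respect to the first variable: the decay lemma for the Dunkl transform costs derivatives, and these
  must not cost further powers of the second variable.\<close>

definition amplitude :: "(real \<Rightarrow> real \<Rightarrow> complex) \<Rightarrow> bool" where
  "amplitude s \<longleftrightarrow> continuous_on UNIV (\<lambda>(x, \<xi>). s x \<xi>) \<and>
     (\<forall>n. tame UNIV poly_weight n s) \<and>
     (\<exists>M. \<forall>n. tame UNIV (power_weight M) n (\<lambda>\<xi> x. s x \<xi>))"

lemma amplitude_mult:
  assumes "amplitude s" "amplitude t"
  shows "amplitude (\<lambda>x \<xi>. s x \<xi> * t x \<xi>)"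
  unfolding amplitude_def
proof (intro conjI allI)
  show "continuous_on UNIV (\<lambda>(x, \<xi>). s x \<xi> * t x \<xi>)"
    using assms by (auto simp: amplitude_def split_def intro: continuous_on_mult)
  show "tame UNIV poly_weight n (\<lambda>x \<xi>. s x \<xi> * t x \<xi>)" for n
    using assms by (intro tame_mult_poly_weight) (auto simp: amplitude_def)
  obtain M M' where M: "\<And>n. tame UNIV (power_weight M) n (\<lambda>\<xi> x. s x \<xi>)"
    "\<And>n. tame UNIV (power_weight M') n (\<lambda>\<xi> x. t x \<xi>)"
    using assms unfolding amplitude_def by blast
  show "\<exists>M. \<forall>n. tame UNIV (power_weight M) n (\<lambda>\<xi> x. s x \<xi> * t x \<xi>)"
  proof (intro exI allI)
    show "tame UNIV (power_weight (M + M')) n (\<lambda>\<xi> x. s x \<xi> * t x \<xi>)" for n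
      by (rule tame_mult[OF weight_power_weight weight_power_weight weight_power_weight _ M])
        (simp add: power_weight_def power_add)
  qed
qed

lemma amplitude_const: "amplitude (\<lambda>x \<xi>. c)"
  unfolding amplitude_def
proof (intro conjI allI exI)
  show "tame UNIV poly_weight n (\<lambda>x \<xi>. c)" for n
    by (rule tame_const[OF weight_poly_weight, where C = "norm c" and M = 0]) (simp add: poly_weight_def)
  show "tame UNIV (power_weight 0) n (\<lambda>\<xi> x. c)" for n
    by (rule tame_const[OF weight_power_weight, where C = "norm c"]) (simp add: power_weight_def)
qed simp

section \<open>Chirps as amplitudes\<close>

definition chirp :: "real \<Rightarrow> real \<Rightarrow> complex" where
  "chirp a x = exp (\<i> / 2 * of_real (a * x\<^sup>2))"

lemma norm_chirp [simp]: "norm (chirp a x) = 1"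
  by (simp add: chirp_def norm_exp_eq_Re)

lemma continuous_on_chirp [continuous_intros]:
  "continuous_on S f \<Longrightarrow> continuous_on S (\<lambda>x. chirp a (f x))"
  unfolding chirp_def by (intro continuous_intros)

text \<open>A derivative costs one factor \<open>x\<close> and nothing in the parameter, so the
  estimate is proved for the weight 1 and then transferred to any weight above it.\<close>

lemma tame_chirp:
  assumes W: "weight I W" and "\<And>p N. p \<in> I \<Longrightarrow> 1 \<le> W N p"
  shows "tame I W n (\<lambda>p. chirp a)"
proof -
  define U :: "nat \<Rightarrow> 'a \<Rightarrow> real" where "U = (\<lambda>_ _. 1)"
  have U: "weight I U" by (auto simp: weight_def U_def intro: monoI)
  have const: "tame I U n (\<lambda>p x. c)" for c n
    by (rule tame_const[OF U, where C = "norm c"]) (simp add: U_def)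
  have pb_ident: "poly_bounded I U (\<lambda>p x. complex_of_real x)"
    by (rule poly_boundedI[OF U, where C = 1 and L = 1]) (simp add: U_def)
  have ident: "tame I U n (\<lambda>p x. of_real x)" for n
  proof (cases n)
    case (Suc m)
    show ?thesis
      unfolding Suc
    proof (rule tame_SucI)
      show "((\<lambda>x. of_real x) has_vector_derivative (1 :: complex)) (at x)" for x
        by (auto intro!: derivative_eq_intros)
      show "poly_bounded I U (\<lambda>p x. complex_of_real x)"
        by (rule pb_ident)
    qed (rule const)
  qed (simp add: pb_ident)
  have pb: "poly_bounded I U (\<lambda>p. chirp a)"
    by (rule poly_boundedI[OF U, where C = 1 and L = 0]) (simp add: U_def)
  have "tame I U n (\<lambda>p. chirp a)"
  proof (induction n)
    case (Suc n)
    show ?case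
    proof (rule tame_SucI[OF pb])
      show "(chirp a has_vector_derivative \<i> * of_real a * (of_real x * chirp a x)) (at x)" for x
      proof -
        have "((\<lambda>z. exp (\<i> / 2 * (of_real a * z\<^sup>2))) has_field_derivative
            \<i> * of_real a * (of_real x * chirp a x)) (at (of_real x))"
          by (auto intro!: derivative_eq_intros simp: chirp_def)
        from has_vector_derivative_real_field[OF this]
        show ?thesis by (simp add: chirp_def[abs_def])
      qed
      show "tame I U n (\<lambda>p x. \<i> * of_real a * (of_real x * chirp a x))"
        by (intro tame_cmult[OF U] tame_mult[OF U U U _ ident Suc.IH]) (simp add: U_def)
    qed
  qed (simp add: pb)
  then show ?thesis
    by (rule tame_reindex[OF W, where \<pi> = "\<lambda>p. p"]) (use assms(2) in \<open>auto simp: U_def\<close>)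
qed

lemma
  shows amplitude_chirp_fst: "amplitude (\<lambda>x \<xi>. chirp a x)"
    and amplitude_chirp_snd: "amplitude (\<lambda>x \<xi>. chirp a \<xi>)"
proof -
  have 1: "tame UNIV poly_weight n (\<lambda>x \<xi>. chirp a x)"
    "tame UNIV (power_weight 0) n (\<lambda>\<xi> x. chirp a \<xi>)" for n
    by (rule tame_const[OF weight_poly_weight, where C = 1 and M = 0], simp add: poly_weight_def)
      (rule tame_const[OF weight_power_weight, where C = 1], simp add: power_weight_def)
  have 2: "tame UNIV poly_weight n (\<lambda>x \<xi>. chirp a \<xi>)"
    "tame UNIV (power_weight 0) n (\<lambda>\<xi> x. chirp a x)" for n
    using tame_chirp[OF weight_poly_weight, of UNIV n a] tame_chirp[OF weight_power_weight, of UNIV 0 n a]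
    by (simp_all add: poly_weight_def power_weight_def)
  show "amplitude (\<lambda>x \<xi>. chirp a x)" "amplitude (\<lambda>x \<xi>. chirp a \<xi>)"
    unfolding amplitude_def using 1 2
    by (auto simp: split_def intro!: continuous_intros exI[of _ 0])
qed

section \<open>Symbols as amplitudes\<close>

lemma pderiv_snd_pow: "(pderiv_snd ^^ n) s x = (vderiv ^^ n) (s x)"
proof (induction n)
  case (Suc n)
  have "(pderiv_snd ^^ Suc n) s x = vderiv ((pderiv_snd ^^ n) s x)"
    by (simp add: pderiv_snd_def vderiv_def)
  then show ?case using Suc by simp
qed simp

lemma pderiv_fst_pow: "(pderiv_fst ^^ n) s x y = (vderiv ^^ n) (\<lambda>t. s t y) x"
  by (induction n arbitrary: x) (simp_all add: pderiv_fst_def vderiv_def)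

lemma
  assumes "\<forall>n. Cn_plane n s"
  shows smooth_fst: "smooth (\<lambda>x. s x \<xi>)" and smooth_snd: "smooth (s x)"
proof -
  have 1: "\<forall>n. Cn_plane n ((pderiv_fst ^^ j) s)" for j
  proof (induction j)
    case (Suc j)
    then show ?case using Cn_plane.simps(2) by (metis comp_apply funpow.simps(2))
  qed (use assms in simp)
  have 2: "\<forall>n. Cn_plane n ((pderiv_snd ^^ j) s)" for j
  proof (induction j)
    case (Suc j)
    then show ?case using Cn_plane.simps(2) by (metis comp_apply funpow.simps(2))
  qed (use assms in simp)
  show "smooth (\<lambda>x. s x \<xi>)"
    unfolding smooth_def
  proof (intro allI)
    fix n x
    have "(\<lambda>t. (pderiv_fst ^^ n) s t \<xi>) differentiable (at x)"
      using 1[of n, rule_format, of "Suc 0"] by simp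
    then show "(vderiv ^^ n) (\<lambda>x. s x \<xi>) differentiable (at x)"
      by (simp add: pderiv_fst_pow)
  qed
  show "smooth (s x)"
    unfolding smooth_def
  proof (intro allI)
    fix n \<xi>
    have "(\<lambda>t. (pderiv_snd ^^ n) s x t) differentiable (at \<xi>)"
      using 2[of n, rule_format, of "Suc 0"] by simp
    then show "(vderiv ^^ n) (s x) differentiable (at \<xi>)"
      by (simp add: pderiv_snd_pow)
  qed
qed

lemma amplitude_cnj_symbol:
  assumes \<sigma>: "\<sigma> \<in> symbol_class m"
  shows "amplitude (\<lambda>x \<xi>. cnj (\<sigma> x \<xi>))"
proof -
  have C: "\<forall>n. Cn_plane n \<sigma>" using \<sigma> by (simp add: symbol_class_def)
  \<comment> \<open>Differentiation in \<open>\<xi>\<close> only lowers the exponent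
    \<open>(m - n) / 2\<close>, and
    \<open>1 + \<xi>\<^sup>2 \<le> (1 + \<bar>\<xi>\<bar>)\<^sup>2\<close>; one exponent therefore
    serves all orders.\<close>
  define M where "M = nat \<lceil>\<bar>m\<bar>\<rceil>"
  have growth: "(1 + \<bar>\<xi>\<bar>\<^sup>2) powr ((m - real n) / 2) \<le> (1 + \<bar>\<xi>\<bar>) ^ M" for \<xi> n
  proof -
    have "(1 + \<bar>\<xi>\<bar>\<^sup>2) powr ((m - real n) / 2) \<le> (1 + \<bar>\<xi>\<bar>\<^sup>2) powr (\<bar>m\<bar> / 2)"
      by (intro powr_mono) auto
    also have "\<dots> \<le> ((1 + \<bar>\<xi>\<bar>)\<^sup>2) powr (\<bar>m\<bar> / 2)"
      by (intro powr_mono2) (auto simp: power2_sum)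
    also have "\<dots> = (1 + \<bar>\<xi>\<bar>) powr \<bar>m\<bar>"
      by (simp add: powr_powr flip: powr_numeral)
    also have "\<dots> \<le> (1 + \<bar>\<xi>\<bar>) powr real M"
      unfolding M_def by (intro powr_mono real_nat_ceiling_ge) auto
    also have "\<dots> = (1 + \<bar>\<xi>\<bar>) ^ M"
      by (rule powr_realpow) simp
    finally show ?thesis .
  qed
  have bound: "\<exists>C. \<forall>x \<xi>. norm ((pderiv_fst ^^ l) ((pderiv_snd ^^ n) \<sigma>) x \<xi>) \<le> C * (1 + \<bar>\<xi>\<bar>) ^ M" for l n
  proof -
    obtain C where C: "\<And>x \<xi>. norm (of_real ((1 + x\<^sup>2) ^ 0) * (pderiv_fst ^^ l) ((pderiv_snd ^^ n) \<sigma>) x \<xi>)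
        \<le> C * (1 + \<bar>\<xi>\<bar>\<^sup>2) powr ((m - real n) / 2)"
      using \<sigma> unfolding symbol_class_def by blast
    have "norm ((pderiv_fst ^^ l) ((pderiv_snd ^^ n) \<sigma>) x \<xi>) \<le> \<bar>C\<bar> * (1 + \<bar>\<xi>\<bar>) ^ M" for x \<xi>
    proof -
      have "norm ((pderiv_fst ^^ l) ((pderiv_snd ^^ n) \<sigma>) x \<xi>) \<le> C * (1 + \<bar>\<xi>\<bar>\<^sup>2) powr ((m - real n) / 2)"
        using C[of x \<xi>] by simp
      also have "\<dots> \<le> \<bar>C\<bar> * (1 + \<bar>\<xi>\<bar>) ^ M"
        by (intro mult_mono growth) auto
      finally show ?thesis .
    qed
    then show ?thesis by blast
  qed
  have "continuous_on UNIV (\<lambda>(x, \<xi>). \<sigma> x \<xi>)"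
    using C Cn_plane.simps(1) by blast
  then have cont: "continuous_on UNIV (\<lambda>(x, \<xi>). cnj (\<sigma> x \<xi>))"
    by (auto simp: split_def intro: continuous_on_cnj)
  have "\<forall>n. tame UNIV poly_weight n \<sigma>"
    unfolding tame_iff
  proof (intro conjI allI ballI)
    show "smooth (\<sigma> x)" for x by (rule smooth_snd[OF C])
    show "poly_bounded UNIV poly_weight (\<lambda>x. (vderiv ^^ n) (\<sigma> x))" for n
    proof -
      obtain C where C: "\<And>x \<xi>. norm ((vderiv ^^ n) (\<sigma> x) \<xi>) \<le> C * (1 + \<bar>\<xi>\<bar>) ^ M"
        using bound[of 0 n] by (auto simp: pderiv_snd_pow)
      show ?thesis
        by (rule poly_boundedI[OF weight_poly_weight, where C = C and M = 0 and L = M])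
          (use C in \<open>simp add: poly_weight_def\<close>)
    qed
  qed
  moreover have "\<forall>n. tame UNIV (power_weight M) n (\<lambda>\<xi> x. \<sigma> x \<xi>)"
    unfolding tame_iff
  proof (intro conjI allI ballI)
    show "smooth (\<lambda>x. \<sigma> x \<xi>)" for \<xi> by (rule smooth_fst[OF C])
    show "poly_bounded UNIV (power_weight M) (\<lambda>\<xi>. (vderiv ^^ n) (\<lambda>x. \<sigma> x \<xi>))" for n
    proof -
      obtain C where C: "\<And>x \<xi>. norm ((vderiv ^^ n) (\<lambda>x. \<sigma> x \<xi>) x) \<le> C * (1 + \<bar>\<xi>\<bar>) ^ M"
        using bound[of n 0] by (auto simp: pderiv_fst_pow)
      show ?thesis
        by (rule poly_boundedI[OF weight_power_weight, where C = C and M = 0 and L = 0])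
          (use C in \<open>simp add: power_weight_def\<close>)
    qed
  qed
  ultimately show ?thesis
    unfolding amplitude_def using cont tame_cnj by blast
qed

section \<open>Smoothness and decay of the oscillatory integrals\<close>

lemma
  assumes "smooth g"
  shows vderiv_pow_mult_right: "(vderiv ^^ n) (\<lambda>x. g x * c) = (\<lambda>x. (vderiv ^^ n) g x * c)"
    and smooth_mult_right: "smooth (\<lambda>x. g x * c)"
proof -
  have deriv: "((\<lambda>x. (vderiv ^^ n) g x * c) has_vector_derivative (vderiv ^^ Suc n) g x * c) (at x)" for n x
    by (rule has_vector_derivative_mult_left[OF smooth_has_vector_derivative[OF assms]])
  have eq: "(vderiv ^^ n) (\<lambda>x. g x * c) = (\<lambda>x. (vderiv ^^ n) g x * c)" for n
  proof (induction n)
    case (Suc n)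
    have "vderiv ((vderiv ^^ n) (\<lambda>x. g x * c)) = (\<lambda>x. (vderiv ^^ Suc n) g x * c)"
      unfolding Suc.IH by (rule vderiv_eqI[OF deriv])
    then show ?case by simp
  qed simp
  show "(vderiv ^^ n) (\<lambda>x. g x * c) = (\<lambda>x. (vderiv ^^ n) g x * c)" by (rule eq)
  show "smooth (\<lambda>x. g x * c)"
    unfolding smooth_def eq using deriv differentiableI_vector by blast
qed

definition osc_op :: "real \<Rightarrow> real \<Rightarrow> (real \<Rightarrow> real \<Rightarrow> complex) \<Rightarrow> (real \<Rightarrow> complex) \<Rightarrow> real \<Rightarrow> complex" where
  "osc_op k c s g \<xi> = (LINT x|dunkl_measure k. s x \<xi> * dunkl_kernel k (c * \<xi>) x * g x)"

text \<open>The Dunkl kernel depends on the product of its arguments only, so the factor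
  \<open>c\<close> can be moved from \<open>\<xi>\<close> to the parameter \<open>x\<close>, where
  it costs a power of \<open>1 + \<bar>c\<bar>\<close> in the weight.\<close>

lemma tame_osc_kernel:
  assumes k: "k \<ge> - 1 / 2" and s: "amplitude s"
  shows "tame UNIV poly_weight n (\<lambda>x \<xi>. s x \<xi> * dunkl_kernel k (c * \<xi>) x)"
proof (rule tame_mult_poly_weight)
  show "tame UNIV poly_weight n s" using s by (simp add: amplitude_def)
  have "tame UNIV poly_weight n (\<lambda>x. dunkl_kernel k (c * x))"
  proof (rule tame_reweight[OF weight_poly_weight tame_dunkl_kernel[OF k], where \<pi> = "(*) c"])
    fix N
    have "poly_weight N (c * x) \<le> (1 + \<bar>c\<bar>) ^ N * poly_weight N x" for x
      unfolding poly_weight_def power_mult_distrib[symmetric]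
      by (intro power_mono) (auto simp: abs_mult algebra_simps)
    then show "\<exists>C M. \<forall>x\<in>UNIV. poly_weight N (c * x) \<le> C * poly_weight M x" by blast
  qed auto
  moreover have "(\<lambda>x. dunkl_kernel k (c * x)) = (\<lambda>x \<xi>. dunkl_kernel k (c * \<xi>) x)"
    by (intro ext) (simp add: dunkl_kernel_def mult_ac)
  ultimately show "tame UNIV poly_weight n (\<lambda>x \<xi>. dunkl_kernel k (c * \<xi>) x)"
    by simp
qed

lemma borel_measurable_osc_kernel:
  assumes k: "k \<ge> - 1 / 2" and s: "amplitude s" and g: "g \<in> schwartz"
  shows "(\<lambda>x. s x \<xi> * dunkl_kernel k (c * \<xi>) x * g x) \<in> borel_measurable borel"
proof -
  have "continuous_on UNIV ((\<lambda>(x, \<xi>). s x \<xi>) \<circ> (\<lambda>x. (x, \<xi>)))"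
    using s by (intro continuous_on_compose continuous_intros)
      (auto simp: amplitude_def intro: continuous_on_subset)
  then have s': "continuous_on UNIV (\<lambda>x. s x \<xi>)" by (simp add: o_def)
  have "continuous_on UNIV (\<lambda>x. dunkl_kernel k (c * \<xi>) x)"
    using k by (intro continuous_intros)
  moreover have "continuous_on UNIV g"
    using g by (intro smooth_continuous_on_0 schwartz_smooth)
  ultimately show ?thesis
    by (intro borel_measurable_continuous_onI continuous_on_mult s')
qed

lemma
  assumes k: "k \<ge> - 1 / 2" and s: "amplitude s"
  shows tame_osc_op: "\<forall>n. tame schwartz schwartz_norm n (osc_op k c s)"
    and integrable_osc_op: "g \<in> schwartz \<Longrightarrow>
      integrable (dunkl_measure k) (\<lambda>x. s x \<xi> * dunkl_kernel k (c * \<xi>) x * g x)"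
proof -
  define L where "L = dunkl_decay k"
  define \<Phi> where "\<Phi> = (\<lambda>x \<xi>. s x \<xi> * dunkl_kernel k (c * \<xi>) x)"
  have \<Phi>: "(\<forall>x. smooth (\<Phi> x)) \<and> (\<forall>n. poly_bounded UNIV poly_weight (\<lambda>x. (vderiv ^^ n) (\<Phi> x)))"
    using tame_iff[of UNIV poly_weight \<Phi>] tame_osc_kernel[OF k s] by (simp add: \<Phi>_def)
  \<comment> \<open>The exponent \<open>A n\<close> may grow with the order of the derivative, since
    only polynomial growth in \<open>\<xi>\<close> is wanted.\<close>
  then obtain A where A: "\<And>n x \<xi>. norm ((vderiv ^^ n) (\<Phi> x) \<xi>)
      \<le> real (A n) * (1 + \<bar>x\<bar>) ^ A n * (1 + \<bar>\<xi>\<bar>) ^ A n"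
    unfolding poly_bounded_def poly_weight_def by (metis UNIV_I)
  have smooth: "smooth (\<Phi> x)" for x using \<Phi> by blast
  \<comment> \<open>The decay of \<open>g\<close> is spent twice: \<open>A n\<close> powers absorb
    the growth of the kernel in \<open>x\<close>, and \<open>L\<close> powers make the result
    integrable.\<close>
  have ptw: "(1 + \<bar>x\<bar>) ^ L * norm ((vderiv ^^ n) (\<lambda>\<xi>. \<Phi> x \<xi> * g x) \<xi>)
      \<le> real (A n) * 2 ^ (L + A n) * schwartz_norm (L + A n) g * (1 + \<bar>\<xi>\<bar>) ^ A n" (is "_ \<le> ?B n g \<xi>")
    if g: "g \<in> schwartz" for g n x \<xi>
  proof -
    have "(1 + \<bar>x\<bar>) ^ L * norm ((vderiv ^^ n) (\<lambda>\<xi>. \<Phi> x \<xi> * g x) \<xi>)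
        = norm ((vderiv ^^ n) (\<Phi> x) \<xi>) * ((1 + \<bar>x\<bar>) ^ L * norm (g x))"
      unfolding vderiv_pow_mult_right[OF smooth] by (simp add: norm_mult)
    also have "\<dots> \<le> (real (A n) * (1 + \<bar>x\<bar>) ^ A n * (1 + \<bar>\<xi>\<bar>) ^ A n) * ((1 + \<bar>x\<bar>) ^ L * norm (g x))"
      by (intro mult_right_mono A) auto
    also have "\<dots> = (real (A n) * (1 + \<bar>\<xi>\<bar>) ^ A n) * ((1 + \<bar>x\<bar>) ^ (L + A n) * norm (g x))"
      by (simp add: power_add)
    also have "\<dots> \<le> (real (A n) * (1 + \<bar>\<xi>\<bar>) ^ A n) * (2 ^ (L + A n) * schwartz_norm (L + A n) g)"
      using schwartz_norm_bound[OF g, of "L + A n" "L + A n" 0 x] by (intro mult_left_mono) auto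
    finally show ?thesis by (simp add: mult_ac)
  qed
  have int: "smooth (osc_op k c s g)"
    "(vderiv ^^ n) (osc_op k c s g) = (\<lambda>\<xi>. LINT x|dunkl_measure k. (vderiv ^^ n) (\<lambda>\<xi>. \<Phi> x \<xi> * g x) \<xi>)"
    "integrable (dunkl_measure k) (\<lambda>x. (vderiv ^^ n) (\<lambda>\<xi>. \<Phi> x \<xi> * g x) \<xi>)"
    if g: "g \<in> schwartz" for g n \<xi>
  proof -
    have meas: "(\<lambda>x. \<Phi> x \<xi> * g x) \<in> borel_measurable (dunkl_measure k)" for \<xi>
      using borel_measurable_osc_kernel[OF k s g] by (simp add: \<Phi>_def)
    have dom: "\<exists>G. integrable (dunkl_measure k) G \<and> (\<forall>x\<in>space (dunkl_measure k). \<forall>\<xi>. \<bar>\<xi>\<bar> \<le> R \<longrightarrow>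
        norm ((vderiv ^^ n) (\<lambda>\<xi>. \<Phi> x \<xi> * g x) \<xi>) \<le> G x)" for n R
    proof (intro exI conjI ballI allI impI)
      show "integrable (dunkl_measure k) (\<lambda>x. ?B n g R * (1 / (1 + \<bar>x\<bar>) ^ dunkl_decay k))"
        by (intro integrable_mult_right integrable_dunkl_decay k)
      fix x \<xi> :: real assume \<xi>: "\<bar>\<xi>\<bar> \<le> R"
      have "(1 + \<bar>x\<bar>) ^ L * norm ((vderiv ^^ n) (\<lambda>\<xi>. \<Phi> x \<xi> * g x) \<xi>) \<le> ?B n g \<xi>"
        by (rule ptw[OF g])
      also have "\<dots> \<le> ?B n g R"
        using \<xi> by (intro mult_left_mono power_mono mult_nonneg_nonneg weight_nonneg[OF weight_schwartz_norm g]) auto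
      finally show "norm ((vderiv ^^ n) (\<lambda>\<xi>. \<Phi> x \<xi> * g x) \<xi>) \<le> ?B n g R * (1 / (1 + \<bar>x\<bar>) ^ dunkl_decay k)"
        by (simp add: L_def pos_le_divide_eq mult.commute)
    qed
    have osc: "osc_op k c s g = (\<lambda>\<xi>. LINT x|dunkl_measure k. \<Phi> x \<xi> * g x)"
      by (auto simp: osc_op_def \<Phi>_def)
    note smooth_integral = smooth_integral[where \<Phi> = "\<lambda>x \<xi>. \<Phi> x \<xi> * g x", OF smooth_mult_right[OF smooth] meas dom]
    show "smooth (osc_op k c s g)"
      "(vderiv ^^ n) (osc_op k c s g) = (\<lambda>\<xi>. LINT x|dunkl_measure k. (vderiv ^^ n) (\<lambda>\<xi>. \<Phi> x \<xi> * g x) \<xi>)"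
      "integrable (dunkl_measure k) (\<lambda>x. (vderiv ^^ n) (\<lambda>\<xi>. \<Phi> x \<xi> * g x) \<xi>)"
      unfolding osc by (rule smooth_integral)+
  qed
  show "integrable (dunkl_measure k) (\<lambda>x. s x \<xi> * dunkl_kernel k (c * \<xi>) x * g x)" if "g \<in> schwartz"
    using int(3)[OF that, of 0] by (simp add: \<Phi>_def)
  show "\<forall>n. tame schwartz schwartz_norm n (osc_op k c s)"
    unfolding tame_iff
  proof (intro conjI allI ballI)
    show "smooth (osc_op k c s g)" if "g \<in> schwartz" for g by (rule int(1)[OF that])
    fix n
    show "poly_bounded schwartz schwartz_norm (\<lambda>g. (vderiv ^^ n) (osc_op k c s g))"
    proof (rule poly_boundedI[OF weight_schwartz_norm])
      fix g :: "real \<Rightarrow> complex" and \<xi> assume g: "g \<in> schwartz"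
      have "norm (LINT x|dunkl_measure k. (vderiv ^^ n) (\<lambda>\<xi>. \<Phi> x \<xi> * g x) \<xi>) \<le> ?B n g \<xi> * dunkl_const k"
        using borel_measurable_integrable[OF int(3)[OF g]] ptw[OF g]
        by (intro integral_dunkl_bound[OF k]) (simp_all add: L_def)
      then show "norm ((vderiv ^^ n) (osc_op k c s g) \<xi>)
          \<le> (real (A n) * 2 ^ (L + A n) * dunkl_const k) * schwartz_norm (L + A n) g * (1 + \<bar>\<xi>\<bar>) ^ A n"
        unfolding int(2)[OF g] by (simp add: mult_ac)
    qed
  qed
qed

text \<open>The function being transformed, \<open>A (g, \<xi>)\<close>, depends on
  \<open>\<xi>\<close> itself. Taking the pairs \<open>(g, \<xi>)\<close> as parameters gives bounds
  for its Schwartz norms that are uniform up to the factor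
  \<open>(1 + \<bar>\<xi>\<bar>) ^ M\<close>.\<close>

lemma rapid_osc_op:
  assumes k: "k \<ge> - 1 / 2" and s: "amplitude s" and c: "c \<noteq> 0"
  shows "rapid schwartz schwartz_norm (osc_op k c s)"
proof (rule rapidI[OF weight_schwartz_norm])
  fix l
  obtain M where M: "\<And>n. tame UNIV (power_weight M) n (\<lambda>\<xi> x. s x \<xi>)"
    using s unfolding amplitude_def by blast
  define J where "J = (schwartz \<times> UNIV :: ((real \<Rightarrow> complex) \<times> real) set)"
  define U where "U = (\<lambda>N (p :: (real \<Rightarrow> complex) \<times> real). power_weight M N (snd p))"
  define V where "V = (\<lambda>N (p :: (real \<Rightarrow> complex) \<times> real). schwartz_norm N (fst p))"
  define W where "W = (\<lambda>N (p :: (real \<Rightarrow> complex) \<times> real). (1 + \<bar>snd p\<bar>) ^ M * schwartz_norm N (fst p))"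
  have V: "weight J V"
    using weight_schwartz_norm by (auto simp: weight_def J_def V_def)
  have U: "weight J U"
    by (auto simp: weight_def U_def power_weight_def intro: monoI)
  have W: "weight J W"
    using V by (auto simp: weight_def W_def V_def mono_def intro!: mult_left_mono)
  have UV: "U N p * V N' p \<le> W (N + N') p" if "p \<in> J" for p N N'
    using weight_mono[OF V that, of N' "N + N'"]
    by (auto simp: U_def V_def W_def power_weight_def intro: mult_left_mono)
  have tU: "tame J U n (\<lambda>p x. s x (snd p))" for n
    by (rule tame_reindex[OF U M, where \<pi> = snd]) (auto simp: U_def)
  have tV: "tame J V n fst" for n
    by (rule tame_reindex[OF V schwartz_tame, where \<pi> = fst]) (auto simp: V_def J_def)
  have rV: "rapid J V fst"
    by (rule rapid_reindex[OF V schwartz_rapid]) (auto simp: V_def J_def)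
  define A where "A = (\<lambda>p x. s x (snd p) * fst p x)"
  have tA: "\<forall>n. tame J W n A"
    unfolding A_def by (intro allI tame_mult[OF U V W UV tU tV])
  have rA: "rapid J W A"
    unfolding A_def by (rule rapid_mult_poly_bounded[OF U V W UV tame_poly_bounded[OF tU[of 0]] rV])
  \<comment> \<open>The \<open>M\<close> additional powers of decay compensate the growth of the
    Schwartz norms of \<open>A (g, \<xi>)\<close> in \<open>\<xi>\<close> and are cancelled at the
    end.\<close>
  obtain K where K: "\<And>f \<eta>. f \<in> schwartz \<Longrightarrow>
      (1 + \<bar>\<eta>\<bar>) ^ (l + M) * norm (LINT x|dunkl_measure k. f x * dunkl_kernel k \<eta> x) \<le> real K * schwartz_norm K f"
    using dunkl_transform_decay[OF k, of "l + M"] by blast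
  obtain K' where K': "\<And>p. p \<in> J \<Longrightarrow> schwartz_norm K (A p) \<le> real K' * W K' p"
    using schwartz_criterion(2)[OF W tA rA] by blast
  \<comment> \<open>This constant converts decay in the frequency \<open>c * \<xi>\<close> into
    decay in \<open>\<xi>\<close>.\<close>
  define B where "B = 1 + 1 / \<bar>c\<bar>"
  show "\<exists>C M. \<forall>g\<in>schwartz. \<forall>\<xi>. (1 + \<bar>\<xi>\<bar>) ^ l * norm (osc_op k c s g \<xi>) \<le> C * schwartz_norm M g"
  proof (intro exI ballI allI)
    fix g :: "real \<Rightarrow> complex" and \<xi> :: real assume g: "g \<in> schwartz"
    have p: "(g, \<xi>) \<in> J" using g by (simp add: J_def)
    have osc: "osc_op k c s g \<xi> = (LINT x|dunkl_measure k. A (g, \<xi>) x * dunkl_kernel k (c * \<xi>) x)"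
      unfolding osc_op_def A_def by (simp add: mult_ac)
    have "1 + \<bar>\<xi>\<bar> \<le> B * (1 + \<bar>c * \<xi>\<bar>)"
    proof -
      have "B * (1 + \<bar>c * \<xi>\<bar>) = 1 + \<bar>c * \<xi>\<bar> + 1 / \<bar>c\<bar> + \<bar>\<xi>\<bar>"
        using c by (simp add: B_def algebra_simps abs_mult)
      then show ?thesis by simp
    qed
    then have "(1 + \<bar>\<xi>\<bar>) ^ (l + M) \<le> (B * (1 + \<bar>c * \<xi>\<bar>)) ^ (l + M)"
      by (intro power_mono) auto
    then have "(1 + \<bar>\<xi>\<bar>) ^ (l + M) * norm (osc_op k c s g \<xi>)
        \<le> (B * (1 + \<bar>c * \<xi>\<bar>)) ^ (l + M) * norm (osc_op k c s g \<xi>)"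
      by (intro mult_right_mono) auto
    also have "\<dots> = B ^ (l + M) * ((1 + \<bar>c * \<xi>\<bar>) ^ (l + M) * norm (osc_op k c s g \<xi>))"
      by (simp only: power_mult_distrib mult.assoc)
    also have "\<dots> \<le> B ^ (l + M) * (real K * schwartz_norm K (A (g, \<xi>)))"
      unfolding osc by (intro mult_left_mono K schwartz_criterion(1)[OF W tA rA p]) (auto simp: B_def)
    also have "\<dots> \<le> B ^ (l + M) * (real K * (real K' * W K' (g, \<xi>)))"
      by (intro mult_left_mono K' p) (auto simp: B_def)
    also have "\<dots> = (1 + \<bar>\<xi>\<bar>) ^ M * (B ^ (l + M) * real K * real K' * schwartz_norm K' g)"
      by (simp add: W_def)
    finally have "(1 + \<bar>\<xi>\<bar>) ^ M * ((1 + \<bar>\<xi>\<bar>) ^ l * norm (osc_op k c s g \<xi>))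
        \<le> (1 + \<bar>\<xi>\<bar>) ^ M * (B ^ (l + M) * real K * real K' * schwartz_norm K' g)"
      by (simp only: power_add mult_ac)
    then show "(1 + \<bar>\<xi>\<bar>) ^ l * norm (osc_op k c s g \<xi>) \<le> (B ^ (l + M) * real K * real K') * schwartz_norm K' g"
      by (rule mult_left_le_imp_le) simp
  qed
qed

lemma schwartz_operator_osc_op:
  assumes "k \<ge> - 1 / 2" "amplitude s" "c \<noteq> 0"
  shows "schwartz_operator (osc_op k c s)"
  using tame_osc_op[OF assms(1,2)] rapid_osc_op[OF assms] by (rule schwartz_operatorI)

section \<open>Linear operators and the Schwartz topology\<close>

definition schwartz_linear :: "((real \<Rightarrow> complex) \<Rightarrow> real \<Rightarrow> complex) \<Rightarrow> bool" where
  "schwartz_linear A \<longleftrightarrow>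
     (\<forall>f\<in>schwartz. \<forall>g\<in>schwartz. A (\<lambda>x. f x + g x) = (\<lambda>x. A f x + A g x)) \<and>
     (\<forall>z. \<forall>f\<in>schwartz. A (\<lambda>x. z * f x) = (\<lambda>x. z * A f x))"

lemma schwartz_linear_add:
  "schwartz_linear A \<Longrightarrow> f \<in> schwartz \<Longrightarrow> g \<in> schwartz \<Longrightarrow> A (\<lambda>x. f x + g x) = (\<lambda>x. A f x + A g x)"
  by (simp add: schwartz_linear_def)

lemma schwartz_linear_cmult:
  "schwartz_linear A \<Longrightarrow> f \<in> schwartz \<Longrightarrow> A (\<lambda>x. z * f x) = (\<lambda>x. z * A f x)"
  by (simp add: schwartz_linear_def)

text \<open>The criterion for families applies with pairs of Schwartz functions as parameters and
  the sum of their norms as weight.\<close>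

lemma schwartz_add:
  assumes "f \<in> schwartz" "g \<in> schwartz"
  shows "(\<lambda>x. f x + g x) \<in> schwartz"
proof -
  define W where "W = (\<lambda>N (p :: (real \<Rightarrow> complex) \<times> (real \<Rightarrow> complex)).
    schwartz_norm N (fst p) + schwartz_norm N (snd p))"
  have W: "weight (schwartz \<times> schwartz) W"
    using weight_schwartz_norm by (auto simp: weight_def W_def mono_def intro: add_mono add_nonneg_nonneg)
  have nonneg: "0 \<le> schwartz_norm N f" if "f \<in> schwartz" for f N
    by (rule weight_nonneg[OF weight_schwartz_norm that])
  have "tame (schwartz \<times> schwartz) W n fst" "tame (schwartz \<times> schwartz) W n snd" for n
    by (rule tame_reindex[OF W schwartz_tame]; auto simp: W_def nonneg)+
  then have tame: "\<forall>n. tame (schwartz \<times> schwartz) W n (\<lambda>p x. fst p x + snd p x)"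
    by (intro allI tame_add[OF W])
  have "rapid (schwartz \<times> schwartz) W fst" "rapid (schwartz \<times> schwartz) W snd"
    by (rule rapid_reindex[OF W schwartz_rapid]; auto simp: W_def nonneg)+
  then have "rapid (schwartz \<times> schwartz) W (\<lambda>p x. fst p x + snd p x)"
    by (rule rapid_add[OF W])
  from schwartz_criterion(1)[OF W tame this, of "(f, g)"] assms show ?thesis by simp
qed

lemma schwartz_operator_cmult: "schwartz_operator (\<lambda>f x. z * f x)"
  by (intro schwartz_operatorI allI tame_cmult schwartz_tame rapid_mult_bounded[where K = "norm z"]
      schwartz_rapid weight_schwartz_norm) simp

lemma schwartz_operator_cnj: "schwartz_operator (\<lambda>f x. cnj (f x))"
proof (rule schwartz_operatorI)
  show "\<forall>n. tame schwartz schwartz_norm n (\<lambda>f x. cnj (f x))"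
    by (intro allI tame_cnj schwartz_tame)
  show "rapid schwartz schwartz_norm (\<lambda>f x. cnj (f x))"
    using schwartz_rapid by (simp add: rapid_def)
qed

lemma schwartz_cmult: "f \<in> schwartz \<Longrightarrow> (\<lambda>x. z * f x) \<in> schwartz"
  by (rule schwartz_operator_in[OF schwartz_operator_cmult])

lemma schwartz_cnj: "f \<in> schwartz \<Longrightarrow> (\<lambda>x. cnj (f x)) \<in> schwartz"
  by (rule schwartz_operator_in[OF schwartz_operator_cnj])

lemma schwartz_diff:
  assumes "f \<in> schwartz" "g \<in> schwartz"
  shows "(\<lambda>x. f x - g x) \<in> schwartz"
  using schwartz_add[OF assms(1) schwartz_cmult[OF assms(2), of "- 1"]] by simp

lemma schwartz_linear_diff:
  assumes "schwartz_linear A" "f \<in> schwartz" "g \<in> schwartz"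
  shows "A (\<lambda>x. f x - g x) = (\<lambda>x. A f x - A g x)"
proof -
  have "A (\<lambda>x. f x + (- 1) * g x) = (\<lambda>x. A f x + A (\<lambda>x. (- 1) * g x) x)"
    by (rule schwartz_linear_add[OF assms(1,2) schwartz_cmult[OF assms(3)]])
  also have "A (\<lambda>x. (- 1) * g x) = (\<lambda>x. (- 1) * A g x)"
    by (rule schwartz_linear_cmult[OF assms(1,3)])
  finally show ?thesis by simp
qed

lemma schwartz_linear_compose:
  assumes "schwartz_linear A" "schwartz_linear B" "schwartz_operator B"
  shows "schwartz_linear (\<lambda>f. A (B f))"
  using assms unfolding schwartz_linear_def by (simp add: schwartz_operator_in)

lemma vderiv_pow_add:
  assumes "smooth f" "smooth g"
  shows "(vderiv ^^ n) (\<lambda>x. f x + g x) = (\<lambda>x. (vderiv ^^ n) f x + (vderiv ^^ n) g x)"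
proof (induction n)
  case (Suc n)
  have "vderiv ((vderiv ^^ n) (\<lambda>x. f x + g x)) = (\<lambda>x. (vderiv ^^ Suc n) f x + (vderiv ^^ Suc n) g x)"
    unfolding Suc.IH
    by (intro vderiv_eqI has_vector_derivative_add smooth_has_vector_derivative assms)
  then show ?case by simp
qed simp

lemma schwartz_seminorm_triangle:
  assumes f: "f \<in> schwartz" and g: "g \<in> schwartz"
  shows "schwartz_seminorm l n (\<lambda>x. f x + g x) \<le> schwartz_seminorm l n f + schwartz_seminorm l n g"
  unfolding schwartz_seminorm_def[of l n "\<lambda>x. f x + g x"]
proof (rule cSUP_least)
  fix x
  have "\<bar>x\<bar> ^ l * norm ((vderiv ^^ n) (\<lambda>x. f x + g x) x)
      \<le> \<bar>x\<bar> ^ l * (norm ((vderiv ^^ n) f x) + norm ((vderiv ^^ n) g x))"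
    unfolding vderiv_pow_add[OF schwartz_smooth[OF f] schwartz_smooth[OF g]]
    by (intro mult_left_mono norm_triangle_ineq) auto
  also have "\<dots> \<le> schwartz_seminorm l n f + schwartz_seminorm l n g"
    unfolding distrib_left by (intro add_mono schwartz_seminorm_ge f g)
  finally show "\<bar>x\<bar> ^ l * norm ((vderiv ^^ n) (\<lambda>x. f x + g x) x)
      \<le> schwartz_seminorm l n f + schwartz_seminorm l n g" .
qed simp

lemma openin_schwartz_ball:
  assumes "f \<in> schwartz" "0 < e"
  shows "openin schwartz_topology {g \<in> schwartz. schwartz_seminorm l n (\<lambda>x. g x - f x) < e}"
  unfolding schwartz_topology_def by (rule topology_generated_by_Basis) (use assms in blast)

text \<open>It suffices to look at preimages of subbasic balls. By linearity and the norm estimate,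
  such a preimage contains around each of its points a finite intersection of balls of one small
  radius.\<close>

lemma continuous_map_schwartz_operator:
  assumes op: "schwartz_operator A" and lin: "schwartz_linear A"
  shows "continuous_map schwartz_topology schwartz_topology A"
proof -
  have "continuous_map schwartz_topology (topology_generated_by
      {{g \<in> schwartz. schwartz_seminorm l n (\<lambda>x. g x - f x) < e} | f l n e. f \<in> schwartz \<and> 0 < e}) A"
  proof (rule continuous_on_generated_topo)
    show "A ` topspace schwartz_topology \<subseteq>
        \<Union> {{g \<in> schwartz. schwartz_seminorm l n (\<lambda>x. g x - f x) < e} | f l n e. f \<in> schwartz \<and> 0 < e}"
    proof -
      have "\<Union> {{g \<in> schwartz. schwartz_seminorm l n (\<lambda>x. g x - f x) < e} | f l n e. f \<in> schwartz \<and> 0 < e}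
          = schwartz"
        using topspace_schwartz_topology unfolding schwartz_topology_def topology_generated_by_topspace .
      then show ?thesis
        using op by (auto simp: topspace_schwartz_topology schwartz_operator_in)
    qed
    fix U assume "U \<in> {{g \<in> schwartz. schwartz_seminorm l n (\<lambda>x. g x - f x) < e} | f l n e. f \<in> schwartz \<and> 0 < e}"
    then obtain f l n e where f: "f \<in> schwartz" and e: "0 < e"
      and U: "U = {g \<in> schwartz. schwartz_seminorm l n (\<lambda>x. g x - f x) < e}" by blast
    obtain K where K: "\<And>g. g \<in> schwartz \<Longrightarrow> schwartz_norm (l + n) (A g) \<le> real K * schwartz_norm K g"
      using op unfolding schwartz_operator_def by blast
    show "openin schwartz_topology (A -` U \<inter> topspace schwartz_topology)"
    proof (subst openin_subopen, intro ballI)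
      fix \<phi> assume "\<phi> \<in> A -` U \<inter> topspace schwartz_topology"
      then have \<phi>: "\<phi> \<in> schwartz" and A\<phi>: "A \<phi> \<in> schwartz"
        and less: "schwartz_seminorm l n (\<lambda>x. A \<phi> x - f x) < e"
        by (auto simp: U topspace_schwartz_topology)
      define r where "r = e - schwartz_seminorm l n (\<lambda>x. A \<phi> x - f x)"
      \<comment> \<open>The norm with index \<open>K\<close> sums \<open>(K + 1)\<^sup>2\<close>
        seminorms, each below \<open>\<delta>\<close>; the added 1 keeps \<open>c\<close> positive
        and makes the estimate strict. The bound to be met is \<open>r\<close>, the slack left by
        the triangle inequality.\<close>
      define c where "c = real K * (real (Suc K) * real (Suc K)) + 1"
      define \<delta> where "\<delta> = r / c"
      have c: "c > 0" by (simp add: c_def add_nonneg_pos)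
      have r: "r > 0" using less by (simp add: r_def)
      have \<delta>: "\<delta> > 0" using r c by (simp add: \<delta>_def)
      define T where "T = (\<Inter>(i, j)\<in>{..K} \<times> {..K}. {g \<in> schwartz. schwartz_seminorm i j (\<lambda>x. g x - \<phi> x) < \<delta>})"
      have "openin schwartz_topology T"
        unfolding T_def by (intro openin_INT2) (auto intro: openin_schwartz_ball[OF \<phi> \<delta>])
      moreover have "\<phi> \<in> T"
      proof -
        have "smooth (\<lambda>x. 0 :: complex)" "(vderiv ^^ j) (\<lambda>x. 0 :: complex) = (\<lambda>x. 0)" for j
          using smooth_mult_right[OF schwartz_smooth[OF \<phi>], of 0] vderiv_pow_mult_right[OF schwartz_smooth[OF \<phi>], of j 0]
          by simp_all
        then show ?thesis using \<phi> \<delta> by (simp add: T_def schwartz_seminorm_def)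
      qed
      moreover have "T \<subseteq> A -` U \<inter> topspace schwartz_topology"
      proof
        fix g assume g: "g \<in> T"
        have gS: "g \<in> schwartz" using g by (auto simp: T_def)
        have d: "(\<lambda>x. g x - \<phi> x) \<in> schwartz" by (rule schwartz_diff[OF gS \<phi>])
        have "schwartz_norm K (\<lambda>x. g x - \<phi> x) \<le> (\<Sum>i\<le>K. \<Sum>j\<le>K. \<delta>)"
          unfolding schwartz_norm_def using g by (intro sum_mono) (auto simp: T_def intro: less_imp_le)
        also have "\<dots> = real (Suc K) * real (Suc K) * \<delta>" by simp
        finally have "real K * schwartz_norm K (\<lambda>x. g x - \<phi> x) \<le> real K * (real (Suc K) * real (Suc K) * \<delta>)"
          by (rule mult_left_mono) simp
        also have "\<dots> < c * \<delta>" using \<delta> by (simp add: c_def distrib_right mult.assoc del: of_nat_Suc)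
        also have "\<dots> = r" using c by (simp add: \<delta>_def)
        finally have small: "schwartz_norm (l + n) (A (\<lambda>x. g x - \<phi> x)) < r"
          using K[OF d] by simp
        have Ad: "A (\<lambda>x. g x - \<phi> x) \<in> schwartz" by (rule schwartz_operator_in[OF op d])
        have "(\<lambda>x. A g x - f x) = (\<lambda>x. A (\<lambda>x. g x - \<phi> x) x + (A \<phi> x - f x))"
          unfolding schwartz_linear_diff[OF lin gS \<phi>] by simp
        then have "schwartz_seminorm l n (\<lambda>x. A g x - f x)
            \<le> schwartz_seminorm l n (A (\<lambda>x. g x - \<phi> x)) + schwartz_seminorm l n (\<lambda>x. A \<phi> x - f x)"
          using schwartz_seminorm_triangle[OF Ad schwartz_diff[OF A\<phi> f]] by simp
        also have "\<dots> < r + schwartz_seminorm l n (\<lambda>x. A \<phi> x - f x)"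
          using small schwartz_seminorm_le_norm[OF Ad, of l "l + n" n] by simp
        finally show "g \<in> A -` U \<inter> topspace schwartz_topology"
          using gS schwartz_operator_in[OF op gS] by (simp add: U topspace_schwartz_topology r_def)
      qed
      ultimately show "\<exists>T. openin schwartz_topology T \<and> \<phi> \<in> T \<and> T \<subseteq> A -` U \<inter> topspace schwartz_topology"
        by blast
    qed
  qed
  then show ?thesis by (simp only: schwartz_topology_def)
qed

text \<open>The transpose of a continuous linear operator is weak-* continuous because its value at a test
  function \<open>\<phi>\<close> is an evaluation, at \<open>A \<phi>\<close>.\<close>

lemma continuous_map_transpose:
  assumes op: "schwartz_operator A" and lin: "schwartz_linear A"
  shows "continuous_map weak_star_topology weak_star_topology (\<lambda>u. \<lambda>\<phi>\<in>schwartz. u (A \<phi>))"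
  unfolding weak_star_topology_def
proof (rule continuous_map_into_subtopology)
  show "continuous_map (subtopology (product_topology (\<lambda>_. euclidean) schwartz) tempered_distributions)
      (product_topology (\<lambda>_. euclidean) schwartz) (\<lambda>u. \<lambda>\<phi>\<in>schwartz. u (A \<phi>))"
  proof (rule continuous_map_coordinatewise_then_product)
    fix \<phi> :: "real \<Rightarrow> complex" assume \<phi>: "\<phi> \<in> schwartz"
    then show "continuous_map (subtopology (product_topology (\<lambda>_. euclidean) schwartz) tempered_distributions)
        euclidean (\<lambda>u. (\<lambda>\<phi>\<in>schwartz. u (A \<phi>)) \<phi>)"
      using continuous_map_from_subtopology[OF continuous_map_product_projection[OF schwartz_operator_in[OF op \<phi>]]]
      by simp
  qed simp
  show "(\<lambda>u. \<lambda>\<phi>\<in>schwartz. u (A \<phi>)) \<in> topspace (subtopology (product_topology (\<lambda>_. euclidean) schwartz)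
      tempered_distributions) \<rightarrow> tempered_distributions"
  proof
    fix u :: "(real \<Rightarrow> complex) \<Rightarrow> complex"
    assume "u \<in> topspace (subtopology (product_topology (\<lambda>_. euclidean) schwartz) tempered_distributions)"
    then have u: "\<And>f g. f \<in> schwartz \<Longrightarrow> g \<in> schwartz \<Longrightarrow> u (\<lambda>x. f x + g x) = u f + u g"
      "\<And>z f. f \<in> schwartz \<Longrightarrow> u (\<lambda>x. z * f x) = z * u f"
      "continuous_map schwartz_topology euclidean u"
      by (auto simp: tempered_distributions_def)
    have "continuous_map schwartz_topology euclidean (\<lambda>\<phi>\<in>schwartz. u (A \<phi>))"
    proof (rule continuous_map_eq)
      show "continuous_map schwartz_topology euclidean (u \<circ> A)"
        using continuous_map_compose[OF continuous_map_schwartz_operator[OF op lin] u(3)] .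
    qed (simp add: topspace_schwartz_topology)
    moreover have "A (\<lambda>x. f x + g x) = (\<lambda>x. A f x + A g x)" "A (\<lambda>x. z * f x) = (\<lambda>x. z * A f x)"
      if "f \<in> schwartz" "g \<in> schwartz" for f g z
      using lin that unfolding schwartz_linear_def by blast+
    ultimately show "(\<lambda>\<phi>\<in>schwartz. u (A \<phi>)) \<in> tempered_distributions"
      unfolding tempered_distributions_def
      by (simp add: schwartz_add schwartz_cmult schwartz_operator_in[OF op] u)
  qed
qed

section \<open>The adjoint of the pseudo-differential operator\<close>

text \<open>The Schwartz factors absorb any polynomial growth of \<open>K\<close>, so the integrand
  is dominated by a product of integrable functions of one variable. Joint continuity gives
  measurability for the product measure.\<close>

lemma dunkl_fubini:
  assumes k: "k \<ge> - 1 / 2" and f: "f \<in> schwartz" and g: "g \<in> schwartz"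
    and cont: "continuous_on UNIV (\<lambda>(x, y). K x y)"
    and bound: "\<And>x y. norm (K x y) \<le> C * (1 + \<bar>x\<bar>) ^ N * (1 + \<bar>y\<bar>) ^ N"
  shows "(LINT x|dunkl_measure k. LINT y|dunkl_measure k. K x y * f x * g y)
    = (LINT y|dunkl_measure k. LINT x|dunkl_measure k. K x y * f x * g y)"
proof -
  let ?\<mu> = "dunkl_measure k"
  interpret pair_sigma_finite ?\<mu> ?\<mu>
    by (simp add: pair_sigma_finite_def sigma_finite_dunkl_measure)
  define L where "L = dunkl_decay k"
  define F :: "real \<Rightarrow> real" where "F = (\<lambda>x. 1 / (1 + \<bar>x\<bar>) ^ L)"
  have F: "integrable ?\<mu> F" unfolding F_def L_def by (rule integrable_dunkl_decay[OF k])
  have F_nonneg: "0 \<le> F x" for x by (simp add: F_def)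
  have sets: "sets (?\<mu> \<Otimes>\<^sub>M ?\<mu>) = sets borel"
    using sets_pair_measure_cong[OF sets_dunkl_measure sets_dunkl_measure] unfolding borel_prod .
  have dec: "\<exists>c\<ge>0. \<forall>x. (1 + \<bar>x\<bar>) ^ N * norm (f x) \<le> c * F x" if f: "f \<in> schwartz" for f
  proof (intro exI conjI allI)
    show "0 \<le> 2 ^ (N + L) * schwartz_norm (N + L) f"
      by (intro mult_nonneg_nonneg weight_nonneg[OF weight_schwartz_norm f]) auto
    show "(1 + \<bar>x\<bar>) ^ N * norm (f x) \<le> 2 ^ (N + L) * schwartz_norm (N + L) f * F x" for x
      using schwartz_norm_bound[OF f, of "N + L" "N + L" 0 x]
      by (simp add: F_def pos_le_divide_eq power_add mult_ac)
  qed
  obtain cf where cf: "0 \<le> cf" "\<And>x. (1 + \<bar>x\<bar>) ^ N * norm (f x) \<le> cf * F x" using dec[OF f] by blast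
  obtain cg where cg: "0 \<le> cg" "\<And>x. (1 + \<bar>x\<bar>) ^ N * norm (g x) \<le> cg * F x" using dec[OF g] by blast
  have C: "0 \<le> C" using order_trans[OF norm_ge_zero bound[of 0 0]] by simp
  have FF: "integrable (?\<mu> \<Otimes>\<^sub>M ?\<mu>) (\<lambda>(x, y). F x * F y)"
  proof (rule Fubini_integrable)
    show "(\<lambda>(x, y). F x * F y) \<in> borel_measurable (?\<mu> \<Otimes>\<^sub>M ?\<mu>)"
      unfolding F_def by measurable
    show "integrable ?\<mu> (\<lambda>x. LINT y|?\<mu>. norm (case (x, y) of (x, y) \<Rightarrow> F x * F y))"
      using F by (simp add: F_nonneg abs_mult)
    show "AE x in ?\<mu>. integrable ?\<mu> (\<lambda>y. case (x, y) of (x, y) \<Rightarrow> F x * F y)"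
      using F by simp
  qed
  have "integrable (?\<mu> \<Otimes>\<^sub>M ?\<mu>) (\<lambda>(x, y). K x y * f x * g y)"
  proof (rule integrable_dominated)
    show "integrable (?\<mu> \<Otimes>\<^sub>M ?\<mu>) (\<lambda>p. (C * cf * cg) * (case p of (x, y) \<Rightarrow> F x * F y))"
      by (intro integrable_mult_right FF)
    have "continuous_on UNIV (\<lambda>p. (\<lambda>(x, y). K x y) p * f (fst p) * g (snd p))"
      by (intro continuous_on_mult cont continuous_on_compose2[OF smooth_continuous_on_0[OF schwartz_smooth[OF f], of UNIV]]
          continuous_on_compose2[OF smooth_continuous_on_0[OF schwartz_smooth[OF g], of UNIV]] continuous_intros) auto
    then have "(\<lambda>(x, y). K x y * f x * g y) \<in> borel_measurable borel"
      by (intro borel_measurable_continuous_onI) (simp add: split_def)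
    then show "(\<lambda>(x, y). K x y * f x * g y) \<in> borel_measurable (?\<mu> \<Otimes>\<^sub>M ?\<mu>)"
      using measurable_cong_sets[OF sets refl] by blast
    fix p :: "real \<times> real"
    obtain x y where p: "p = (x, y)" by (cases p)
    have "norm (K x y * f x * g y) \<le> (C * (1 + \<bar>x\<bar>) ^ N * (1 + \<bar>y\<bar>) ^ N) * norm (f x) * norm (g y)"
      unfolding norm_mult by (intro mult_right_mono bound) auto
    also have "\<dots> = C * (((1 + \<bar>x\<bar>) ^ N * norm (f x)) * ((1 + \<bar>y\<bar>) ^ N * norm (g y)))"
      by (simp add: mult_ac)
    also have "\<dots> \<le> C * ((cf * F x) * (cg * F y))"
      by (intro mult_left_mono mult_mono cf cg C mult_nonneg_nonneg F_nonneg) auto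
    finally show "norm (case p of (x, y) \<Rightarrow> K x y * f x * g y) \<le> (C * cf * cg) * (case p of (x, y) \<Rightarrow> F x * F y)"
      by (simp add: p mult_ac)
  qed
  from Fubini_integral[OF this] show ?thesis by simp
qed

lemma schwartz_linear_osc_op:
  assumes "k \<ge> - 1 / 2" "amplitude s"
  shows "schwartz_linear (osc_op k c s)"
  unfolding schwartz_linear_def
proof (intro conjI ballI allI ext)
  fix f g :: "real \<Rightarrow> complex" and \<xi> assume fg: "f \<in> schwartz" "g \<in> schwartz"
  show "osc_op k c s (\<lambda>x. f x + g x) \<xi> = osc_op k c s f \<xi> + osc_op k c s g \<xi>"
    unfolding osc_op_def distrib_left
    by (rule Bochner_Integration.integral_add) (intro integrable_osc_op assms fg)+
next
  fix z \<xi> and f :: "real \<Rightarrow> complex"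
  show "osc_op k c s (\<lambda>x. z * f x) \<xi> = z * osc_op k c s f \<xi>"
    unfolding osc_op_def integral_mult_right_zero[symmetric] by (simp add: mult_ac)
qed

lemma cnj_chirp: "cnj (chirp a x) = chirp (- a) x"
  by (simp add: chirp_def exp_cnj)

lemma lc_kernel_eq_chirp:
  "lc_kernel k M \<xi> x = chirp (M $ 2 $ 2 / M $ 1 $ 2) \<xi> * chirp (M $ 1 $ 1 / M $ 1 $ 2) x *
     dunkl_kernel k (- 1 / M $ 1 $ 2 * \<xi>) x"
proof -
  have "exp (\<i> / 2 * complex_of_real (r + t)) = exp (\<i> / 2 * of_real r) * exp (\<i> / 2 * of_real t)" for r t
    by (simp add: distrib_left exp_add)
  then show ?thesis by (simp only: lc_kernel_def chirp_def) simp
qed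

text \<open>Conjugation reverses the sign of the chirps and of the frequency in the Dunkl kernel,
  which is exactly the effect of passing to the inverse matrix. All kernels in the proof thus reduce
  to one and its conjugate.\<close>

lemma lc_kernel_inverse:
  assumes "k \<ge> - 1 / 2" "det M = 1"
  shows "lc_kernel k (matrix_inv M) x \<xi> = cnj (lc_kernel k M \<xi> x)"
proof -
  have "cnj (lc_kernel k M \<xi> x) =
      exp (- \<i> / 2 * of_real (M $ 2 $ 2 / M $ 1 $ 2 * \<xi>\<^sup>2 + M $ 1 $ 1 / M $ 1 $ 2 * x\<^sup>2)) *
      dunkl_kernel k (- (- \<xi> / M $ 1 $ 2)) x"
    unfolding lc_kernel_def complex_cnj_mult cnj_dunkl_kernel[OF assms(1)] by (simp add: exp_cnj)
  also have "dunkl_kernel k (- (- \<xi> / M $ 1 $ 2)) x = dunkl_kernel k (x / M $ 1 $ 2) \<xi>"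
    by (simp add: dunkl_kernel_def mult.commute)
  finally show ?thesis
    unfolding lc_kernel_matrix_inv[OF assms(2)] by (simp only: add.commute)
qed

text \<open>The first conjunct confirms that the explicit double integral is the adjoint with
  respect to \<open>dunkl_inner\<close>, so that \<open>pseudo_op_dist\<close> is built from the
  intended operator.\<close>

theorem proposition3p9:
  fixes k m :: real and M :: "real ^ 2 ^ 2" and \<sigma> :: "real \<Rightarrow> real \<Rightarrow> complex"
  assumes "k \<ge> - 1 / 2"
    and "det M = 1"
    and "M $ 1 $ 2 \<noteq> 0"
    and "\<sigma> \<in> symbol_class m"
  shows "schwartz_adjoint k (pseudo_op k M \<sigma>) (pseudo_op_adj k M \<sigma>) \<and>
         continuous_map weak_star_topology weak_star_topology (pseudo_op_dist k M \<sigma>)"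
proof -
  note k = assms(1)
  let ?\<mu> = "dunkl_measure k"
  define b where "b = M $ 1 $ 2"
  define E where "E = lc_kernel k M"
  define c1 where "c1 = 1 / ((\<i> * of_real b) powr of_real (k + 1))"
  define c2 where "c2 = 1 / ((- (\<i> * of_real b)) powr of_real (k + 1))"
  define \<alpha> \<delta> where "\<alpha> = M $ 1 $ 1 / b" and "\<delta> = M $ 2 $ 2 / b"
  have b: "b \<noteq> 0" using assms(3) by (simp add: b_def)
  have E: "E \<xi> x = chirp \<delta> \<xi> * chirp \<alpha> x * dunkl_kernel k (- 1 / b * \<xi>) x" for \<xi> x
    by (simp add: E_def lc_kernel_eq_chirp b_def \<alpha>_def \<delta>_def)
  have Einv: "lc_kernel k (matrix_inv M) x \<xi> = cnj (E \<xi> x)" for x \<xi>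
    unfolding E_def by (rule lc_kernel_inverse[OF k assms(2)])
  have cnj_E: "cnj (E \<xi> x) = chirp (- \<delta>) \<xi> * chirp (- \<alpha>) x * dunkl_kernel k (1 / b * x) \<xi>" for \<xi> x
  proof -
    have "cnj (dunkl_kernel k (- 1 / b * \<xi>) x) = dunkl_kernel k (1 / b * x) \<xi>"
      unfolding cnj_dunkl_kernel[OF k] by (simp add: dunkl_kernel_def mult.commute)
    then show ?thesis by (simp add: E cnj_chirp)
  qed
  have E_bound: "norm (E \<xi> x) \<le> 1" for \<xi> x
    using norm_dunkl_kernel_le_1[OF k] by (simp add: E norm_mult)
  have E_cont: "continuous_on UNIV (\<lambda>(x, \<xi>). E \<xi> x)"
    unfolding E split_def using k b by (intro continuous_intros) auto
  \<comment> \<open>For real \<open>b \<noteq> 0\<close> the base is purely imaginary and nonzero,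
    off the branch cut, so the principal power commutes with conjugation.\<close>
  have c12: "cnj c2 = c1"
  proof -
    have "cnj ((- (\<i> * of_real b)) powr of_real (k + 1)) = (cnj (- (\<i> * of_real b))) powr cnj (of_real (k + 1))"
      using b by (intro cnj_powr) simp
    then show ?thesis by (simp add: c1_def c2_def)
  qed
  have \<sigma>: "amplitude (\<lambda>x \<xi>. cnj (\<sigma> x \<xi>))" by (rule amplitude_cnj_symbol[OF assms(4)])

  define D where "D = osc_op k (- 1 / b) (\<lambda>x \<xi>. c1 * (chirp \<delta> \<xi> * chirp \<alpha> x))"
  define H where "H = osc_op k (- 1 / b) (\<lambda>x \<xi>. cnj (\<sigma> x \<xi>) * (chirp \<delta> \<xi> * chirp \<alpha> x))"
  \<comment> \<open>In the outer integral the integration variable is the frequency, so the chirps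
    trade places; the constant in front becomes part of the amplitude.\<close>
  define R where "R = osc_op k (1 / b) (\<lambda>\<xi> y. c2 * (chirp (- \<delta>) \<xi> * chirp (- \<alpha>) y))"
  note amplitude_intros = amplitude_mult amplitude_const amplitude_chirp_fst amplitude_chirp_snd \<sigma>
  have op: "schwartz_operator D" "schwartz_operator H" "schwartz_operator R"
    unfolding D_def H_def R_def using b
    by (intro schwartz_operator_osc_op k amplitude_intros; simp)+
  have lin: "schwartz_linear H" "schwartz_linear R"
    unfolding H_def R_def by (intro schwartz_linear_osc_op k amplitude_intros)+
  have D_eq: "lc_dunkl k M f \<xi> = D f \<xi>" "D f \<xi> = (LINT x|?\<mu>. c1 * E \<xi> x * f x)" for f \<xi>
  proof -
    show "D f \<xi> = (LINT x|?\<mu>. c1 * E \<xi> x * f x)"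
      unfolding D_def osc_op_def E by (simp add: mult_ac)
    then show "lc_dunkl k M f \<xi> = D f \<xi>"
      unfolding lc_dunkl_def b_def[symmetric] c1_def[symmetric] E_def[symmetric] integral_mult_right_zero[symmetric]
      by (simp add: mult_ac)
  qed
  have H_eq: "H g \<xi> = (LINT x|?\<mu>. cnj (\<sigma> x \<xi>) * E \<xi> x * g x)" for g \<xi>
    unfolding H_def osc_op_def E by (simp add: mult_ac)
  have R_eq: "R h y = c2 * (LINT \<xi>|?\<mu>. cnj (E \<xi> y) * h \<xi>)" for h y
    unfolding R_def osc_op_def cnj_E integral_mult_right_zero[symmetric] by (simp add: mult_ac)
  have adj: "pseudo_op_adj k M \<sigma> = (\<lambda>g. R (H g))"
    unfolding pseudo_op_adj_def R_eq H_eq Einv E_def[symmetric] b_def[symmetric] c2_def[symmetric] ..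
  have adj_op: "schwartz_operator (\<lambda>g. R (H g))"
    by (rule schwartz_operator_compose[OF op(3,2)])

  have inner: "dunkl_inner k (pseudo_op k M \<sigma> f) g = dunkl_inner k f (pseudo_op_adj k M \<sigma> g)"
    if f: "f \<in> schwartz" and g: "g \<in> schwartz" for f g
  proof -
    have "poly_bounded UNIV poly_weight (\<lambda>x \<xi>. cnj (\<sigma> x \<xi>))"
      using \<sigma> tame_poly_bounded unfolding amplitude_def by blast
    then obtain N where N: "\<And>x \<xi>. norm (\<sigma> x \<xi>) \<le> real N * (1 + \<bar>x\<bar>) ^ N * (1 + \<bar>\<xi>\<bar>) ^ N"
      by (auto simp: poly_bounded_def poly_weight_def)
    have "continuous_on UNIV (\<lambda>p. cnj ((\<lambda>(x, \<xi>). cnj (\<sigma> x \<xi>)) p))"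
      using \<sigma> unfolding amplitude_def by (intro continuous_on_cnj) blast
    then have \<sigma>_cont: "continuous_on UNIV (\<lambda>p. \<sigma> (fst p) (snd p))" by (simp add: split_def)
    have Df: "D f \<in> schwartz" and Hg: "(\<lambda>\<xi>. cnj (H g \<xi>)) \<in> schwartz"
      by (rule schwartz_operator_in[OF op(1) f], rule schwartz_cnj[OF schwartz_operator_in[OF op(2) g]])
    \<comment> \<open>The first exchange of integrals isolates the inner integral \<open>H g\<close>
      of the adjoint, with the Schwartz functions \<open>cnj (g x)\<close> and \<open>D f\<close> as
      factors. The second one, after \<open>D f\<close> is written out as an integral, isolates
      \<open>R (H g)\<close>.\<close>
    have "dunkl_inner k (pseudo_op k M \<sigma> f) g
        = (LINT x|?\<mu>. LINT \<xi>|?\<mu>. (\<sigma> x \<xi> * cnj (E \<xi> x)) * cnj (g x) * D f \<xi>)"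
      unfolding dunkl_inner_def pseudo_op_def D_eq(1) Einv integral_mult_left_zero[symmetric]
      by (simp add: mult_ac)
    also have "\<dots> = (LINT \<xi>|?\<mu>. LINT x|?\<mu>. (\<sigma> x \<xi> * cnj (E \<xi> x)) * cnj (g x) * D f \<xi>)"
    proof (rule dunkl_fubini[OF k schwartz_cnj[OF g] Df])
      show "continuous_on UNIV (\<lambda>(x, \<xi>). \<sigma> x \<xi> * cnj (E \<xi> x))"
        using continuous_on_mult[OF \<sigma>_cont continuous_on_cnj[OF E_cont]] by (simp add: split_def)
      show "norm (\<sigma> x \<xi> * cnj (E \<xi> x)) \<le> real N * (1 + \<bar>x\<bar>) ^ N * (1 + \<bar>\<xi>\<bar>) ^ N" for x \<xi>
        using mult_mono[OF N[of x \<xi>] E_bound[of \<xi> x]] by (simp add: norm_mult)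
    qed
    also have "\<dots> = (LINT \<xi>|?\<mu>. D f \<xi> * cnj (H g \<xi>))"
    proof -
      have "(LINT x|?\<mu>. (\<sigma> x \<xi> * cnj (E \<xi> x)) * cnj (g x) * D f \<xi>) = D f \<xi> * cnj (H g \<xi>)" for \<xi>
        unfolding H_eq Bochner_Integration.integral_cnj[symmetric] integral_mult_right_zero[symmetric]
        by (simp add: mult_ac)
      then show ?thesis by (simp only:)
    qed
    also have "\<dots> = (LINT \<xi>|?\<mu>. LINT x|?\<mu>. (c1 * E \<xi> x) * f x * cnj (H g \<xi>))"
      unfolding D_eq(2) integral_mult_left_zero[symmetric] ..
    also have "\<dots> = (LINT x|?\<mu>. LINT \<xi>|?\<mu>. (c1 * E \<xi> x) * f x * cnj (H g \<xi>))"
    proof (rule dunkl_fubini[OF k f Hg, symmetric])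
      show "continuous_on UNIV (\<lambda>(x, \<xi>). c1 * E \<xi> x)"
        using continuous_on_mult_left[OF E_cont] by (simp add: split_def)
      show "norm (c1 * E \<xi> x) \<le> norm c1 * (1 + \<bar>x\<bar>) ^ 0 * (1 + \<bar>\<xi>\<bar>) ^ 0" for x \<xi>
        using mult_left_mono[OF E_bound[of \<xi> x], of "norm c1"] by (simp add: norm_mult)
    qed
    also have "\<dots> = (LINT x|?\<mu>. f x * cnj (R (H g) x))"
    proof -
      have "(LINT \<xi>|?\<mu>. (c1 * E \<xi> x) * f x * cnj (H g \<xi>)) = f x * cnj (R (H g) x)" for x
        unfolding R_eq complex_cnj_mult c12 Bochner_Integration.integral_cnj[symmetric] integral_mult_right_zero[symmetric]
        by (simp add: mult_ac)
      then show ?thesis by (simp only:)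
    qed
    finally show ?thesis by (simp only: dunkl_inner_def adj)
  qed

  \<comment> \<open>The two conjugations make \<open>A\<close> linear rather than antilinear in
    composition with the linear map \<open>\<lambda>g. R (H g)\<close>, since a scalar is conjugated
    twice.\<close>
  define A where "A = (\<lambda>\<phi> y. cnj (pseudo_op_adj k M \<sigma> (\<lambda>x. cnj (\<phi> x)) y))"
  have A_op: "schwartz_operator A"
    unfolding A_def adj
    by (intro schwartz_operator_compose[OF schwartz_operator_cnj]
        schwartz_operator_compose[OF adj_op schwartz_operator_cnj])
  have RH: "schwartz_linear (\<lambda>g. R (H g))"
    by (rule schwartz_linear_compose[OF lin(2,1) op(2)])
  have A_lin: "schwartz_linear A"
    unfolding A_def adj schwartz_linear_def
  proof (intro conjI ballI allI ext)
    fix f g :: "real \<Rightarrow> complex" and y assume "f \<in> schwartz" "g \<in> schwartz"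
    then have "R (H (\<lambda>x. cnj (f x) + cnj (g x))) = (\<lambda>y. R (H (\<lambda>x. cnj (f x))) y + R (H (\<lambda>x. cnj (g x))) y)"
      by (intro schwartz_linear_add[OF RH] schwartz_cnj)
    then show "cnj (R (H (\<lambda>x. cnj (f x + g x))) y) = cnj (R (H (\<lambda>x. cnj (f x))) y) + cnj (R (H (\<lambda>x. cnj (g x))) y)"
      by simp
  next
    fix z and f :: "real \<Rightarrow> complex" and y assume "f \<in> schwartz"
    then have "R (H (\<lambda>x. cnj z * cnj (f x))) = (\<lambda>y. cnj z * R (H (\<lambda>x. cnj (f x))) y)"
      by (intro schwartz_linear_cmult[OF RH] schwartz_cnj)
    then show "cnj (R (H (\<lambda>x. cnj (z * f x))) y) = z * cnj (R (H (\<lambda>x. cnj (f x))) y)"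
      by simp
  qed
  have "pseudo_op_dist k M \<sigma> = (\<lambda>u. \<lambda>\<phi>\<in>schwartz. u (A \<phi>))"
    by (simp add: fun_eq_iff pseudo_op_dist_def A_def)
  then have "continuous_map weak_star_topology weak_star_topology (pseudo_op_dist k M \<sigma>)"
    using continuous_map_transpose[OF A_op A_lin] by simp
  moreover have "schwartz_adjoint k (pseudo_op k M \<sigma>) (pseudo_op_adj k M \<sigma>)"
    unfolding schwartz_adjoint_def using inner schwartz_operator_in[OF adj_op] by (simp add: adj)
  ultimately show ?thesis by blast
qed

end
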